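(* Let $\alpha\in(0,1)$. Let $\theta_0\in L^\infty(\mathbb{R}^2)$ be a positive (i.e. nonnegative and not identically zero), compactly supported initial temperature whose support is contained in the ball of radius $R_0$ centered at the origin, and let $\theta(x,t)$, $t\ge 0$, be a solution of the active scalar flow equation (modified SQG equation with parameter $\alpha$) with initial datum $\theta_0$. Then there exists a constant $C_0\equiv C_0(i_0,R_0,m_0,M_0)$ such that, for every $t\ge 0$, the support of $\theta(\cdot,t)$ is contained in the ball $$|x|<4R_0+C_0\left[t\ln(2+t)\right]^{\frac{1}{4+\alpha}}.$$ Here $m_0=\int\theta_0\,dx$, $M_0=\|\theta_0\|_{L^\infty}$, $i_0=\int|x|^2\theta_0(x)\,dx$.
   Context: The active scalar flow (modified surface quasi-geostrophic, or $\alpha$-patch, model) with parameter $\alpha\in(0,1)$ (fixed) on $\mathbb{R}^2$ is $$\partial_t\theta+u\cdot\nabla\theta=0,\qquad u=\left(\frac{\partial\psi}{\partial x_2},-\frac{\partial\psi}{\partial x_1}\right),\qquad \theta=\Lambda^{2-\alpha}\psi,\quad \Lambda=\sqrt{-\Delta}.$$ Equivalently, $u(x,t)=\int K(x-y)\theta(y,t)\,dy$ with $K=\nabla^\perp G$, $\nabla^\perp=(\partial_{x_2},-\partial_{x_1})$, where $G$ is the Green function of $(-\Delta)^{1-\alpha/2}$ on $\mathbb{R}^2$ vanishing at infinity: $G(x)=c_\alpha|x|^{-\alpha}$, $c_\alpha=\frac{1}{\pi 2^{2-\alpha}}\frac{\Gamma(\alpha/2)}{\Gamma((2-\alpha)/2)}$.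 Solutions are understood in the weak form: for every bounded smooth function $f(x,t)$, writing $\theta[f]=\int\theta(x,t)f(x,t)\,dx$, one has $\frac{d}{dt}\theta[f]=\theta[u\cdot\nabla f]+\theta[\partial_t f]$. The field $u$ is divergence-free and $\theta$ is transported by the flow of $u$ (so $\theta\ge 0$ is preserved). The following quantities are conserved in time for the solutions considered: the total mass $\int\theta(x,t)\,dx=m_0$; the maximum norm $\|\theta(\cdot,t)\|_{L^\infty}=M_0$; the center of mass $\frac{1}{m_0}\int x\,\theta(x,t)\,dx=c_0$; the moment of inertia $\int|x|^2\theta(x,t)\,dx=i_0$. *)

theory Defs
  imports "HOL-Probability.Essential_Supremum"
begin

section \<open>The velocity field\<close>

definition grad :: "(real^2 \<Rightarrow> real) \<Rightarrow> real^2 \<Rightarrow> real^2" where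
  "grad g x = (\<chi> i. frechet_derivative g (at x) (axis i 1))"

definition perp_grad :: "(real^2 \<Rightarrow> real) \<Rightarrow> real^2 \<Rightarrow> real^2" where
  "perp_grad g x = vector [grad g x $ 2, - grad g x $ 1]"

definition green_const :: "real \<Rightarrow> real" where
  "green_const \<alpha> =
     1 / (pi * 2 powr (2 - \<alpha>)) * (Gamma (\<alpha> / 2) / Gamma ((2 - \<alpha>) / 2))"

text \<open>The Green function of the fractional Laplacian of order \<open>1 - \<alpha>/2\<close> on the plane that
  vanishes at infinity.\<close>

definition green :: "real \<Rightarrow> real^2 \<Rightarrow> real" where
  "green \<alpha> x = green_const \<alpha> * norm x powr (- \<alpha>)"

text \<open>The value of the kernel at the origin, where \<open>green\<close> is singular, is unspecified; it does
  not affect the integral below.\<close>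

definition kernel :: "real \<Rightarrow> real^2 \<Rightarrow> real^2" where
  "kernel \<alpha> = perp_grad (green \<alpha>)"

definition velocity :: "real \<Rightarrow> (real^2 \<Rightarrow> real) \<Rightarrow> real^2 \<Rightarrow> real^2" where
  "velocity \<alpha> \<theta> x = (LINT y|lebesgue. \<theta> y *\<^sub>R kernel \<alpha> (x - y))"


section \<open>Bounded functions, essential support, and the conserved quantities\<close>

definition Linfty_norm :: "(real^2 \<Rightarrow> real) \<Rightarrow> real" where
  "Linfty_norm g = real_of_ereal (esssup lebesgue (\<lambda>x. ereal \<bar>g x\<bar>))"

definition in_Linfty :: "(real^2 \<Rightarrow> real) \<Rightarrow> bool" where
  "in_Linfty g \<longleftrightarrow>
     g \<in> borel_measurable lebesgue \<and> esssup lebesgue (\<lambda>x. ereal \<bar>g x\<bar>) < \<infinity>"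

text \<open>The support of an a.e.-equivalence class: the complement of the largest open set on which
  the function vanishes almost everywhere.\<close>

definition ess_support :: "(real^2 \<Rightarrow> real) \<Rightarrow> (real^2) set" where
  "ess_support g = - \<Union> {U. open U \<and> (AE x in lebesgue. x \<in> U \<longrightarrow> g x = 0)}"

definition total_mass :: "(real^2 \<Rightarrow> real) \<Rightarrow> real" where
  "total_mass g = (LINT x|lebesgue. g x)"

definition mass_center :: "(real^2 \<Rightarrow> real) \<Rightarrow> real^2" where
  "mass_center g = (1 / total_mass g) *\<^sub>R (LINT x|lebesgue. g x *\<^sub>R x)"

definition inertia :: "(real^2 \<Rightarrow> real) \<Rightarrow> real" where
  "inertia g = (LINT x|lebesgue. (norm x)\<^sup>2 * g x)"


section \<open>Weak solutions\<close>

primrec Ck :: "nat \<Rightarrow> ('a::euclidean_space \<Rightarrow> real) \<Rightarrow> bool" where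
  "Ck 0 f \<longleftrightarrow> continuous_on UNIV f"
| "Ck (Suc k) f \<longleftrightarrow>
     f differentiable_on UNIV \<and> (\<forall>b\<in>Basis. Ck k (\<lambda>x. frechet_derivative f (at x) b))"

definition smooth :: "('a::euclidean_space \<Rightarrow> real) \<Rightarrow> bool" where
  "smooth f \<longleftrightarrow> (\<forall>k. Ck k f)"

definition dt :: "(real^2 \<Rightarrow> real \<Rightarrow> real) \<Rightarrow> real^2 \<Rightarrow> real \<Rightarrow> real" where
  "dt f x t = deriv (\<lambda>s. f x s) t"

text \<open>The first-order derivatives are required to be bounded too, so that every integral in the
  weak formulation converges although no compactness of the support of a solution at positive
  times is presupposed. This only enlarges the class of weak solutions.\<close>

definition test_function :: "(real^2 \<Rightarrow> real \<Rightarrow> real) \<Rightarrow> bool" where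
  "test_function f \<longleftrightarrow>
     smooth (\<lambda>(x, t). f x t) \<and>
     bounded (range (\<lambda>(x, t). f x t)) \<and>
     bounded (range (\<lambda>(x, t). grad (\<lambda>y. f y t) x)) \<and>
     bounded (range (\<lambda>(x, t). dt f x t))"

text \<open>Solutions are written with the time argument first: \<open>\<theta> t\<close> is the temperature at time \<open>t\<close>.
  The time derivative at \<open>t = 0\<close> is one-sided.\<close>

definition weak_solution ::
  "real \<Rightarrow> (real^2 \<Rightarrow> real) \<Rightarrow> (real \<Rightarrow> real^2 \<Rightarrow> real) \<Rightarrow> bool" where
  "weak_solution \<alpha> \<theta>\<^sub>0 \<theta> \<longleftrightarrow>
     (AE x in lebesgue. \<theta> 0 x = \<theta>\<^sub>0 x) \<and>
     (\<forall>t\<ge>0. in_Linfty (\<theta> t) \<and> integrable lebesgue (\<theta> t)) \<and>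
     (\<forall>f. test_function f \<longrightarrow>
        (\<forall>t\<ge>0. ((\<lambda>s. LINT x|lebesgue. \<theta> s x * f x s) has_real_derivative
            (LINT x|lebesgue. \<theta> t x * (velocity \<alpha> (\<theta> t) x \<bullet> grad (\<lambda>y. f y t) x))
          + (LINT x|lebesgue. \<theta> t x * dt f x t)) (at t within {0..})))"

text \<open>The standing properties of the solutions under consideration. Since the velocity field is in
  general only Hoelder continuous, transport by its flow enters only through the consequences
  listed here.\<close>

definition conserves_invariants :: "(real \<Rightarrow> real^2 \<Rightarrow> real) \<Rightarrow> bool" where
  "conserves_invariants \<theta> \<longleftrightarrow>
     (\<forall>t\<ge>0. integrable lebesgue (\<lambda>x. (norm x)\<^sup>2 * \<theta> t x) \<and>
        total_mass (\<theta> t) = total_mass (\<theta> 0) \<and>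
        Linfty_norm (\<theta> t) = Linfty_norm (\<theta> 0) \<and>
        mass_center (\<theta> t) = mass_center (\<theta> 0) \<and>
        inertia (\<theta> t) = inertia (\<theta> 0))"

definition preserves_nonneg :: "(real \<Rightarrow> real^2 \<Rightarrow> real) \<Rightarrow> bool" where
  "preserves_nonneg \<theta> \<longleftrightarrow>
     ((AE x in lebesgue. 0 \<le> \<theta> 0 x) \<longrightarrow> (\<forall>t\<ge>0. AE x in lebesgue. 0 \<le> \<theta> t x))"

definition active_scalar_solution ::
  "real \<Rightarrow> (real^2 \<Rightarrow> real) \<Rightarrow> (real \<Rightarrow> real^2 \<Rightarrow> real) \<Rightarrow> bool" where
  "active_scalar_solution \<alpha> \<theta>\<^sub>0 \<theta> \<longleftrightarrow>
     weak_solution \<alpha> \<theta>\<^sub>0 \<theta> \<and> conserves_invariants \<theta> \<and> preserves_nonneg \<theta>"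

end

theory Submission
  imports Defs
begin

text \<open>Put the center of mass at the origin and consider the excess
  \<open>V(s, t) = \<integral> (|x|\<^sup>2 - s)\<^sub>+ \<theta>(x, t) dx\<close>. By antisymmetry of the interaction its time derivative
  involves only pairs of points on opposite sides of the circle \<open>|x|\<^sup>2 = s\<close>. It is compared with
  the barrier \<open>16 I (1 - s / S(t))\<^sub>+\<^sup>3\<close>, where \<open>S\<close> grows like \<open>t\<close> to the power \<open>2 / (4 + \<alpha>)\<close>. At
  a maximum of \<open>V\<close> minus the barrier in \<open>s\<close>, the second differences of \<open>V\<close> are at most those of
  the barrier. As the second derivative of \<open>V\<close> is the radial distribution of \<open>\<theta>\<close>, this bounds
  the mass in every annulus around the circle. Hence no concentrated cluster sits there, and
  the nearby pairs contribute a dyadic sum that converges because \<open>\<alpha> < 1\<close>. The distant mass acts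
  only through its second moment, since the first one vanishes. Both contributions are slower
  than the barrier, so \<open>V\<close> never crosses it and vanishes for \<open>s \<ge> S(t)\<close>. The bound obtained for
  the radius is of order \<open>t\<close> to the power \<open>1 / (4 + \<alpha>)\<close>, without the logarithm.\<close>

section \<open>The angular part of the kernel\<close>

text \<open>Why a cube, and why this rate: let \<open>x = S - s\<close>. The barrier rises in time
  at a rate proportional to \<open>x^2\<close>, so the flux must be small at that order and must
  also decay in \<open>S\<close>. Bounding the torque by the maximum norm alone gives no decay in
  \<open>S\<close>. With the cube, the mass beyond the circle is of order \<open>c x^2\<close>, and
  the masses within \<open>k\<close> of the circle (in squared radius) on its two sides have a
  product of order \<open>c^2 x^2 k^2\<close>, for \<open>k\<close> below \<open>x\<close> as well
  as above it. Against a kernel of order \<open>s^(1 + \<alpha>/2) k^(-1 - \<alpha>)\<close> this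
  sums to \<open>s^(2 - \<alpha>/2) c^2 x^2\<close>. For \<open>c = 16 I / S^3\<close> and
  \<open>s\<close> comparable to \<open>S\<close> this matches the distant part,
  \<open>I S^(-1 - \<alpha>/2) c x^2\<close>, and \<open>S' = const * S^(-1 - \<alpha>/2)\<close>
  fixes the growth of the front. Only differences of the excess in \<open>s\<close> enter, so any
  positive maximum serves and no first crossing time is needed. The maximum norm makes the kernel
  integrals converge absolutely and controls the passage from smooth bounded test functions to the
  sharp hinge.\<close>

definition cross2 :: "real^2 \<Rightarrow> real^2 \<Rightarrow> real" where
  "cross2 a b = a $ 1 * b $ 2 - a $ 2 * b $ 1"

definition angular_kernel :: "real \<Rightarrow> real^2 \<Rightarrow> real^2 \<Rightarrow> real" where
  "angular_kernel \<alpha> y z = cross2 y z * norm (y - z) powr (- (2 + \<alpha>))"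

lemma cross2_antisym: "cross2 b a = - cross2 a b"
  by (simp add: cross2_def)

lemma abs_cross2_le: "\<bar>cross2 a b\<bar> \<le> norm a * norm b"
proof -
  have "(cross2 a b)\<^sup>2 + (a \<bullet> b)\<^sup>2 = (norm a)\<^sup>2 * (norm b)\<^sup>2"
    unfolding cross2_def power2_norm_eq_inner inner_vec_def
    by (simp add: UNIV_2 power2_eq_square algebra_simps)
  then have "(cross2 a b)\<^sup>2 \<le> (norm a * norm b)\<^sup>2"
    by (simp add: power_mult_distrib) (smt (verit) zero_le_power2)
  then show ?thesis
    by (simp add: abs_le_square_iff[symmetric])
qed

lemma cross2_diff_right: "cross2 a (b - c) = cross2 a b - cross2 a c"
  by (simp add: cross2_def algebra_simps)

lemma cross2_self [simp]: "cross2 a a = 0"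
  by (simp add: cross2_def)

lemma abs_cross2_le_diff: "\<bar>cross2 a b\<bar> \<le> norm b * norm (a - b)"
  using abs_cross2_le[of b "a - b"] cross2_antisym[of a b]
  by (simp add: cross2_diff_right)

lemma angular_kernel_antisym: "angular_kernel \<alpha> z y = - angular_kernel \<alpha> y z"
  by (simp add: angular_kernel_def cross2_antisym[of z y] norm_minus_commute)

text \<open>The cross product vanishes on the diagonal and thereby removes one power of the
  singularity. The remaining exponent \<open>1 + \<alpha> < 2\<close> is locally integrable in the
  plane.\<close>

lemma abs_angular_kernel_le:
  "\<bar>angular_kernel \<alpha> y z\<bar> \<le> norm z * norm (y - z) powr (- (1 + \<alpha>))"
proof (cases "y = z")
  case False
  have "\<bar>angular_kernel \<alpha> y z\<bar> \<le> norm z * norm (y - z) * norm (y - z) powr (- (2 + \<alpha>))"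
    unfolding angular_kernel_def abs_mult
    by (simp add: abs_cross2_le_diff mult_right_mono)
  also have "norm z * norm (y - z) * norm (y - z) powr (- (2 + \<alpha>))
      = norm z * (norm (y - z) powr 1 * norm (y - z) powr (- (2 + \<alpha>)))"
    using False by simp
  also have "\<dots> = norm z * norm (y - z) powr (- (1 + \<alpha>))"
    by (subst powr_add[symmetric]) simp
  finally show ?thesis .
qed (simp add: angular_kernel_def)

lemma abs_angular_kernel_le':
  "\<bar>angular_kernel \<alpha> y z\<bar> \<le> norm y * norm (y - z) powr (- (1 + \<alpha>))"
  using abs_angular_kernel_le[of \<alpha> z y] angular_kernel_antisym[of \<alpha> y z]
  by (simp add: norm_minus_commute)

lemma has_derivative_green:
  assumes "x \<noteq> 0"
  shows "(green \<alpha> has_derivative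
    (\<lambda>h. - (\<alpha> * green_const \<alpha> * norm x powr (- (2 + \<alpha>))) * (x \<bullet> h))) (at x)"
proof -
  have "(green \<alpha> has_derivative
      (\<lambda>h. green_const \<alpha> * (norm x powr (- \<alpha>) * (0 * ln (norm x) + (x \<bullet> h / norm x) * (- \<alpha>) / norm x)))) (at x)"
    unfolding green_def
    by (rule has_derivative_eq_rhs)
      (use assms in \<open>auto intro!: derivative_eq_intros has_derivative_norm
        simp: sgn_div_norm divide_simps inner_commute\<close>)
  moreover have "green_const \<alpha> * (norm x powr (- \<alpha>) * (0 * ln (norm x) + (x \<bullet> h / norm x) * (- \<alpha>) / norm x))
      = - (\<alpha> * green_const \<alpha> * norm x powr (- (2 + \<alpha>))) * (x \<bullet> h)" for h
  proof -
    have "norm x powr (- (2 + \<alpha>)) = norm x powr (- \<alpha>) / norm x powr 2"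
      by (subst powr_diff[symmetric]) (simp add: algebra_simps)
    then have "norm x powr (- (2 + \<alpha>)) = norm x powr (- \<alpha>) / (norm x * norm x)"
      using assms by (simp add: powr_numeral power2_eq_square)
    then show ?thesis by simp
  qed
  ultimately show ?thesis by simp
qed

lemma kernel_eq:
  assumes "x \<noteq> 0"
  shows "kernel \<alpha> x =
    (\<alpha> * green_const \<alpha> * norm x powr (- (2 + \<alpha>))) *\<^sub>R vector [- (x $ 2), x $ 1]"
proof -
  have "grad (green \<alpha>) x $ i = - (\<alpha> * green_const \<alpha> * norm x powr (- (2 + \<alpha>))) * x $ i" for i
    using frechet_derivative_at[OF has_derivative_green[OF assms], symmetric]
    by (simp add: grad_def inner_axis)
  then show ?thesis
    unfolding kernel_def perp_grad_def by (simp add: vec_eq_iff forall_2)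
qed

text \<open>Write \<open>x - z\<close> as \<open>(x - c) - (z - c)\<close>: the rotated first term
  is orthogonal to \<open>x - c\<close>, so only a cross product survives. The center
  \<open>c\<close> is free, which later permits the shift to the center of mass.\<close>

lemma inner_kernel:
  assumes "x \<noteq> z"
  shows "(x - c) \<bullet> kernel \<alpha> (x - z) = \<alpha> * green_const \<alpha> * angular_kernel \<alpha> (x - c) (z - c)"
proof -
  have "x - c - (z - c) = x - z" by simp
  then show ?thesis
    using kernel_eq[of "x - z" \<alpha>] assms
    by (simp add: angular_kernel_def cross2_def inner_vec_def UNIV_2 algebra_simps)
qed

lemma norm_kernel:
  assumes "x \<noteq> 0"
  shows "norm (kernel \<alpha> x) = \<bar>\<alpha> * green_const \<alpha>\<bar> * norm x powr (- (1 + \<alpha>))"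
proof -
  have "norm (vector [- (x $ 2), x $ 1] :: real^2) = norm x"
    by (simp add: norm_vec_def L2_set_def UNIV_2 add.commute)
  moreover have "norm x powr (- (1 + \<alpha>)) = norm x powr (- (2 + \<alpha>)) * norm x powr 1"
    by (subst powr_add[symmetric]) simp
  ultimately show ?thesis
    using assms by (simp add: kernel_eq abs_mult)
qed

section \<open>Torque and flux of a centered charge\<close>

lemma borel_measurable_vec_nth' [measurable]: "(\<lambda>z::real^2. z $ i) \<in> borel_measurable borel"
  by (intro borel_measurable_continuous_onI continuous_intros)

lemma borel_measurable_cross2 [measurable]:
  assumes [measurable]: "f \<in> borel_measurable M" "g \<in> borel_measurable M"
  shows "(\<lambda>x. cross2 (f x) (g x)) \<in> borel_measurable M"
  unfolding cross2_def by measurable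

lemma borel_measurable_angular_kernel [measurable]:
  assumes [measurable]: "f \<in> borel_measurable M" "g \<in> borel_measurable M"
  shows "(\<lambda>x. angular_kernel \<alpha> (f x) (g x)) \<in> borel_measurable M"
  unfolding angular_kernel_def by measurable

lemma norm_le_one_plus_sq: "norm x \<le> 1 + (norm x)\<^sup>2"
  by (smt (verit) mult_le_cancel_left1 norm_ge_zero power2_eq_square zero_le_power2)

definition excess :: "(real^2) measure \<Rightarrow> real \<Rightarrow> real" where
  "excess \<nu> s = (\<integral>x. max 0 ((norm x)\<^sup>2 - s) \<partial>\<nu>)"

text \<open>Up to the factor \<open>\<alpha> * green_const \<alpha>\<close>, this is position times
  velocity in the field of the charge, that is, half the growth rate of the squared radius.\<close>

definition torque :: "real \<Rightarrow> (real^2) measure \<Rightarrow> real^2 \<Rightarrow> real" where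
  "torque \<alpha> \<nu> y = (\<integral>z. angular_kernel \<alpha> y z \<partial>\<nu>)"

text \<open>Up to the factor \<open>2 * \<alpha> * green_const \<alpha>\<close>, this is the time
  derivative of the excess, because the hinge has slope one beyond the circle and slope zero inside
  it.\<close>

definition flux :: "real \<Rightarrow> (real^2) measure \<Rightarrow> real \<Rightarrow> real" where
  "flux \<alpha> \<nu> s = (\<integral>y. indicator {y. s < (norm y)\<^sup>2} y * torque \<alpha> \<nu> y \<partial>\<nu>)"

lemma powr_minus_diff_le:
  fixes a b m p :: real
  assumes "0 < m" "m \<le> a" "m \<le> b" "0 < p"
  shows "\<bar>a powr (- p) - b powr (- p)\<bar> \<le> p * m powr (- (p + 1)) * \<bar>a - b\<bar>"
proof -
  have "norm (a powr (- p) - b powr (- p)) \<le> p * m powr (- (p + 1)) * norm (a - b)"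
  proof (rule field_differentiable_bound[of "{m..}"])
    show "((\<lambda>x. x powr (- p)) has_field_derivative - p * x powr (- p - 1)) (at x within {m..})"
      if "x \<in> {m..}" for x
      using that assms by (auto intro!: derivative_eq_intros)
    show "norm (- p * x powr (- p - 1)) \<le> p * m powr (- (p + 1))" if "x \<in> {m..}" for x
    proof -
      have "x powr (- (p + 1)) \<le> m powr (- (p + 1))"
        using that assms by (intro powr_mono2') auto
      then show ?thesis using assms by (simp add: abs_mult minus_diff_commute)
    qed
  qed (use assms in auto)
  then show ?thesis by simp
qed

text \<open>The potential bound serves absolute convergence: it makes the angular kernel integrable
  on pairs, so that Fubini and antisymmetry apply to the flux. The size estimates rest on
  \<open>I\<close> and on the vanishing first moment.\<close>

locale centered_measure = finite_measure \<nu> for \<nu> :: "(real^2) measure" +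
  fixes \<alpha> I U :: real
  assumes sets_borel [measurable_cong, simp]: "sets \<nu> = sets borel"
    and alpha: "0 < \<alpha>" "\<alpha> < 1"
    and integrable_sq: "integrable \<nu> (\<lambda>x. (norm x)\<^sup>2)"
    and inertia_le: "(\<integral>x. (norm x)\<^sup>2 \<partial>\<nu>) \<le> I"
    and centered: "(\<integral>x. x \<partial>\<nu>) = 0"
    and potential_le:
      "\<And>y. (\<integral>\<^sup>+z. ennreal (norm (y - z) powr (- (1 + \<alpha>))) \<partial>\<nu>) \<le> ennreal U"
begin

lemma space_UNIV [simp]: "space \<nu> = UNIV"
  using sets_eq_imp_space_eq[OF sets_borel] by simp

lemma I_nonneg: "0 \<le> I"
  using inertia_le by (rule order_trans[rotated]) simp

lemma integrable_norm': "integrable \<nu> norm"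
proof (rule Bochner_Integration.integrable_bound)
  show "integrable \<nu> (\<lambda>x. 1 + (norm x)\<^sup>2)"
    using integrable_sq by simp
  show "AE x in \<nu>. norm (norm x) \<le> norm (1 + (norm x)\<^sup>2)"
    using norm_le_one_plus_sq by (intro AE_I2) simp
qed simp

lemma integrable_id: "integrable \<nu> (\<lambda>x. x)"
  using integrable_norm' by (rule Bochner_Integration.integrable_bound) auto

lemma integrable_excess: "integrable \<nu> (\<lambda>x. max 0 ((norm x)\<^sup>2 - s))"
  by (rule Bochner_Integration.integrable_bound[of _ "\<lambda>x. (norm x)\<^sup>2 + \<bar>s\<bar>"])
    (use integrable_sq in auto)

lemma integrable_angular_kernel: "integrable \<nu> (\<lambda>z. angular_kernel \<alpha> y z)"
proof (rule integrableI_bounded)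
  have "(\<integral>\<^sup>+z. ennreal (norm (angular_kernel \<alpha> y z)) \<partial>\<nu>)
      \<le> (\<integral>\<^sup>+z. ennreal (norm y) * ennreal (norm (y - z) powr (- (1 + \<alpha>))) \<partial>\<nu>)"
    using abs_angular_kernel_le'[of \<alpha>]
    by (intro nn_integral_mono) (simp add: ennreal_mult[symmetric] ennreal_leI)
  also have "\<dots> \<le> ennreal (norm y) * ennreal U"
    using potential_le[of y] by (simp add: nn_integral_cmult mult_left_mono)
  finally show "(\<integral>\<^sup>+z. ennreal (norm (angular_kernel \<alpha> y z)) \<partial>\<nu>) < \<infinity>"
    by (auto simp: ennreal_mult_less_top intro: le_less_trans)
qed simp

lemma integrable_angular_kernel_pair:
  "integrable (\<nu> \<Otimes>\<^sub>M \<nu>) (\<lambda>(y, z). angular_kernel \<alpha> y z)"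
proof (rule integrableI_bounded)
  have "(\<integral>\<^sup>+p. ennreal (norm (case p of (y, z) \<Rightarrow> angular_kernel \<alpha> y z)) \<partial>(\<nu> \<Otimes>\<^sub>M \<nu>))
      = (\<integral>\<^sup>+y. \<integral>\<^sup>+z. ennreal (norm (angular_kernel \<alpha> y z)) \<partial>\<nu> \<partial>\<nu>)"
    by (subst nn_integral_fst[symmetric]) auto
  also have "\<dots> \<le> (\<integral>\<^sup>+y. \<integral>\<^sup>+z. ennreal (norm y) * ennreal (norm (y - z) powr (- (1 + \<alpha>))) \<partial>\<nu> \<partial>\<nu>)"
    using abs_angular_kernel_le'[of \<alpha>]
    by (intro nn_integral_mono) (simp add: ennreal_mult[symmetric] ennreal_leI)
  also have "\<dots> \<le> (\<integral>\<^sup>+y. ennreal (norm y) * ennreal U \<partial>\<nu>)"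
    using potential_le by (intro nn_integral_mono) (simp add: nn_integral_cmult mult_left_mono)
  also have "\<dots> = (\<integral>\<^sup>+y. ennreal (norm y) \<partial>\<nu>) * ennreal U"
    by (simp add: nn_integral_multc)
  also have "\<dots> < \<infinity>"
    using integrable_norm' by (auto simp: ennreal_mult_less_top integrable_iff_bounded)
  finally show "(\<integral>\<^sup>+p. ennreal (norm (case p of (y, z) \<Rightarrow> angular_kernel \<alpha> y z)) \<partial>(\<nu> \<Otimes>\<^sub>M \<nu>)) < \<infinity>" .
qed simp

lemma borel_measurable_torque [measurable]: "torque \<alpha> \<nu> \<in> borel_measurable borel"
  unfolding torque_def by measurable

lemma integrable_restricted_kernel:
  assumes [measurable]: "C \<in> sets borel"
  shows "integrable \<nu> (\<lambda>z. indicator C z * angular_kernel \<alpha> y z)"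
  by (rule Bochner_Integration.integrable_bound[OF integrable_angular_kernel])
    (auto simp: indicator_def)

lemma integrable_restricted_kernel_pair:
  assumes [measurable]: "A \<in> sets borel" "C \<in> sets borel"
  shows "integrable (\<nu> \<Otimes>\<^sub>M \<nu>) (\<lambda>(y, z). indicator A y * (indicator C z * angular_kernel \<alpha> y z))"
  by (rule Bochner_Integration.integrable_bound[OF integrable_angular_kernel_pair])
    (auto simp: indicator_def)

lemma integrable_restricted_torque:
  assumes "A \<in> sets borel" "C \<in> sets borel"
  shows "integrable \<nu> (\<lambda>y. indicator A y * (\<integral>z. indicator C z * angular_kernel \<alpha> y z \<partial>\<nu>))"
proof -
  interpret P: pair_sigma_finite \<nu> \<nu> ..
  show ?thesis using P.integrable_fst'[OF integrable_restricted_kernel_pair[OF assms]] by simp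
qed

text \<open>The kernel is antisymmetric, so the charge outside a disc exerts no net torque on
  itself.\<close>

lemma flux_eq:
  "flux \<alpha> \<nu> s = (\<integral>y. indicator {y. s < (norm y)\<^sup>2} y *
      (\<integral>z. indicator {z. (norm z)\<^sup>2 \<le> s} z * angular_kernel \<alpha> y z \<partial>\<nu>) \<partial>\<nu>)"
  (is "_ = (\<integral>y. indicator ?A y * (\<integral>z. indicator ?B z * ?k y z \<partial>\<nu>) \<partial>\<nu>)")
proof -
  interpret P: pair_sigma_finite \<nu> \<nu> ..
  have AB [measurable]: "?A \<in> sets borel" "?B \<in> sets borel" by measurable
  have antisym: "indicator ?A y * (indicator ?A z * ?k y z)
      = - (indicator ?A z * (indicator ?A y * ?k z y))" for y z
    using angular_kernel_antisym[of \<alpha> z y] by simp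
  define J where "J = (\<integral>y. \<integral>z. indicator ?A y * (indicator ?A z * ?k y z) \<partial>\<nu> \<partial>\<nu>)"
  have "J = (\<integral>z. \<integral>y. indicator ?A y * (indicator ?A z * ?k y z) \<partial>\<nu> \<partial>\<nu>)"
    unfolding J_def using P.Fubini_integral[OF integrable_restricted_kernel_pair[OF AB(1) AB(1)]] by simp
  also have "\<dots> = (\<integral>z. \<integral>y. - (indicator ?A z * (indicator ?A y * ?k z y)) \<partial>\<nu> \<partial>\<nu>)"
    by (intro Bochner_Integration.integral_cong refl antisym)
  also have "\<dots> = - J" by (simp add: J_def)
  finally have J0: "J = 0" by simp
  have "torque \<alpha> \<nu> y = (\<integral>z. indicator ?A z * ?k y z + indicator ?B z * ?k y z \<partial>\<nu>)" for y
    unfolding torque_def by (intro Bochner_Integration.integral_cong) (auto simp: indicator_def)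
  then have "torque \<alpha> \<nu> y = (\<integral>z. indicator ?A z * ?k y z \<partial>\<nu>) + (\<integral>z. indicator ?B z * ?k y z \<partial>\<nu>)" for y
    by (simp only: Bochner_Integration.integral_add[OF integrable_restricted_kernel[OF AB(1)] integrable_restricted_kernel[OF AB(2)]])
  then have "flux \<alpha> \<nu> s = J + (\<integral>y. indicator ?A y * (\<integral>z. indicator ?B z * ?k y z \<partial>\<nu>) \<partial>\<nu>)"
    unfolding flux_def J_def
    by (simp only: distrib_left Bochner_Integration.integral_add[OF integrable_restricted_torque[OF AB(1) AB(1)] integrable_restricted_torque[OF AB(1) AB(2)]])
      (simp only: Bochner_Integration.integral_mult_right_zero)
  with J0 show ?thesis by simp
qed

lemma integral_norm_outside_le:
  assumes "0 < r"
  shows "(\<integral>z. indicator {z. r\<^sup>2 < (norm z)\<^sup>2} z * norm z \<partial>\<nu>) \<le> I / r"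
proof -
  have "(\<integral>z. indicator {z. r\<^sup>2 < (norm z)\<^sup>2} z * norm z \<partial>\<nu>) \<le> (\<integral>z. (norm z)\<^sup>2 / r \<partial>\<nu>)"
  proof (rule integral_mono)
    show "integrable \<nu> (\<lambda>z. indicator {z. r\<^sup>2 < (norm z)\<^sup>2} z * norm z)"
      by (rule Bochner_Integration.integrable_bound[OF integrable_norm']) (auto simp: indicator_def)
    show "indicator {z. r\<^sup>2 < (norm z)\<^sup>2} z * norm z \<le> (norm z)\<^sup>2 / r" for z :: "real^2"
    proof (cases "r\<^sup>2 < (norm z)\<^sup>2")
      case True
      then have "r \<le> norm z" using assms power2_less_imp_less[of r "norm z"] by simp
      then show ?thesis using assms True by (simp add: power2_eq_square field_simps mult_mono)
    qed (use assms in simp)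
  qed (use integrable_sq in simp)
  also have "\<dots> \<le> I / r" using inertia_le assms by (simp add: divide_right_mono)
  finally show ?thesis .
qed

text \<open>The charge near the center acts at a distant point like a multipole whose monopole
  exerts no torque and whose dipole vanishes up to the charge outside the disc.\<close>

lemma inner_torque_le:
  assumes s: "0 < s" "s < (norm y)\<^sup>2"
  shows "\<bar>\<integral>z. indicator {z. (norm z)\<^sup>2 \<le> s / 2} z * angular_kernel \<alpha> y z \<partial>\<nu>\<bar>
    \<le> 770 * I * s powr (- (1 + \<alpha> / 2))"
proof -
  define p where "p = 2 + \<alpha>"
  define B where "B = {z :: real^2. (norm z)\<^sup>2 \<le> s / 2}"
  have [measurable]: "B \<in> sets borel" unfolding B_def by measurable
  have p: "2 < p" "p < 3" using alpha by (auto simp: p_def)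
  define r where "r = sqrt (s / 2)"
  have r: "0 < r" "r\<^sup>2 = s / 2" using s by (auto simp: r_def)
  have y0: "0 < norm y" using s by auto
  have y_powr: "norm y powr (- p) \<le> s powr (- (1 + \<alpha> / 2))"
  proof -
    have "norm y powr (- p) = ((norm y) powr 2) powr (- (1 + \<alpha> / 2))"
      unfolding powr_powr p_def by (rule arg_cong[of _ _ "\<lambda>e. norm y powr e"]) simp
    also have "\<dots> = ((norm y)\<^sup>2) powr (- (1 + \<alpha> / 2))" using y0 by (simp add: powr_numeral)
    also have "\<dots> \<le> s powr (- (1 + \<alpha> / 2))" using s alpha by (intro powr_mono2') auto
    finally show ?thesis .
  qed
  have split: "indicator B z * angular_kernel \<alpha> y z
      = indicator B z * (cross2 y z * (norm (y - z) powr (- p) - norm y powr (- p)))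
        + norm y powr (- p) * (cross2 y z - indicator (- B) z * cross2 y z)" for z
    by (auto simp: indicator_def angular_kernel_def p_def algebra_simps)
  have int_cross: "integrable \<nu> (\<lambda>z. cross2 y z)"
    by (rule Bochner_Integration.integrable_bound[of _ "\<lambda>z. norm y * norm z"])
      (use integrable_norm' abs_cross2_le in auto)
  have int_cross_out: "integrable \<nu> (\<lambda>z. indicator (- B) z * cross2 y z)"
    by (rule Bochner_Integration.integrable_bound[OF int_cross]) (auto simp: indicator_def)
  have cross_zero: "(\<integral>z. cross2 y z \<partial>\<nu>) = 0"
  proof -
    have comp: "integrable \<nu> (\<lambda>z. z $ i)" "(\<integral>z. z $ i \<partial>\<nu>) = 0" for i
      using integrable_bounded_linear[OF bounded_linear_vec_nth integrable_id]
        integral_bounded_linear[OF bounded_linear_vec_nth integrable_id] centered by auto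
    show ?thesis unfolding cross2_def using comp by simp
  qed
  \<comment> \<open>On \<open>B\<close> the squared norm of \<open>z\<close> is at most half that of
    \<open>y\<close>, hence below \<open>(3/4)^2\<close> of it, and all distances in play stay above
    \<open>norm y / 4\<close>. The mean value bound costs \<open>p * 4 powr (p + 1)\<close>, which
    is at most \<open>3 * 256 = 768\<close> as \<open>p < 3\<close>.\<close>
  have diff_le: "\<bar>cross2 y z * (norm (y - z) powr (- p) - norm y powr (- p))\<bar>
      \<le> 768 * s powr (- (1 + \<alpha> / 2)) * (norm z)\<^sup>2" if "z \<in> B" for z
  proof -
    have "(norm z)\<^sup>2 \<le> (3 / 4 * norm y)\<^sup>2"
      using that s by (simp add: B_def power_mult_distrib power2_eq_square)
    then have z: "norm z \<le> 3 / 4 * norm y"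
      by (rule power2_le_imp_le) simp
    have tri: "norm y - norm z \<le> norm (y - z)" by (rule norm_triangle_ineq2)
    have "\<bar>norm (y - z) powr (- p) - norm y powr (- p)\<bar>
        \<le> p * (norm y / 4) powr (- (p + 1)) * \<bar>norm (y - z) - norm y\<bar>"
      using y0 z tri p by (intro powr_minus_diff_le) auto
    also have "\<dots> \<le> p * (norm y / 4) powr (- (p + 1)) * norm z"
      using p norm_triangle_ineq3[of "y - z" y] by (intro mult_left_mono) auto
    finally have 1: "\<bar>norm (y - z) powr (- p) - norm y powr (- p)\<bar>
        \<le> p * (norm y / 4) powr (- (p + 1)) * norm z" .
    have "(norm y / 4) powr (- e) = norm y powr (- e) * 4 powr e" for e
      using y0 by (simp add: powr_divide powr_minus divide_simps)
    then have "(norm y / 4) powr (- (p + 1)) = norm y powr (- (p + 1)) * 4 powr (p + 1)" .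
    moreover have "4 powr (p + 1) \<le> (4::real) powr 4" using p by (intro powr_mono) auto
    moreover have "norm y powr (- (p + 1)) * norm y powr 1 = norm y powr (- p)"
      by (subst powr_add[symmetric]) simp
    ultimately have 2: "p * (norm y / 4) powr (- (p + 1)) * norm y \<le> 3 * 256 * norm y powr (- p)"
    proof -
      assume a: "(norm y / 4) powr (- (p + 1)) = norm y powr (- (p + 1)) * 4 powr (p + 1)"
        and b: "4 powr (p + 1) \<le> (4::real) powr 4"
        and c: "norm y powr (- (p + 1)) * norm y powr 1 = norm y powr (- p)"
      have "p * (norm y / 4) powr (- (p + 1)) * norm y
          = p * 4 powr (p + 1) * (norm y powr (- (p + 1)) * norm y powr 1)"
        unfolding a using y0 by simp
      also have "\<dots> = p * 4 powr (p + 1) * norm y powr (- p)" unfolding c ..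
      also have "\<dots> \<le> 3 * 256 * norm y powr (- p)"
        using b p by (intro mult_right_mono mult_mono) auto
      finally show ?thesis .
    qed
    have "\<bar>cross2 y z * (norm (y - z) powr (- p) - norm y powr (- p))\<bar>
        \<le> (norm y * norm z) * (p * (norm y / 4) powr (- (p + 1)) * norm z)"
      unfolding abs_mult using 1 abs_cross2_le by (intro mult_mono) auto
    also have "\<dots> = (p * (norm y / 4) powr (- (p + 1)) * norm y) * (norm z)\<^sup>2"
      by (simp add: power2_eq_square)
    also have "\<dots> \<le> (3 * 256 * norm y powr (- p)) * (norm z)\<^sup>2"
      using 2 by (intro mult_right_mono) auto
    also have "\<dots> \<le> (768 * s powr (- (1 + \<alpha> / 2))) * (norm z)\<^sup>2"
      using y_powr by (intro mult_right_mono) auto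
    finally show ?thesis .
  qed
  have ptw: "\<bar>indicator B z * (cross2 y z * (norm (y - z) powr (- p) - norm y powr (- p)))\<bar>
      \<le> 768 * s powr (- (1 + \<alpha> / 2)) * (norm z)\<^sup>2" for z
    using diff_le[of z] by (cases "z \<in> B") auto
  have int1: "integrable \<nu> (\<lambda>z. indicator B z * (cross2 y z * (norm (y - z) powr (- p) - norm y powr (- p))))"
  proof (rule Bochner_Integration.integrable_bound)
    show "integrable \<nu> (\<lambda>z. 768 * s powr (- (1 + \<alpha> / 2)) * (norm z)\<^sup>2)"
      using integrable_sq by simp
    show "AE z in \<nu>. norm (indicator B z * (cross2 y z * (norm (y - z) powr (- p) - norm y powr (- p))))
        \<le> norm (768 * s powr (- (1 + \<alpha> / 2)) * (norm z)\<^sup>2)"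
      unfolding real_norm_def by (rule AE_I2) (rule order_trans[OF ptw abs_ge_self])
  qed measurable
  have "\<bar>\<integral>z. indicator B z * (cross2 y z * (norm (y - z) powr (- p) - norm y powr (- p))) \<partial>\<nu>\<bar>
      \<le> (\<integral>z. 768 * s powr (- (1 + \<alpha> / 2)) * (norm z)\<^sup>2 \<partial>\<nu>)"
    using Bochner_Integration.integral_norm_bound_integral[OF int1 integrable_mult_right[OF integrable_sq]] ptw by simp
  also have "\<dots> \<le> 768 * s powr (- (1 + \<alpha> / 2)) * I"
    using inertia_le by (simp add: mult_left_mono)
  finally have main: "\<bar>\<integral>z. indicator B z * (cross2 y z * (norm (y - z) powr (- p) - norm y powr (- p))) \<partial>\<nu>\<bar>
      \<le> 768 * s powr (- (1 + \<alpha> / 2)) * I" .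
  have "\<bar>\<integral>z. indicator (- B) z * cross2 y z \<partial>\<nu>\<bar>
      \<le> (\<integral>z. norm y * (indicator {z. r\<^sup>2 < (norm z)\<^sup>2} z * norm z) \<partial>\<nu>)"
  proof -
    have "integrable \<nu> (\<lambda>z. norm y * (indicator {z. r\<^sup>2 < (norm z)\<^sup>2} z * norm z))"
      by (rule Bochner_Integration.integrable_bound[of _ "\<lambda>z. norm y * norm z"])
        (use integrable_norm' in \<open>auto simp: indicator_def\<close>)
    moreover have "norm (indicator (- B) z * cross2 y z)
        \<le> norm y * (indicator {z. r\<^sup>2 < (norm z)\<^sup>2} z * norm z)" for z
      using abs_cross2_le[of y z] by (auto simp: B_def r indicator_def)
    ultimately have "norm (\<integral>z. indicator (- B) z * cross2 y z \<partial>\<nu>)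
        \<le> (\<integral>z. norm y * (indicator {z. r\<^sup>2 < (norm z)\<^sup>2} z * norm z) \<partial>\<nu>)"
      by (rule Bochner_Integration.integral_norm_bound_integral[OF int_cross_out])
    then show ?thesis by simp
  qed
  also have "\<dots> \<le> norm y * (I / r)"
    unfolding Bochner_Integration.integral_mult_right_zero
    using integral_norm_outside_le[OF r(1)] by (rule mult_left_mono) simp
  finally have out: "\<bar>\<integral>z. indicator (- B) z * cross2 y z \<partial>\<nu>\<bar> \<le> norm y * (I / r)" .
  \<comment> \<open>The linear remainder has the same order in \<open>s\<close> as the quadratic
    term: \<open>norm y\<close> occurs to the power \<open>-(1 + \<alpha>)\<close>, and
    \<open>1 / r\<close> supplies the missing half power with a factor at most 2. This is the 2 in
    \<open>770 = 768 + 2\<close>.\<close>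
  have yr: "norm y powr (- p) * (norm y * (I / r)) \<le> 2 * I * s powr (- (1 + \<alpha> / 2))"
  proof -
    have e: "norm y powr (- p) * norm y = ((norm y)\<^sup>2) powr (- ((1 + \<alpha>) / 2))"
    proof -
      have "norm y powr (- p) * norm y powr 1 = norm y powr (- (1 + \<alpha>))"
        unfolding p_def by (subst powr_add[symmetric]) simp
      also have "\<dots> = (norm y powr 2) powr (- ((1 + \<alpha>) / 2))"
        unfolding powr_powr by (rule arg_cong[of _ _ "\<lambda>e. norm y powr e"]) argo
      finally show ?thesis using y0 by (simp add: powr_numeral)
    qed
    have "((norm y)\<^sup>2) powr (- ((1 + \<alpha>) / 2)) \<le> s powr (- ((1 + \<alpha>) / 2))"
      using s alpha by (intro powr_mono2') auto
    moreover have "1 / r \<le> 2 * s powr (- (1 / 2))"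
    proof -
      have "sqrt 2 \<le> 2" by (rule real_le_lsqrt) auto
      then show ?thesis
        using s by (simp add: r_def real_sqrt_divide powr_minus powr_half_sqrt divide_simps)
    qed
    ultimately have "((norm y)\<^sup>2) powr (- ((1 + \<alpha>) / 2)) * (1 / r)
        \<le> s powr (- ((1 + \<alpha>) / 2)) * (2 * s powr (- (1 / 2)))"
      using r by (intro mult_mono) auto
    also have "\<dots> = 2 * (s powr (- ((1 + \<alpha>) / 2)) * s powr (- (1 / 2)))" by simp
    also have "s powr (- ((1 + \<alpha>) / 2)) * s powr (- (1 / 2)) = s powr (- (1 + \<alpha> / 2))"
      by (subst powr_add[symmetric]) (rule arg_cong[of _ _ "\<lambda>e. s powr e"], argo)
    finally have "I * (((norm y)\<^sup>2) powr (- ((1 + \<alpha>) / 2)) * (1 / r))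
        \<le> I * (2 * s powr (- (1 + \<alpha> / 2)))"
      using I_nonneg by (rule mult_left_mono)
    moreover have "norm y powr (- p) * (norm y * (I / r))
        = I * (((norm y)\<^sup>2) powr (- ((1 + \<alpha>) / 2)) * (1 / r))"
      unfolding e[symmetric] by simp
    ultimately show ?thesis by linarith
  qed
  have "(\<integral>z. indicator B z * angular_kernel \<alpha> y z \<partial>\<nu>)
      = (\<integral>z. indicator B z * (cross2 y z * (norm (y - z) powr (- p) - norm y powr (- p))) \<partial>\<nu>)
        - norm y powr (- p) * (\<integral>z. indicator (- B) z * cross2 y z \<partial>\<nu>)"
    unfolding split using int1 int_cross int_cross_out cross_zero by simp
  also have "\<bar>\<dots>\<bar> \<le> 768 * s powr (- (1 + \<alpha> / 2)) * I + norm y powr (- p) * (norm y * (I / r))"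
    using mult_left_mono[OF out, of "norm y powr (- p)"]
    by (intro order_trans[OF abs_triangle_ineq4 add_mono[OF main]]) (simp add: abs_mult)
  also have "\<dots> \<le> 770 * I * s powr (- (1 + \<alpha> / 2))"
    using yr by (simp add: algebra_simps)
  finally show ?thesis by (simp add: B_def)
qed

end

section \<open>Charge near a circle where the barrier touches\<close>

definition barrier :: "real \<Rightarrow> real \<Rightarrow> real \<Rightarrow> real" where
  "barrier c S s = c * (max 0 (S - s)) ^ 3"

text \<open>Without truncation the second difference of the cube is exactly
  \<open>24 k^2 (S - s)\<close>. When the right point \<open>s + 2 k\<close> lies beyond
  \<open>S\<close>, the surplus is at most \<open>8 k^3\<close>; together these give the constant
  32.\<close>

lemma barrier_second_difference:
  assumes "0 \<le> c" "0 < k" "s < S"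
  shows "barrier c S (s + 2 * k) + barrier c S (s - 2 * k) - 2 * barrier c S s
    \<le> c * (32 * k\<^sup>2 * max (S - s) k)"
proof -
  define x where "x = S - s"
  have x: "0 < x" using assms by (simp add: x_def)
  have "(max 0 (x - 2 * k)) ^ 3 + (x + 2 * k) ^ 3 - 2 * x ^ 3 \<le> 32 * k\<^sup>2 * max x k"
  proof (cases "2 * k \<le> x")
    case True
    have "(x - 2 * k) ^ 3 + (x + 2 * k) ^ 3 - 2 * x ^ 3 = 24 * k\<^sup>2 * x"
      by (simp add: power2_eq_square power3_eq_cube algebra_simps)
    also have "\<dots> \<le> 32 * k\<^sup>2 * max x k" using x assms by (intro mult_mono) auto
    finally show ?thesis using True by simp
  next
    case False
    have "6 * x * (x * k) \<le> 6 * x * (2 * k * k)"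
      using False x assms by (intro mult_left_mono mult_right_mono) auto
    moreover have "(x + 2 * k) ^ 3 - 2 * x ^ 3 = 6 * x * (x * k) + 12 * x * k\<^sup>2 + 8 * k\<^sup>2 * k - x ^ 3"
      by (simp add: power2_eq_square power3_eq_cube algebra_simps)
    moreover have "0 \<le> x ^ 3" using x by simp
    ultimately have "(x + 2 * k) ^ 3 - 2 * x ^ 3 \<le> 6 * x * (2 * k * k) + 12 * x * k\<^sup>2 + 8 * k\<^sup>2 * k"
      by linarith
    also have "\<dots> = 24 * k\<^sup>2 * x + 8 * k\<^sup>2 * k" by (simp add: power2_eq_square)
    also have "\<dots> \<le> 24 * k\<^sup>2 * max x k + 8 * k\<^sup>2 * max x k"
      using assms by (intro add_mono mult_left_mono) auto
    finally show ?thesis using False by (simp add: mult_ac)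
  qed
  then have "c * ((max 0 (x - 2 * k)) ^ 3 + (x + 2 * k) ^ 3 - 2 * x ^ 3) \<le> c * (32 * k\<^sup>2 * max x k)"
    using assms by (intro mult_left_mono) auto
  moreover have "S - (s + 2 * k) = x - 2 * k" "S - (s - 2 * k) = x + 2 * k" by (auto simp: x_def)
  ultimately show ?thesis
    using x assms by (simp add: barrier_def x_def[symmetric] algebra_simps)
qed

lemma suminf_term_le:
  fixes f :: "nat \<Rightarrow> ennreal"
  shows "f j \<le> (\<Sum>j. f j)"
  using sum_le_suminf[of f "{j}"] by simp

lemma nn_integral_pair_indicators:
  fixes F :: ennreal and w :: "nat \<Rightarrow> ennreal"
  assumes [measurable]: "A \<in> sets M" "B \<in> sets M" "\<And>j. A' j \<in> sets M" "\<And>j. B' j \<in> sets M"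
  shows "(\<integral>\<^sup>+y. \<integral>\<^sup>+z. F * indicator A y * indicator B z
        + (\<Sum>j. w j * indicator (A' j) y * indicator (B' j) z) \<partial>M \<partial>M)
    = F * emeasure M A * emeasure M B + (\<Sum>j. w j * emeasure M (A' j) * emeasure M (B' j))"
proof -
  have "(\<integral>\<^sup>+z. F * indicator A y * indicator B z
        + (\<Sum>j. w j * indicator (A' j) y * indicator (B' j) z) \<partial>M)
      = F * indicator A y * emeasure M B + (\<Sum>j. w j * indicator (A' j) y * emeasure M (B' j))" for y
    by (simp add: nn_integral_add nn_integral_suminf nn_integral_cmult)
  then show ?thesis
    by (simp add: nn_integral_add nn_integral_suminf nn_integral_cmult nn_integral_multc)
qed

section \<open>Differences of the hinge and dyadic scales\<close>

lemma hinge_difference: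
  fixes h u :: real
  assumes "0 < h"
  shows "h * indicator {0<..} u \<le> max 0 (u + h) - max 0 u"
  using assms by (auto simp: max_def indicator_def)

text \<open>The right-hand side is the tent of height \<open>2 k\<close> supported on
  \<open>[-2k, 2k]\<close>, which is still at least \<open>k\<close> on the inner half.\<close>

lemma hinge_second_difference:
  fixes k u :: real
  assumes "0 < k"
  shows "k * indicator {-k..k} u \<le> max 0 (u - 2 * k) + max 0 (u + 2 * k) - 2 * max 0 u"
  using assms by (auto simp: max_def indicator_def)

lemma dyadic_scale:
  fixes H m :: real
  assumes "0 < m" "m \<le> H"
  obtains j where "m \<le> H * (1 / 2) ^ j" "H * (1 / 2) ^ Suc j < m"
proof -
  obtain n where n: "(1 / 2) ^ n < m / H"
    using real_arch_pow_inv[of "m / H" "1 / 2"] assms by auto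
  define P where "P n \<longleftrightarrow> H * (1 / 2) ^ n < m" for n :: nat
  have "P n" using n assms by (simp add: P_def field_simps)
  moreover have "\<not> P 0" using assms by (simp add: P_def)
  ultimately obtain j where "\<not> P j" "P (Suc j)"
    by (metis LeastI_ex not_less_Least old.nat.exhaust lessI)
  then show ?thesis using that[of j] by (simp add: P_def not_less)
qed

section \<open>Size of the kernel for points on opposite sides of a circle\<close>

lemma angular_kernel_far_le:
  assumes s: "0 < s" "3 / 2 * s < (norm y)\<^sup>2" "(norm z)\<^sup>2 \<le> s" and \<alpha>: "0 < \<alpha>" "\<alpha> < 1"
  shows "\<bar>angular_kernel \<alpha> y z\<bar> \<le> 36 * s powr (- (\<alpha> / 2))"
proof -
  define q where "q = sqrt s"
  have q: "0 < q" "q\<^sup>2 = s" using s by (auto simp: q_def)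
  have zq: "norm z \<le> q" by (rule power2_le_imp_le) (use s q in auto)
  \<comment> \<open>Since \<open>(7/6)^2 = 49/36 < 3/2\<close>, the point \<open>y\<close> is at
    distance at least \<open>q / 6\<close> from the disc of radius \<open>q\<close>. The constant 36
    is \<open>6 powr 2\<close>, used for \<open>6 powr (1 + \<alpha>)\<close>.\<close>
  have "(7 / 6 * q)\<^sup>2 \<le> (norm y)\<^sup>2"
    unfolding power_mult_distrib q(2) using s by (simp add: power2_eq_square)
  then have "7 / 6 * q \<le> norm y" by (rule power2_le_imp_le) simp
  then have "q / 6 \<le> norm (y - z)" using zq norm_triangle_ineq2[of y z] by simp
  then have "norm (y - z) powr (- (1 + \<alpha>)) \<le> (q / 6) powr (- (1 + \<alpha>))"
    using q \<alpha> by (intro powr_mono2') auto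
  also have "\<dots> = q powr (- (1 + \<alpha>)) * 6 powr (1 + \<alpha>)"
  proof -
    have "(q / 6) powr (- e) = q powr (- e) * 6 powr e" for e
      using q by (simp add: powr_divide powr_minus divide_simps)
    then show ?thesis .
  qed
  also have "\<dots> \<le> q powr (- (1 + \<alpha>)) * 6 powr 2"
    using \<alpha> by (intro mult_left_mono powr_mono) auto
  finally have "norm z * norm (y - z) powr (- (1 + \<alpha>)) \<le> q * (q powr (- (1 + \<alpha>)) * 36)"
    using zq q by (intro mult_mono) auto
  also have "\<dots> = 36 * (q powr 1 * q powr (- (1 + \<alpha>)))" using q by simp
  also have "q powr 1 * q powr (- (1 + \<alpha>)) = q powr (2 * (- (\<alpha> / 2)))"
    by (subst powr_add[symmetric]) simp
  also have "\<dots> = s powr (- (\<alpha> / 2))"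
    unfolding powr_powr[symmetric] using q by (simp add: powr_numeral)
  finally show ?thesis using abs_angular_kernel_le order_trans by blast
qed

text \<open>A gap in squared radius is turned into a distance by factoring the difference of
  squares: the sum of the two radii is at most \<open>3 * sqrt s\<close>, so
  \<open>norm (y - z)\<close> is at least \<open>h / (6 * sqrt s)\<close>.\<close>

lemma angular_kernel_near_le:
  assumes s: "0 < s" and yz: "(norm y)\<^sup>2 \<le> 3 / 2 * s" "(norm z)\<^sup>2 \<le> s"
    and h: "0 < h" "h / 2 \<le> (norm y)\<^sup>2 - (norm z)\<^sup>2" and \<alpha>: "0 < \<alpha>" "\<alpha> < 1"
  shows "\<bar>angular_kernel \<alpha> y z\<bar> \<le> 36 * s powr (1 + \<alpha> / 2) * h powr (- (1 + \<alpha>))"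
proof -
  define q where "q = sqrt s"
  have q: "0 < q" "q\<^sup>2 = s" using s by (auto simp: q_def)
  have zq: "norm z \<le> q" by (rule power2_le_imp_le) (use yz q in auto)
  have "(norm y)\<^sup>2 \<le> (2 * q)\<^sup>2"
    unfolding power_mult_distrib q(2) using s yz by (simp add: power2_eq_square)
  then have yq: "norm y \<le> 2 * q" by (rule power2_le_imp_le) (use q in simp)
  have "(norm y)\<^sup>2 - (norm z)\<^sup>2 = (norm y - norm z) * (norm y + norm z)"
    by (simp add: power2_eq_square algebra_simps)
  also have "\<dots> \<le> norm (y - z) * (3 * q)"
    using yq zq norm_triangle_ineq2[of y z] by (intro mult_mono) auto
  finally have "h / (6 * q) \<le> norm (y - z)" using h q by (simp add: field_simps)
  then have "norm (y - z) powr (- (1 + \<alpha>)) \<le> (h / (6 * q)) powr (- (1 + \<alpha>))"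
    using q h \<alpha> by (intro powr_mono2') auto
  also have "\<dots> = h powr (- (1 + \<alpha>)) * (6 powr (1 + \<alpha>) * q powr (1 + \<alpha>))"
  proof -
    have "(h / (6 * q)) powr (- e) = h powr (- e) * (6 powr e * q powr e)" for e
      using q h by (simp add: powr_divide powr_minus powr_mult divide_simps)
    then show ?thesis .
  qed
  also have "\<dots> \<le> h powr (- (1 + \<alpha>)) * (6 powr 2 * q powr (1 + \<alpha>))"
    using \<alpha> by (intro mult_left_mono mult_right_mono powr_mono) auto
  finally have "norm z * norm (y - z) powr (- (1 + \<alpha>))
      \<le> q * (h powr (- (1 + \<alpha>)) * (36 * q powr (1 + \<alpha>)))"
    using zq q by (intro mult_mono) auto
  also have "\<dots> = 36 * (q powr 1 * q powr (1 + \<alpha>)) * h powr (- (1 + \<alpha>))" using q by simp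
  also have "q powr 1 * q powr (1 + \<alpha>) = q powr (2 * (1 + \<alpha> / 2))"
    by (subst powr_add[symmetric]) simp
  also have "\<dots> = s powr (1 + \<alpha> / 2)"
    unfolding powr_powr[symmetric] using q by (simp add: powr_numeral)
  finally show ?thesis using abs_angular_kernel_le order_trans by blast
qed

context centered_measure
begin

lemma measure_outside_le_excess_diff:
  assumes h: "0 < h"
  shows "h * measure \<nu> {x. s < (norm x)\<^sup>2} \<le> excess \<nu> (s - h) - excess \<nu> s"
proof -
  have [measurable]: "{x::real^2. s < (norm x)\<^sup>2} \<in> sets borel" by measurable
  have "h * measure \<nu> {x. s < (norm x)\<^sup>2} = (\<integral>y. h * indicator {x. s < (norm x)\<^sup>2} y \<partial>\<nu>)"
    by simp
  also have "\<dots> \<le> (\<integral>y. max 0 ((norm y)\<^sup>2 - (s - h)) - max 0 ((norm y)\<^sup>2 - s) \<partial>\<nu>)"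
  proof (rule integral_mono)
    show "integrable \<nu> (\<lambda>y. h * indicator {x. s < (norm x)\<^sup>2} y)"
      by (rule integrable_mult_right, rule integrable_real_indicator)
        (auto simp: emeasure_eq_measure)
    show "h * indicator {x. s < (norm x)\<^sup>2} y
        \<le> max 0 ((norm y)\<^sup>2 - (s - h)) - max 0 ((norm y)\<^sup>2 - s)" for y :: "real^2"
      using hinge_difference[OF h, of "(norm y)\<^sup>2 - s"]
      by (simp add: indicator_def algebra_simps)
  qed (intro Bochner_Integration.integrable_diff integrable_excess)
  also have "\<dots> = excess \<nu> (s - h) - excess \<nu> s"
    unfolding excess_def by (intro Bochner_Integration.integral_diff integrable_excess)
  finally show ?thesis .
qed

end

text \<open>The barrier touches the excess from above, after subtracting a constant, at the level
  \<open>s\<close>. Its second differences then control the charge near the circle of squared radius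
  \<open>s\<close> at every scale: no concentrated cluster can sit there.\<close>

locale touched_measure = centered_measure +
  fixes s S c :: real
  assumes c: "0 < c" and sS: "0 < S" "S / 4 \<le> s" "s < S"
    and touch: "\<And>s'. 0 \<le> s' \<Longrightarrow> excess \<nu> s' - barrier c S s' \<le> excess \<nu> s - barrier c S s"
begin

lemma measure_outside_le: "measure \<nu> {x. s < (norm x)\<^sup>2} \<le> 5 * c * (S - s)\<^sup>2"
proof -
  define x where "x = S - s"
  \<comment> \<open>From \<open>S / 4 \<le> s\<close> follows \<open>x \<le> 3 * s\<close>, so this
    is a step with \<open>s - h \<ge> 0\<close>, where \<open>touch\<close> applies. The barrier
    grows by \<open>(4^3 - 3^3) c h^3 = 37 c h^3\<close>, and \<open>37 / 9 < 5\<close>.\<close>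
  define h where "h = x / 3"
  have h: "0 < x" "0 < h" "h \<le> s" "x = 3 * h" using sS by (auto simp: h_def x_def)
  have "h * measure \<nu> {x. s < (norm x)\<^sup>2} \<le> excess \<nu> (s - h) - excess \<nu> s"
    using h(2) by (rule measure_outside_le_excess_diff)
  also have "\<dots> \<le> barrier c S (s - h) - barrier c S s"
    using touch[of "s - h"] h by simp
  also have "\<dots> = c * (37 * h ^ 3)"
  proof -
    have eqs: "max 0 (S - (s - h)) = 4 * h" "max 0 (S - s) = 3 * h" using h by (auto simp: x_def)
    show ?thesis unfolding barrier_def eqs by (simp add: power_mult_distrib)
  qed
  also have "\<dots> \<le> h * (5 * c * x\<^sup>2)"
    using h c by (simp add: power2_eq_square power3_eq_cube)
  finally show ?thesis using h by (simp add: x_def)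
qed

lemma measure_annulus_le:
  assumes k: "0 < k" "2 * k \<le> s"
  shows "measure \<nu> {x. \<bar>(norm x)\<^sup>2 - s\<bar> \<le> k} \<le> 32 * c * k * max (S - s) k"
proof -
  have [measurable]: "{x::real^2. \<bar>(norm x)\<^sup>2 - s\<bar> \<le> k} \<in> sets borel" by measurable
  have "k * measure \<nu> {x. \<bar>(norm x)\<^sup>2 - s\<bar> \<le> k} = (\<integral>y. k * indicator {x. \<bar>(norm x)\<^sup>2 - s\<bar> \<le> k} y \<partial>\<nu>)"
    by simp
  also have "\<dots> \<le> (\<integral>y. max 0 ((norm y)\<^sup>2 - (s + 2 * k)) + max 0 ((norm y)\<^sup>2 - (s - 2 * k))
      - 2 * max 0 ((norm y)\<^sup>2 - s) \<partial>\<nu>)"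
  proof (rule integral_mono)
    show "integrable \<nu> (\<lambda>y. k * indicator {x. \<bar>(norm x)\<^sup>2 - s\<bar> \<le> k} y)"
      by (rule integrable_mult_right, rule integrable_real_indicator)
        (auto simp: emeasure_eq_measure)
    fix y :: "real^2"
    have eqs: "(norm y)\<^sup>2 - (s + 2 * k) = ((norm y)\<^sup>2 - s) - 2 * k"
      "(norm y)\<^sup>2 - (s - 2 * k) = ((norm y)\<^sup>2 - s) + 2 * k"
      "indicator {x. \<bar>(norm x)\<^sup>2 - s\<bar> \<le> k} y = (indicator {-k..k} ((norm y)\<^sup>2 - s) :: real)"
      by (auto simp: indicator_def abs_le_iff)
    show "k * indicator {x. \<bar>(norm x)\<^sup>2 - s\<bar> \<le> k} y
        \<le> max 0 ((norm y)\<^sup>2 - (s + 2 * k)) + max 0 ((norm y)\<^sup>2 - (s - 2 * k))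
          - 2 * max 0 ((norm y)\<^sup>2 - s)"
      unfolding eqs by (rule hinge_second_difference[OF k(1)])
  qed (intro Bochner_Integration.integrable_diff Bochner_Integration.integrable_add
      integrable_mult_right integrable_excess)
  also have "\<dots> = excess \<nu> (s + 2 * k) + excess \<nu> (s - 2 * k) - 2 * excess \<nu> s"
    unfolding excess_def by (simp add: integrable_excess)
  also have "\<dots> \<le> barrier c S (s + 2 * k) + barrier c S (s - 2 * k) - 2 * barrier c S s"
    using touch[of "s + 2 * k"] touch[of "s - 2 * k"] k by simp
  also have "\<dots> \<le> c * (32 * k\<^sup>2 * max (S - s) k)"
    using c k sS by (intro barrier_second_difference) auto
  finally have "k * measure \<nu> {x. \<bar>(norm x)\<^sup>2 - s\<bar> \<le> k} \<le> k * (32 * c * k * max (S - s) k)"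
    by (simp add: power2_eq_square mult.left_commute mult.assoc)
  then show ?thesis using k by simp
qed

text \<open>The outer mass is bounded by the annulus estimate for small \<open>k\<close> and by the
  whole mass beyond the circle for large \<open>k\<close>; both cases read
  \<open>x * min x k\<close>. The inner mass has only the bound \<open>k * max x k\<close>.
  Multiplying, minimum and maximum combine to \<open>x * k\<close>, which leaves the full factor
  \<open>(S - s)^2\<close> at every scale.\<close>

lemma measure_straddle_le:
  assumes k: "0 < k" "2 * k \<le> s"
  shows "measure \<nu> {x. s < (norm x)\<^sup>2 \<and> (norm x)\<^sup>2 \<le> s + k} * measure \<nu> {x. s - k \<le> (norm x)\<^sup>2 \<and> (norm x)\<^sup>2 \<le> s}
    \<le> 1024 * c\<^sup>2 * (S - s)\<^sup>2 * k\<^sup>2" (is "measure \<nu> ?A * measure \<nu> ?B \<le> _")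
proof -
  define x where "x = S - s"
  have x: "0 < x" using sS by (simp add: x_def)
  have [measurable]: "{x::real^2. \<bar>(norm x)\<^sup>2 - s\<bar> \<le> k} \<in> sets borel"
    "{x::real^2. s < (norm x)\<^sup>2} \<in> sets borel" by measurable
  have "measure \<nu> ?B \<le> measure \<nu> {x. \<bar>(norm x)\<^sup>2 - s\<bar> \<le> k}"
    by (rule finite_measure_mono) auto
  then have B: "measure \<nu> ?B \<le> 32 * c * k * max x k"
    using measure_annulus_le[OF k] by (simp add: x_def)
  have A: "measure \<nu> ?A \<le> 32 * c * x * min x k"
  proof (cases "k \<le> x")
    case True
    have "measure \<nu> ?A \<le> measure \<nu> {x. \<bar>(norm x)\<^sup>2 - s\<bar> \<le> k}"
      by (rule finite_measure_mono) auto
    also have "\<dots> \<le> 32 * c * k * max x k"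
      using measure_annulus_le[OF k] by (simp add: x_def)
    also have "\<dots> = 32 * c * x * min x k" using True by simp
    finally show ?thesis .
  next
    case False
    have "measure \<nu> ?A \<le> measure \<nu> {x. s < (norm x)\<^sup>2}"
      by (rule finite_measure_mono) auto
    also have "\<dots> \<le> 5 * c * x\<^sup>2" using measure_outside_le by (simp add: x_def)
    also have "\<dots> \<le> 32 * c * x * x" using c x by (simp add: power2_eq_square)
    also have "\<dots> = 32 * c * x * min x k" using False by simp
    finally show ?thesis .
  qed
  have "measure \<nu> ?A * measure \<nu> ?B \<le> (32 * c * x * min x k) * (32 * c * k * max x k)"
    using A B c x k by (intro mult_mono) auto
  also have "\<dots> = 1024 * c\<^sup>2 * x * k * (min x k * max x k)"
    by (simp add: power2_eq_square)
  also have "min x k * max x k = x * k" by (simp add: min_def max_def)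
  finally show ?thesis by (simp add: x_def power2_eq_square mult_ac)
qed

text \<open>If \<open>y\<close> is far outside, the kernel is bounded and the inner mass is
  estimated by the inertia. Otherwise the pair is sorted by dyadic distance \<open>h\<close> to the
  circle: the kernel costs \<open>h powr (- (1 + \<alpha>))\<close>, the two masses gain
  \<open>h^2\<close>, and the scales sum as a geometric series of ratio
  \<open>(1/2) powr (1 - \<alpha>)\<close>.\<close>

lemma torque_restrict_le:
  "\<bar>\<integral>y. indicator {y. s < (norm y)\<^sup>2} y *
      (\<integral>z. indicator {z. s / 2 < (norm z)\<^sup>2 \<and> (norm z)\<^sup>2 \<le> s} z * angular_kernel \<alpha> y z \<partial>\<nu>) \<partial>\<nu>\<bar>
    \<le> 72 * I * s powr (- (1 + \<alpha> / 2)) * measure \<nu> {x. s < (norm x)\<^sup>2}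
      + 36864 / (1 - (1 / 2) powr (1 - \<alpha>)) * s powr (2 - \<alpha> / 2) * c\<^sup>2 * (S - s)\<^sup>2"
  (is "\<bar>\<integral>y. indicator ?A y * (\<integral>z. indicator ?B z * _ \<partial>\<nu>) \<partial>\<nu>\<bar> \<le> _")
proof -
  have s: "0 < s" using sS by simp
  define F where "F = 36 * s powr (- (\<alpha> / 2))"
  \<comment> \<open>The scales start at \<open>s / 2\<close> because
    \<open>measure_straddle_le\<close> needs \<open>2 * h j \<le> s\<close>; near pairs never exceed
    this scale.\<close>
  define h where "h j = s / 2 * (1 / 2) ^ j" for j :: nat
  define w where "w j = 36 * s powr (1 + \<alpha> / 2) * h j powr (- (1 + \<alpha>))" for j
  define Aj where "Aj j = {x :: real^2. s < (norm x)\<^sup>2 \<and> (norm x)\<^sup>2 \<le> s + h j}" for j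
  define Bj where "Bj j = {x :: real^2. s - h j \<le> (norm x)\<^sup>2 \<and> (norm x)\<^sup>2 \<le> s}" for j
  have [measurable]: "?A \<in> sets borel" "?B \<in> sets borel" "Aj j \<in> sets borel" "Bj j \<in> sets borel" for j
    unfolding Aj_def Bj_def by measurable
  have h: "0 < h j" "2 * h j \<le> s" for j
    using s power_le_one[of "1 / 2 :: real" j] by (auto simp: h_def)
  have wF: "0 \<le> w j" "0 \<le> F" for j by (auto simp: w_def F_def)
  have ptw: "ennreal (norm (indicator ?A y * (indicator ?B z * angular_kernel \<alpha> y z)))
      \<le> ennreal F * indicator ?A y * indicator ?B z
        + (\<Sum>j. ennreal (w j) * indicator (Aj j) y * indicator (Bj j) z)" (is "?lhs y z \<le> _") for y z
  proof (cases "y \<in> ?A \<and> z \<in> ?B")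
    case True
    then have yz: "s < (norm y)\<^sup>2" "(norm z)\<^sup>2 \<le> s" "s / 2 < (norm z)\<^sup>2" by auto
    show ?thesis
    proof (cases "3 / 2 * s < (norm y)\<^sup>2")
      case far: True
      have "ennreal (norm (angular_kernel \<alpha> y z)) \<le> ennreal F"
        unfolding F_def real_norm_def
        by (rule ennreal_leI) (rule angular_kernel_far_le[OF s far yz(2) alpha])
      then have "?lhs y z \<le> ennreal F * indicator ?A y * indicator ?B z"
        using True by (simp add: indicator_def)
      then show ?thesis by (rule order_trans) (rule add_increasing2[OF zero_le order_refl])
    next
      case False
      \<comment> \<open>The larger of the two distances to the circle, in squared radius. It places
        both points in the same annulus, and it bounds the gap between them from below, since that
        gap is the sum of the two distances.\<close>
      define m where "m = max ((norm y)\<^sup>2 - s) (s - (norm z)\<^sup>2)"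
      have "0 < m" using yz by (simp add: m_def less_max_iff_disj)
      moreover have "m \<le> s / 2"
        unfolding m_def by (rule max.boundedI) (use yz False in auto)
      ultimately obtain j
        where j: "m \<le> s / 2 * (1 / 2) ^ j" "s / 2 * (1 / 2) ^ Suc j < m"
        by (rule dyadic_scale)
      then have hj: "h j / 2 < m" "m \<le> h j" by (auto simp: h_def)
      then have mem: "y \<in> Aj j" "z \<in> Bj j" using yz by (auto simp: Aj_def Bj_def m_def)
      have "m \<le> (norm y)\<^sup>2 - (norm z)\<^sup>2"
        unfolding m_def by (rule max.boundedI) (use yz in auto)
      with hj have "h j / 2 \<le> (norm y)\<^sup>2 - (norm z)\<^sup>2" by linarith
      then have "ennreal (norm (angular_kernel \<alpha> y z)) \<le> ennreal (w j)"
        unfolding w_def real_norm_def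
        using s False yz(2) h(1)[of j] alpha by (intro ennreal_leI angular_kernel_near_le) auto
      then have "?lhs y z \<le> ennreal (w j) * indicator (Aj j) y * indicator (Bj j) z"
        using True mem by (simp add: indicator_def)
      also have "\<dots> \<le> (\<Sum>j. ennreal (w j) * indicator (Aj j) y * indicator (Bj j) z)"
        by (rule suminf_term_le)
      finally show ?thesis by (rule order_trans) (rule add_increasing[OF zero_le order_refl])
    qed
  next
    case False
    then have "?lhs y z = 0" by (auto simp: indicator_def)
    then show ?thesis by (simp only: zero_le)
  qed
  define r :: real where "r = (1 / 2) powr (1 - \<alpha>)"
  have r: "0 < r" "r < 1"
    using alpha powr_less_mono2[of "1 - \<alpha>" "1 / 2" 1] by (auto simp: r_def)
  define D where "D = 36864 * s powr (2 - \<alpha> / 2) * c\<^sup>2 * (S - s)\<^sup>2"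
  have D: "0 \<le> D" by (simp add: D_def)
  \<comment> \<open>The factor 36 of the kernel and the factor 1024 of the straddling masses give
    \<open>36864\<close>.\<close>
  have term_le: "ennreal (w j) * emeasure \<nu> (Aj j) * emeasure \<nu> (Bj j) \<le> ennreal (D * r ^ j)" for j
  proof -
    have "h j powr (- (1 + \<alpha>)) * (h j)\<^sup>2 = h j powr (1 - \<alpha>)"
    proof -
      have "h j powr (- (1 + \<alpha>)) * h j powr 2 = h j powr (1 - \<alpha>)"
        by (subst powr_add[symmetric]) simp
      then show ?thesis using h[of j] by (simp add: powr_numeral)
    qed
    also have "\<dots> = (s / 2) powr (1 - \<alpha>) * r ^ j"
    proof -
      have "((1 / 2 :: real) ^ j) powr (1 - \<alpha>) = r ^ j"
        unfolding r_def by (simp add: powr_power powr_realpow[symmetric] powr_powr mult.commute)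
      then show ?thesis unfolding h_def using s by (subst powr_mult) auto
    qed
    also have "\<dots> \<le> s powr (1 - \<alpha>) * r ^ j"
      using s alpha r by (intro mult_right_mono powr_mono2) auto
    finally have hh: "h j powr (- (1 + \<alpha>)) * (h j)\<^sup>2 \<le> s powr (1 - \<alpha>) * r ^ j" .
    have "w j * (measure \<nu> (Aj j) * measure \<nu> (Bj j)) \<le> w j * (1024 * c\<^sup>2 * (S - s)\<^sup>2 * (h j)\<^sup>2)"
      using measure_straddle_le[OF h] wF by (intro mult_left_mono) (auto simp: Aj_def Bj_def)
    also have "\<dots> = 36864 * s powr (1 + \<alpha> / 2) * c\<^sup>2 * (S - s)\<^sup>2 * (h j powr (- (1 + \<alpha>)) * (h j)\<^sup>2)"
      by (simp add: w_def)
    also have "\<dots> \<le> 36864 * s powr (1 + \<alpha> / 2) * c\<^sup>2 * (S - s)\<^sup>2 * (s powr (1 - \<alpha>) * r ^ j)"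
      using hh by (intro mult_left_mono) auto
    also have "\<dots> = 36864 * (s powr (1 + \<alpha> / 2) * s powr (1 - \<alpha>)) * c\<^sup>2 * (S - s)\<^sup>2 * r ^ j"
      by simp
    also have "s powr (1 + \<alpha> / 2) * s powr (1 - \<alpha>) = s powr (2 - \<alpha> / 2)"
      by (subst powr_add[symmetric]) (rule arg_cong[of _ _ "\<lambda>e. s powr e"], argo)
    finally have "w j * (measure \<nu> (Aj j) * measure \<nu> (Bj j)) \<le> D * r ^ j" by (simp add: D_def)
    then show ?thesis
      using wF by (simp add: emeasure_eq_measure ennreal_mult[symmetric] ennreal_leI mult.assoc)
  qed
  \<comment> \<open>Chebyshev: where the squared norm exceeds \<open>s / 2\<close> the mass is at
    most \<open>2 * I / s\<close>, hence \<open>72 = 36 * 2\<close>.\<close>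
  have B_le: "F * measure \<nu> ?B \<le> 72 * I * s powr (- (1 + \<alpha> / 2))"
  proof -
    have "s / 2 * measure \<nu> ?B = (\<integral>y. s / 2 * indicator ?B y \<partial>\<nu>)" by simp
    also have "\<dots> \<le> (\<integral>y. (norm y)\<^sup>2 \<partial>\<nu>)"
    proof (rule integral_mono)
      show "integrable \<nu> (\<lambda>y. s / 2 * indicator ?B y)"
        by (rule integrable_mult_right, rule integrable_real_indicator) (auto simp: emeasure_eq_measure)
    qed (use integrable_sq s in \<open>auto simp: indicator_def\<close>)
    also have "\<dots> \<le> I" by (rule inertia_le)
    finally have "measure \<nu> ?B \<le> 2 * I / s" using s by (simp add: field_simps)
    then have "F * measure \<nu> ?B \<le> F * (2 * I / s)" using wF(2) by (rule mult_left_mono)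
    also have "\<dots> = 72 * I * (s powr (- (\<alpha> / 2)) * s powr (- 1))"
      using s by (simp add: F_def powr_minus divide_simps)
    also have "s powr (- (\<alpha> / 2)) * s powr (- 1) = s powr (- (1 + \<alpha> / 2))"
      by (subst powr_add[symmetric]) (simp add: add.commute)
    finally show ?thesis .
  qed
  have "ennreal (norm (\<integral>y. indicator ?A y * (\<integral>z. indicator ?B z * angular_kernel \<alpha> y z \<partial>\<nu>) \<partial>\<nu>))
      \<le> (\<integral>\<^sup>+y. ennreal (norm (indicator ?A y * (\<integral>z. indicator ?B z * angular_kernel \<alpha> y z \<partial>\<nu>))) \<partial>\<nu>)"
    by (rule integral_norm_bound_ennreal, rule integrable_restricted_torque) measurable
  also have "\<dots> \<le> (\<integral>\<^sup>+y. \<integral>\<^sup>+z. ennreal (norm (indicator ?A y * (indicator ?B z * angular_kernel \<alpha> y z))) \<partial>\<nu> \<partial>\<nu>)"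
  proof (rule nn_integral_mono)
    fix y
    have "integrable \<nu> (\<lambda>z. indicator ?A y * (indicator ?B z * angular_kernel \<alpha> y z))"
      by (intro integrable_mult_right integrable_restricted_kernel) measurable
    from integral_norm_bound_ennreal[OF this]
    show "ennreal (norm (indicator ?A y * (\<integral>z. indicator ?B z * angular_kernel \<alpha> y z \<partial>\<nu>)))
        \<le> (\<integral>\<^sup>+z. ennreal (norm (indicator ?A y * (indicator ?B z * angular_kernel \<alpha> y z))) \<partial>\<nu>)"
      by (simp only: Bochner_Integration.integral_mult_right_zero)
  qed
  also have "\<dots> \<le> (\<integral>\<^sup>+y. \<integral>\<^sup>+z. ennreal F * indicator ?A y * indicator ?B z
        + (\<Sum>j. ennreal (w j) * indicator (Aj j) y * indicator (Bj j) z) \<partial>\<nu> \<partial>\<nu>)"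
    by (intro nn_integral_mono ptw)
  also have "\<dots> = ennreal F * emeasure \<nu> ?A * emeasure \<nu> ?B
      + (\<Sum>j. ennreal (w j) * emeasure \<nu> (Aj j) * emeasure \<nu> (Bj j))"
    by (rule nn_integral_pair_indicators) (simp_all only: sets_borel, measurable)
  also have "\<dots> \<le> ennreal (F * measure \<nu> ?A * measure \<nu> ?B) + (\<Sum>j. ennreal (D * r ^ j))"
    using wF term_le
    by (intro add_mono suminf_le) (auto simp: emeasure_eq_measure ennreal_mult[symmetric])
  also have "(\<Sum>j. ennreal (D * r ^ j)) = ennreal (D * (1 / (1 - r)))"
    using r D by (intro suminf_ennreal_eq sums_mult geometric_sums) auto
  also have "ennreal (F * measure \<nu> ?A * measure \<nu> ?B) + \<dots>
      = ennreal (F * measure \<nu> ?A * measure \<nu> ?B + D * (1 / (1 - r)))"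
    using wF D r by (intro ennreal_plus[symmetric]) auto
  finally have "\<bar>\<integral>y. indicator ?A y * (\<integral>z. indicator ?B z * angular_kernel \<alpha> y z \<partial>\<nu>) \<partial>\<nu>\<bar>
      \<le> F * measure \<nu> ?A * measure \<nu> ?B + D * (1 / (1 - r))"
    using wF D r by (subst (asm) ennreal_le_iff) auto
  also have "F * measure \<nu> ?A * measure \<nu> ?B \<le> 72 * I * s powr (- (1 + \<alpha> / 2)) * measure \<nu> ?A"
    using mult_right_mono[OF B_le, of "measure \<nu> ?A"] by (simp add: mult_ac)
  finally show ?thesis by (simp add: D_def r_def)
qed

lemma flux_le:
  "\<bar>flux \<alpha> \<nu> s\<bar> \<le> (4210 * I * s powr (- (1 + \<alpha> / 2)) * c
      + 36864 / (1 - (1 / 2) powr (1 - \<alpha>)) * s powr (2 - \<alpha> / 2) * c\<^sup>2) * (S - s)\<^sup>2"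
proof -
  define A where "A = {y :: real^2. s < (norm y)\<^sup>2}"
  define B1 where "B1 = {z :: real^2. (norm z)\<^sup>2 \<le> s / 2}"
  define B2 where "B2 = {z :: real^2. s / 2 < (norm z)\<^sup>2 \<and> (norm z)\<^sup>2 \<le> s}"
  have m [measurable]: "A \<in> sets borel" "B1 \<in> sets borel" "B2 \<in> sets borel"
    unfolding A_def B1_def B2_def by measurable
  have s: "0 < s" using sS by simp
  let ?E = "s powr (- (1 + \<alpha> / 2))"
  let ?T = "\<lambda>C y. \<integral>z. indicator C z * angular_kernel \<alpha> y z \<partial>\<nu>"
  have "indicator {z. (norm z)\<^sup>2 \<le> s} z * angular_kernel \<alpha> y z
      = indicator B1 z * angular_kernel \<alpha> y z + indicator B2 z * angular_kernel \<alpha> y z" for y z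
    using s by (auto simp: B1_def B2_def indicator_def)
  then have "flux \<alpha> \<nu> s = (\<integral>y. indicator A y * (?T B1 y + ?T B2 y) \<partial>\<nu>)"
    unfolding flux_eq A_def
    by (simp only: Bochner_Integration.integral_add[OF integrable_restricted_kernel[OF m(2)]
        integrable_restricted_kernel[OF m(3)]])
  also have "\<dots> = (\<integral>y. indicator A y * ?T B1 y \<partial>\<nu>) + (\<integral>y. indicator A y * ?T B2 y \<partial>\<nu>)"
    by (simp only: distrib_left Bochner_Integration.integral_add[OF integrable_restricted_torque[OF m(1,2)]
        integrable_restricted_torque[OF m(1,3)]])
  finally have eq: "flux \<alpha> \<nu> s
      = (\<integral>y. indicator A y * ?T B1 y \<partial>\<nu>) + (\<integral>y. indicator A y * ?T B2 y \<partial>\<nu>)" .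
  have "norm (\<integral>y. indicator A y * ?T B1 y \<partial>\<nu>) \<le> (\<integral>y. 770 * I * ?E * indicator A y \<partial>\<nu>)"
  proof (rule Bochner_Integration.integral_norm_bound_integral)
    show "integrable \<nu> (\<lambda>y. 770 * I * ?E * indicator A y)"
      by (rule integrable_mult_right, rule integrable_real_indicator) (auto simp: emeasure_eq_measure)
    show "norm (indicator A y * ?T B1 y) \<le> 770 * I * ?E * indicator A y" for y
      using inner_torque_le[OF s, of y] by (auto simp: A_def B1_def indicator_def)
  qed (rule integrable_restricted_torque[OF m(1,2)])
  also have "\<dots> = 770 * I * ?E * measure \<nu> A" by simp
  \<comment> \<open>Here \<open>842 = 770 + 72\<close> collects the inner disc and the far pairs;
    the bound on the outer mass then gives \<open>4210 = 5 * 842\<close>.\<close>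
  finally have "\<bar>flux \<alpha> \<nu> s\<bar> \<le> 842 * I * ?E * measure \<nu> A
      + 36864 / (1 - (1 / 2) powr (1 - \<alpha>)) * s powr (2 - \<alpha> / 2) * c\<^sup>2 * (S - s)\<^sup>2"
    using torque_restrict_le unfolding eq A_def[symmetric] B2_def[symmetric] real_norm_def by linarith
  also have "842 * I * ?E * measure \<nu> A \<le> 842 * I * ?E * (5 * c * (S - s)\<^sup>2)"
    using measure_outside_le I_nonneg by (intro mult_left_mono) (auto simp: A_def)
  finally show ?thesis by (simp add: algebra_simps)
qed

end

section \<open>The moving barrier\<close>

context centered_measure
begin

lemma excess_nonneg: "0 \<le> excess \<nu> s"
  unfolding excess_def by (rule Bochner_Integration.integral_nonneg) simp

lemma excess_antimono: "s \<le> s' \<Longrightarrow> excess \<nu> s' \<le> excess \<nu> s"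
  unfolding excess_def by (intro integral_mono integrable_excess) auto

lemma excess_le: "0 \<le> s \<Longrightarrow> excess \<nu> s \<le> I"
proof -
  assume "0 \<le> s"
  then have "excess \<nu> s \<le> (\<integral>x. (norm x)\<^sup>2 \<partial>\<nu>)"
    unfolding excess_def by (intro integral_mono integrable_excess integrable_sq) auto
  then show ?thesis using inertia_le by simp
qed

lemma excess_lipschitz: "\<bar>excess \<nu> s - excess \<nu> s'\<bar> \<le> measure \<nu> UNIV * \<bar>s - s'\<bar>"
proof -
  have "\<bar>excess \<nu> s - excess \<nu> s'\<bar>
      = \<bar>\<integral>x. max 0 ((norm x)\<^sup>2 - s) - max 0 ((norm x)\<^sup>2 - s') \<partial>\<nu>\<bar>"
    unfolding excess_def by (simp add: integrable_excess)
  also have "\<dots> \<le> (\<integral>x. \<bar>s - s'\<bar> \<partial>\<nu>)"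
    by (intro integral_abs_bound_integral Bochner_Integration.integrable_diff integrable_excess) auto
  finally show ?thesis by simp
qed

text \<open>The slope of the excess is the outer mass \<open>P\<close>, so cubic growth to the left
  gives \<open>h * P \<le> c * h^3\<close> and forces \<open>P = 0\<close>. This excludes a positive
  maximum at \<open>s \<ge> S\<close>, where the barrier vanishes and rises only cubically to the
  left.\<close>

lemma excess_zero_if_cubic:
  assumes "0 < s" and c: "\<And>h. 0 < h \<Longrightarrow> h \<le> s \<Longrightarrow> excess \<nu> (s - h) - excess \<nu> s \<le> c * h ^ 3"
  shows "excess \<nu> s = 0"
proof -
  define P where "P = measure \<nu> {x. s < (norm x)\<^sup>2}"
  have [measurable]: "{x::real^2. s < (norm x)\<^sup>2} \<in> sets borel" by measurable
  have P_le: "P \<le> c * h\<^sup>2" if h: "0 < h" "h \<le> s" for h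
  proof -
    have "h * P \<le> excess \<nu> (s - h) - excess \<nu> s"
      unfolding P_def using h(1) by (rule measure_outside_le_excess_diff)
    also have "\<dots> \<le> h * (c * h\<^sup>2)"
      using c[OF h] by (simp add: power2_eq_square power3_eq_cube mult_ac)
    finally show ?thesis using h by simp
  qed
  have "((\<lambda>h. c * h\<^sup>2) \<longlongrightarrow> c * 0\<^sup>2) (at_right 0)"
    by (intro tendsto_intros)
  moreover have "\<forall>\<^sub>F h in at_right 0. P \<le> c * h\<^sup>2"
    using P_le assms(1) by (intro eventually_at_rightI[of 0 s]) auto
  ultimately have "P \<le> c * 0\<^sup>2"
    by (rule tendsto_lowerbound) simp
  then have "P = 0" by (simp add: P_def measure_le_0_iff)
  then have "AE x in \<nu>. \<not> s < (norm x)\<^sup>2"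
    by (subst AE_iff_measurable[of "{x. s < (norm x)\<^sup>2}"]) (auto simp: P_def emeasure_eq_measure)
  then have "AE x in \<nu>. max 0 ((norm x)\<^sup>2 - s) = 0" by eventually_elim simp
  then show ?thesis unfolding excess_def by (simp cong: integral_cong_AE add: integral_eq_zero_AE)
qed

end

text \<open>A supersolution \<open>barrier (16 I / S\<^sup>3) S\<close> whose support grows like \<open>t\<close> to the power
  \<open>2 / (4 + \<alpha>)\<close>. At a positive maximum of excess minus barrier, the barrier touches the excess,
  and there the flux is too weak to catch up with the growth of the barrier.\<close>

definition spread_rate :: "real \<Rightarrow> real \<Rightarrow> real" where
  "spread_rate \<alpha> I = I * (33680 + 16 * (36864 / (1 - (1 / 2) powr (1 - \<alpha>))))"

lemma half_powr_less_one: "\<alpha> < 1 \<Longrightarrow> (1 / 2 :: real) powr (1 - \<alpha>) < 1"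
  using powr_less_mono2[of "1 - \<alpha>" "1 / 2" 1] by simp

lemma spread_rate_nonneg: "\<alpha> < 1 \<Longrightarrow> 0 \<le> I \<Longrightarrow> 0 \<le> spread_rate \<alpha> I"
  using half_powr_less_one[of \<alpha>] by (simp add: spread_rate_def)

text \<open>The solution of \<open>S' = B / (2 + \<alpha>/2) * S powr (- (1 + \<alpha>/2))\<close>
  starting from \<open>S\<^sub>0\<close>.\<close>

definition front :: "real \<Rightarrow> real \<Rightarrow> real \<Rightarrow> real \<Rightarrow> real" where
  "front \<alpha> S\<^sub>0 B t = (S\<^sub>0 powr (2 + \<alpha> / 2) + B * t) powr (1 / (2 + \<alpha> / 2))"

text \<open>With this \<open>c\<close>, both terms of \<open>flux_le\<close> acquire the same power
  of \<open>S\<close>: the first by \<open>s \<ge> S / 4\<close>, at a cost of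
  \<open>4 powr (3/2) = 8\<close>, the second because \<open>s powr (2 - \<alpha>/2) * c\<close> is
  at most \<open>16 * I * S powr (- (1 + \<alpha>/2))\<close>. Hence \<open>33680 = 8 * 4210\<close>
  and the factor 16 in \<open>spread_rate\<close>.\<close>

lemma (in touched_measure) flux_le_barrier_speed:
  assumes c_eq: "c = 16 * I / S ^ 3"
  shows "\<bar>flux \<alpha> \<nu> s\<bar> \<le> spread_rate \<alpha> I * S powr (- (1 + \<alpha> / 2)) * c * (S - s)\<^sup>2"
proof -
  let ?D = "36864 / (1 - (1 / 2) powr (1 - \<alpha>))"
  have "(1 / 2 :: real) powr (1 - \<alpha>) < 1" using alpha by (intro half_powr_less_one)
  then have D: "0 \<le> ?D" by simp
  have s: "0 < s" using sS by simp
  have "s powr (- (1 + \<alpha> / 2)) \<le> (S / 4) powr (- (1 + \<alpha> / 2))"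
    using sS alpha by (intro powr_mono2') auto
  also have "\<dots> = S powr (- (1 + \<alpha> / 2)) * 4 powr (1 + \<alpha> / 2)"
  proof -
    have "(S / 4) powr (- e) = S powr (- e) * 4 powr e" for e
      using sS by (simp add: powr_divide powr_minus divide_simps)
    then show ?thesis .
  qed
  also have "\<dots> \<le> S powr (- (1 + \<alpha> / 2)) * 4 powr (3 / 2)"
    using alpha by (intro mult_left_mono powr_mono) auto
  also have "4 powr (3 / 2) = (8 :: real)"
  proof -
    have "4 powr (3 / 2) = ((2 :: real) powr 2) powr (3 / 2)" by simp
    also have "\<dots> = 2 powr 3" unfolding powr_powr by simp
    finally show ?thesis by simp
  qed
  finally have 1: "s powr (- (1 + \<alpha> / 2)) \<le> S powr (- (1 + \<alpha> / 2)) * 8" .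
  have "s powr (2 - \<alpha> / 2) * c \<le> S powr (2 - \<alpha> / 2) * c"
    using sS s alpha c by (intro mult_right_mono powr_mono2) auto
  also have "\<dots> = 16 * I * (S powr (2 - \<alpha> / 2) / S powr 3)"
    using sS by (simp add: c_eq powr_numeral)
  also have "S powr (2 - \<alpha> / 2) / S powr 3 = S powr (- (1 + \<alpha> / 2))"
    by (subst powr_diff[symmetric]) simp
  finally have 2: "s powr (2 - \<alpha> / 2) * c \<le> 16 * I * S powr (- (1 + \<alpha> / 2))" .
  have "4210 * I * s powr (- (1 + \<alpha> / 2)) * c + ?D * s powr (2 - \<alpha> / 2) * c\<^sup>2
      = (4210 * I * s powr (- (1 + \<alpha> / 2)) + ?D * (s powr (2 - \<alpha> / 2) * c)) * c"
    by (simp add: power2_eq_square algebra_simps)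
  also have "\<dots> \<le> (4210 * I * (S powr (- (1 + \<alpha> / 2)) * 8) + ?D * (16 * I * S powr (- (1 + \<alpha> / 2)))) * c"
    using 1 2 D c I_nonneg by (intro mult_right_mono add_mono mult_left_mono) auto
  also have "\<dots> = spread_rate \<alpha> I * S powr (- (1 + \<alpha> / 2)) * c"
    by (simp add: spread_rate_def algebra_simps)
  finally have le: "4210 * I * s powr (- (1 + \<alpha> / 2)) * c + ?D * s powr (2 - \<alpha> / 2) * c\<^sup>2
      \<le> spread_rate \<alpha> I * S powr (- (1 + \<alpha> / 2)) * c" .
  show ?thesis by (rule order_trans[OF flux_le mult_right_mono[OF le]]) simp
qed

text \<open>Below the front the barrier is \<open>16 I (1 - s / S)^3\<close>. The shrinking
  coefficient therefore reduces the growth only by the factor \<open>s / S\<close>, which is at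
  least \<open>1/4\<close> wherever touching can occur.\<close>

lemma has_real_derivative_barrier:
  assumes S: "(S has_real_derivative S') (at t within T)" and "0 < S t" "s < S t"
  shows "((\<lambda>t. barrier (16 * I / S t ^ 3) (S t) s) has_real_derivative
    3 * (16 * I / S t ^ 3) * (S t - s)\<^sup>2 * (s / S t) * S') (at t within T)"
proof -
  have deriv: "((\<lambda>t. 16 * I / S t ^ 3 * (S t - s) ^ 3) has_real_derivative
      3 * (16 * I / S t ^ 3) * (S t - s)\<^sup>2 * (s / S t) * S') (at t within T)"
    using assms
    by (auto intro!: derivative_eq_intros simp: field_simps power2_eq_square power3_eq_cube power_numeral_reduce)
  have "\<forall>\<^sub>F u in at t within T. s < S u"
    using DERIV_continuous[OF S] \<open>s < S t\<close> unfolding continuous_within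
    by (rule order_tendstoD(1))
  then have ev: "\<forall>\<^sub>F u in at t within T. 16 * I / S u ^ 3 * (S u - s) ^ 3 = barrier (16 * I / S u ^ 3) (S u) s"
    by eventually_elim (simp add: barrier_def)
  have eq: "16 * I / S t ^ 3 * (S t - s) ^ 3 = barrier (16 * I / S t ^ 3) (S t) s"
    using \<open>s < S t\<close> by (simp add: barrier_def)
  show ?thesis
    by (rule iffD1[OF has_field_derivative_cong_eventually[OF ev eq] deriv])
qed

lemma front_pos: "0 < S\<^sub>0 \<Longrightarrow> 0 \<le> B \<Longrightarrow> 0 \<le> t \<Longrightarrow> 0 < front \<alpha> S\<^sub>0 B t"
  using add_pos_nonneg[of "S\<^sub>0 powr (2 + \<alpha> / 2)" "B * t"] by (simp add: front_def)

lemma front_mono: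
  assumes "0 < \<alpha>" "0 < S\<^sub>0" "0 \<le> B" "0 \<le> t" "t \<le> t'"
  shows "front \<alpha> S\<^sub>0 B t \<le> front \<alpha> S\<^sub>0 B t'"
  using assms unfolding front_def
  by (intro powr_mono2 add_mono mult_left_mono add_nonneg_nonneg) auto

lemma has_real_derivative_front:
  assumes "0 < \<alpha>" "0 < S\<^sub>0" "0 \<le> B" "0 \<le> t"
  shows "(front \<alpha> S\<^sub>0 B has_real_derivative
    B / (2 + \<alpha> / 2) * front \<alpha> S\<^sub>0 B t powr (- (1 + \<alpha> / 2))) (at t within T)"
proof -
  define q where "q = 2 + \<alpha> / 2"
  define w where "w = S\<^sub>0 powr q + B * t"
  have q: "0 < q" using assms by (simp add: q_def)
  have w: "0 < w" using assms by (simp add: w_def add_pos_nonneg)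
  have deriv: "((\<lambda>t. (S\<^sub>0 powr q + B * t) powr (1 / q)) has_real_derivative
      1 / q * w powr (1 / q - 1) * B) (at t within T)"
    using w by (auto intro!: derivative_eq_intros simp: w_def)
  have eq: "w powr (1 / q - 1) = (w powr (1 / q)) powr (- (1 + \<alpha> / 2))"
  proof -
    have "- (1 + \<alpha> / 2) = 1 - q" by (simp add: q_def)
    then have "1 / q * (- (1 + \<alpha> / 2)) = 1 / q * (1 - q)" by (rule arg_cong)
    also have "\<dots> = 1 / q - 1" using q by (simp add: field_simps)
    finally show ?thesis unfolding powr_powr by simp
  qed
  have "((\<lambda>t. (S\<^sub>0 powr q + B * t) powr (1 / q)) has_real_derivative
      B / q * (w powr (1 / q)) powr (- (1 + \<alpha> / 2))) (at t within T)"
    by (rule DERIV_cong[OF deriv]) (simp add: eq)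
  then show ?thesis
    by (simp only: front_def[abs_def] q_def[symmetric] w_def)
qed

section \<open>Comparison of the excess with the moving barrier\<close>

lemma continuous_on_pair_lipschitz:
  fixes f :: "real \<Rightarrow> real \<Rightarrow> real"
  assumes lip: "\<And>s s' t. t \<in> T \<Longrightarrow> \<bar>f s t - f s' t\<bar> \<le> L * \<bar>s - s'\<bar>"
    and cont: "\<And>s. continuous_on T (f s)"
  shows "continuous_on (A \<times> T) (\<lambda>p. f (fst p) (snd p))"
  unfolding continuous_on_def
proof
  fix p assume p: "p \<in> A \<times> T"
  let ?F = "at p within A \<times> T"
  have fst: "((\<lambda>q. fst q) \<longlongrightarrow> fst p) ?F" and snd: "((\<lambda>q. snd q) \<longlongrightarrow> snd p) ?F"
    by (intro tendsto_intros)+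
  have in_T: "\<forall>\<^sub>F q in ?F. snd q \<in> T"
    by (auto simp: eventually_at_topological)
  have "((\<lambda>q. f (fst q) (snd q) - f (fst p) (snd q)) \<longlongrightarrow> 0) ?F"
  proof (rule Lim_null_comparison)
    show "\<forall>\<^sub>F q in ?F. norm (f (fst q) (snd q) - f (fst p) (snd q)) \<le> L * \<bar>fst q - fst p\<bar>"
      using in_T by eventually_elim (use lip in auto)
    have "((\<lambda>q. L * \<bar>fst q - fst p\<bar>) \<longlongrightarrow> L * \<bar>fst p - fst p\<bar>) ?F"
      by (intro tendsto_intros)
    then show "((\<lambda>q. L * \<bar>fst q - fst p\<bar>) \<longlongrightarrow> 0) ?F" by simp
  qed
  moreover have "((\<lambda>q. f (fst p) (snd q)) \<longlongrightarrow> f (fst p) (snd p)) ?F"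
    by (rule continuous_on_tendsto_compose[OF cont snd]) (use p in_T in auto)
  ultimately have "((\<lambda>q. (f (fst q) (snd q) - f (fst p) (snd q)) + f (fst p) (snd q))
      \<longlongrightarrow> 0 + f (fst p) (snd p)) ?F"
    by (rule tendsto_add)
  then show "((\<lambda>q. f (fst q) (snd q)) \<longlongrightarrow> f (fst p) (snd p)) ?F" by simp
qed

text \<open>A maximum principle in level and time: at a positive maximum the time derivative of
  excess minus barrier would be negative, so an earlier time would give a larger value. In
  \<open>B\<close>, the factor \<open>4/3\<close> undoes the 3 from differentiating the cube and the
  bound \<open>s / S \<ge> 1/4\<close>, the factor \<open>2 + \<alpha>/2\<close> undoes the exponent
  of the front, and the added 1 makes the inequality strict.\<close>

lemma excess_vanishes_beyond_front:
  fixes \<nu> :: "real \<Rightarrow> (real^2) measure" and \<alpha> I U m \<rho> \<kappa> :: real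
  defines "B \<equiv> 4 / 3 * (2 + \<alpha> / 2) * (\<bar>\<kappa>\<bar> * spread_rate \<alpha> I + 1)"
  assumes \<nu>: "\<And>t. 0 \<le> t \<Longrightarrow> centered_measure (\<nu> t) \<alpha> I U"
    and mass: "\<And>t. 0 \<le> t \<Longrightarrow> measure (\<nu> t) UNIV = m"
    and deriv: "\<And>s t. 0 < s \<Longrightarrow> 0 \<le> t \<Longrightarrow>
      ((\<lambda>t. excess (\<nu> t) s) has_real_derivative \<kappa> * flux \<alpha> (\<nu> t) s) (at t within {0..})"
    and \<rho>: "0 < \<rho>" "\<And>s. \<rho> \<le> s \<Longrightarrow> excess (\<nu> 0) s = 0"
    and I: "0 < I" and \<alpha>: "0 < \<alpha>" "\<alpha> < 1" and t1: "0 \<le> t1"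
  shows "excess (\<nu> t1) (front \<alpha> (2 * \<rho>) B t1) = 0"
proof (rule ccontr)
  define S where "S = front \<alpha> (2 * \<rho>) B"
  define g where "g s t = excess (\<nu> t) s - barrier (16 * I / S t ^ 3) (S t) s" for s t
  have E: "0 \<le> spread_rate \<alpha> I" using I \<alpha> by (intro spread_rate_nonneg) auto
  have B: "0 \<le> B" using E \<alpha> by (simp add: B_def)
  have S_pos: "0 < S t" if "0 \<le> t" for t
    using front_pos[of "2 * \<rho>" B t \<alpha>] that \<rho> B by (simp add: S_def)
  \<comment> \<open>Starting the front at \<open>2 * \<rho>\<close> makes the initial barrier at
    least \<open>16 I / 8 = 2 I\<close> for levels below \<open>\<rho>\<close>; beyond
    \<open>\<rho>\<close> there is no initial excess.\<close>
  have S0: "S 0 = 2 * \<rho>" using \<rho> \<alpha> by (simp add: S_def front_def powr_powr)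
  have S_mono: "S t \<le> S t'" if "0 \<le> t" "t \<le> t'" for t t'
    unfolding S_def using front_mono[of \<alpha> "2 * \<rho>" B t t'] that \<rho> B \<alpha> by simp
  have S_deriv: "(S has_real_derivative B / (2 + \<alpha> / 2) * S t powr (- (1 + \<alpha> / 2))) (at t within T)"
    if "0 \<le> t" for t T
    unfolding S_def using has_real_derivative_front[of \<alpha> "2 * \<rho>" B t T] that \<rho> B \<alpha> by simp
  assume "excess (\<nu> t1) (front \<alpha> (2 * \<rho>) B t1) \<noteq> 0"
  then have pos1: "0 < g (S t1) t1"
    using centered_measure.excess_nonneg[OF \<nu>[OF t1], of "S t1"]
    by (simp add: g_def barrier_def S_def)
  \<comment> \<open>Levels stay away from zero because the time derivative is known only for
    positive \<open>s\<close>. The omitted levels lie below \<open>S t / 4\<close>, where the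
    barrier already exceeds every possible excess.\<close>
  define K where "K = {\<rho> / 4..S t1} \<times> {0..t1}"
  have S_cont: "continuous_on {0..t1} S"
    by (rule DERIV_continuous_on[OF S_deriv]) auto
  have "continuous_on {0..t1} (\<lambda>t. excess (\<nu> t) s)" if "0 < s" for s
  proof (rule continuous_on_subset[of "{0..}"])
    show "continuous_on {0..} (\<lambda>t. excess (\<nu> t) s)"
      by (rule DERIV_continuous_on[OF deriv]) (use that in auto)
  qed auto
  \<comment> \<open>Levels are clamped at \<open>\<rho> / 4\<close>, since the joint continuity
    criterion asks for continuity in time at every real level. On \<open>K\<close> the clamp has no
    effect.\<close>
  then have "continuous_on {0..t1} (\<lambda>t. excess (\<nu> t) (max (\<rho> / 4) s))" for s
    using \<rho> by simp
  then have "continuous_on K (\<lambda>p. excess (\<nu> (snd p)) (max (\<rho> / 4) (fst p)))"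
    unfolding K_def
  proof (intro continuous_on_pair_lipschitz[where L = m])
    fix s s' t assume t: "t \<in> {0..t1}"
    have "\<bar>excess (\<nu> t) (max (\<rho> / 4) s) - excess (\<nu> t) (max (\<rho> / 4) s')\<bar>
        \<le> m * \<bar>max (\<rho> / 4) s - max (\<rho> / 4) s'\<bar>"
      using centered_measure.excess_lipschitz[OF \<nu>, of t] mass[of t] t by simp
    also have "\<dots> \<le> m * \<bar>s - s'\<bar>"
      using mass[of t] t measure_nonneg[of "\<nu> t" UNIV] by (intro mult_left_mono) auto
    finally show "\<bar>excess (\<nu> t) (max (\<rho> / 4) s) - excess (\<nu> t) (max (\<rho> / 4) s')\<bar> \<le> m * \<bar>s - s'\<bar>" .
  qed
  then have "continuous_on K (\<lambda>p. excess (\<nu> (snd p)) (fst p))"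
    by (rule continuous_on_cong[THEN iffD1, rotated 2]) (auto simp: K_def max_def)
  moreover have "continuous_on K (\<lambda>p. barrier (16 * I / S (snd p) ^ 3) (S (snd p)) (fst p))"
    unfolding barrier_def
    by (intro continuous_intros continuous_on_compose2[OF S_cont])
      (auto simp: K_def less_imp_neq[OF S_pos, symmetric])
  ultimately have "continuous_on K (\<lambda>p. g (fst p) (snd p))"
    unfolding g_def by (rule continuous_on_diff)
  moreover have "compact K" unfolding K_def by (intro compact_Times compact_Icc)
  moreover have mem1: "(S t1, t1) \<in> K"
    using S_mono[of 0 t1] S0 \<rho> t1 by (auto simp: K_def)
  ultimately have "\<exists>p\<in>K. \<forall>q\<in>K. g (fst q) (snd q) \<le> g (fst p) (snd p)"
    by (intro continuous_attains_sup) auto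
  then obtain p where p: "p \<in> K" "\<And>q. q \<in> K \<Longrightarrow> g (fst q) (snd q) \<le> g (fst p) (snd p)"
    by blast
  obtain s t where st: "p = (s, t)" by (cases p)
  have st_K: "\<rho> / 4 \<le> s" "s \<le> S t1" "0 \<le> t" "t \<le> t1" using p(1) by (auto simp: st K_def)
  have max: "g s' t' \<le> g s t" if "\<rho> / 4 \<le> s'" "s' \<le> S t1" "0 \<le> t'" "t' \<le> t1" for s' t'
    using p(2)[of "(s', t')"] that by (simp add: st K_def)
  have pos: "0 < g s t" using pos1 p(2)[OF mem1] by (simp add: st)
  have s_pos: "0 < s" using st_K \<rho> by simp
  interpret centered_measure "\<nu> t" \<alpha> I U using \<nu> st_K by simp
  define c where "c = 16 * I / S t ^ 3"
  have c: "0 < c" using S_pos[of t] st_K I by (simp add: c_def)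
  have barrier_nonneg: "0 \<le> barrier c (S t) s'" for s' using c by (simp add: barrier_def)
  \<comment> \<open>Here \<open>16 * (3/4)^3 = 27/4 > 1\<close>, whereas the excess is at most
    \<open>I\<close>. A positive difference thus forces \<open>s \<ge> S t / 4\<close>.\<close>
  have barrier_inner: "I < barrier c (S t) s'" if "s' < S t / 4" for s'
  proof -
    have "(3 / 4 * S t) ^ 3 \<le> (max 0 (S t - s')) ^ 3"
      using that S_pos[of t] st_K by (intro power_mono) auto
    then have "c * (3 / 4 * S t) ^ 3 \<le> barrier c (S t) s'"
      using c by (simp add: barrier_def)
    moreover have "c * (3 / 4 * S t) ^ 3 = 27 / 4 * I"
      using S_pos[of t] st_K by (simp add: c_def power_mult_distrib power_divide)
    ultimately show ?thesis using I by simp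
  qed
  have excess_pos: "0 < excess (\<nu> t) s"
    using pos barrier_nonneg[of s] by (simp add: g_def c_def[symmetric])
  have s_ge: "S t / 4 \<le> s"
    using barrier_inner[of s] pos excess_le[of s] s_pos by (force simp: g_def c_def[symmetric])
  \<comment> \<open>The maximum over \<open>K\<close> is extended to all nonnegative levels: below
    \<open>\<rho> / 4\<close> the difference is not positive, and above \<open>S t1\<close> the
    barrier is zero while the excess decreases.\<close>
  have touch: "excess (\<nu> t) s' - barrier c (S t) s' \<le> excess (\<nu> t) s - barrier c (S t) s"
    if s': "0 \<le> s'" for s'
  proof -
    consider "s' < \<rho> / 4" | "\<rho> / 4 \<le> s'" "s' \<le> S t1" | "S t1 < s'" by linarith
    then have "g s' t \<le> g s t"
    proof cases
      case 1
      then have "s' < S t / 4" using S_mono[of 0 t] S0 st_K \<rho> by simp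
      then have "g s' t \<le> 0"
        using barrier_inner[of s'] excess_le[of s'] s' by (simp add: g_def c_def[symmetric])
      then show ?thesis using pos by simp
    next
      case 2
      then show ?thesis using max[of s' t] st_K by simp
    next
      case 3
      have "S t \<le> S t1" using S_mono[of t t1] st_K by simp
      then have "g s' t \<le> g (S t1) t"
        using 3 excess_antimono[of "S t1" s'] by (simp add: g_def barrier_def)
      then show ?thesis using max[of "S t1" t] st_K by simp
    qed
    then show ?thesis by (simp add: g_def c_def[symmetric])
  qed
  have s_less: "s < S t"
  proof (rule ccontr)
    assume "\<not> s < S t"
    then have "excess (\<nu> t) (s - h) - excess (\<nu> t) s \<le> c * h ^ 3" if "0 < h" "h \<le> s" for h
    proof -
      have "(max 0 (S t - (s - h))) ^ 3 \<le> h ^ 3"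
        using that \<open>\<not> s < S t\<close> by (intro power_mono) auto
      then have "barrier c (S t) (s - h) \<le> c * h ^ 3" using c by (simp add: barrier_def)
      then show ?thesis
        using touch[of "s - h"] that \<open>\<not> s < S t\<close> by (simp add: barrier_def)
    qed
    then have "excess (\<nu> t) s = 0" by (rule excess_zero_if_cubic[OF s_pos])
    then show False using excess_pos by simp
  qed
  \<comment> \<open>The contradiction looks backward in time, so the maximum must not sit at the
    initial time.\<close>
  have t_pos: "0 < t"
  proof (rule ccontr)
    assume "\<not> 0 < t"
    then have t0: "t = 0" using st_K by simp
    show False
    proof (cases "\<rho> \<le> s")
      case True
      then show ?thesis using excess_pos \<rho>(2)[of s] t0 by simp
    next
      case False
      have "\<rho> ^ 3 \<le> (max 0 (S t - s)) ^ 3"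
        using False \<rho> t0 S0 by (intro power_mono) auto
      then have "c * \<rho> ^ 3 \<le> barrier c (S t) s" using c by (simp add: barrier_def)
      moreover have "c * \<rho> ^ 3 = 2 * I"
        using \<rho> by (simp add: c_def t0 S0 power_mult_distrib)
      ultimately show False
        using pos excess_le[of s] s_pos I by (simp add: g_def c_def[symmetric])
    qed
  qed
  interpret touched_measure "\<nu> t" \<alpha> I U s "S t" c
    by unfold_locales (use c s_ge s_less touch S_pos[of t] st_K in auto)
  let ?S' = "B / (2 + \<alpha> / 2) * S t powr (- (1 + \<alpha> / 2))"
  let ?d = "\<kappa> * flux \<alpha> (\<nu> t) s - 3 * c * (S t - s)\<^sup>2 * (s / S t) * ?S'"
  have "((\<lambda>t. g s t) has_real_derivative ?d) (at t within {0..})"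
    unfolding g_def c_def
    by (intro DERIV_diff deriv has_real_derivative_barrier S_deriv) (use s_pos st_K s_less S_pos in auto)
  moreover have "?d < 0"
  proof -
    define X where "X = S t powr (- (1 + \<alpha> / 2)) * c * (S t - s)\<^sup>2"
    have X: "0 < X" using S_pos[of t] st_K c s_less by (simp add: X_def)
    have "\<kappa> * flux \<alpha> (\<nu> t) s \<le> \<bar>\<kappa>\<bar> * \<bar>flux \<alpha> (\<nu> t) s\<bar>"
      by (simp add: abs_mult[symmetric])
    also have "\<dots> \<le> \<bar>\<kappa>\<bar> * (spread_rate \<alpha> I * X)"
      using flux_le_barrier_speed[OF c_def] by (intro mult_left_mono) (auto simp: X_def mult_ac)
    also have "\<dots> < (\<bar>\<kappa>\<bar> * spread_rate \<alpha> I + 1) * X" using X by (simp add: algebra_simps)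
    also have "\<dots> = 3 * (1 / 4) * (B / (2 + \<alpha> / 2)) * X"
    proof -
      have "3 * (1 / 4) * (4 / 3 * q * x / q) = x" if "q \<noteq> 0" for q x :: real using that by simp
      from this[of "2 + \<alpha> / 2" "\<bar>\<kappa>\<bar> * spread_rate \<alpha> I + 1"] show ?thesis
        using \<alpha> unfolding B_def by simp
    qed
    also have "\<dots> \<le> 3 * (s / S t) * (B / (2 + \<alpha> / 2)) * X"
      using s_ge S_pos[of t] st_K X B \<alpha> by (intro mult_right_mono mult_left_mono) (auto simp: field_simps)
    also have "\<dots> = 3 * c * (S t - s)\<^sup>2 * (s / S t) * ?S'" by (simp add: X_def)
    finally show ?thesis by simp
  qed
  ultimately obtain e where e: "0 < e" "\<And>h. 0 < h \<Longrightarrow> t - h \<in> {0..} \<Longrightarrow> h < e \<Longrightarrow> g s t < g s (t - h)"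
    using has_real_derivative_neg_dec_left by blast
  \<comment> \<open>A step into the past that stays in the time interval, so that maximality over
    \<open>K\<close> still applies.\<close>
  define h where "h = min t (e / 2)"
  have "g s t < g s (t - h)" using e(1) t_pos by (intro e(2)) (auto simp: h_def)
  moreover have "g s (t - h) \<le> g s t" using st_K t_pos e(1) by (intro max) (auto simp: h_def)
  ultimately show False by simp
qed

section \<open>Test functions\<close>

text \<open>A class of functions closed under differentiation, hence contained in every class
  \<open>Ck\<close>.\<close>

inductive elementary :: "('a::euclidean_space \<Rightarrow> real) \<Rightarrow> bool" where
  elementary_const: "elementary (\<lambda>x. c)"
| elementary_inner: "elementary (\<lambda>x. x \<bullet> b)"
| elementary_add: "elementary f \<Longrightarrow> elementary g \<Longrightarrow> elementary (\<lambda>x. f x + g x)"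
| elementary_mult: "elementary f \<Longrightarrow> elementary g \<Longrightarrow> elementary (\<lambda>x. f x * g x)"
| elementary_inverse: "elementary f \<Longrightarrow> (\<And>x. f x \<noteq> 0) \<Longrightarrow> elementary (\<lambda>x. inverse (f x))"
| elementary_sqrt: "elementary f \<Longrightarrow> (\<And>x. 0 < f x) \<Longrightarrow> elementary (\<lambda>x. sqrt (f x))"

lemma elementary_derivative:
  assumes "elementary f"
  shows "\<exists>f'. (\<forall>x. (f has_derivative f' x) (at x)) \<and> (\<forall>b. elementary (\<lambda>x. f' x b))"
  using assms
proof induction
  case (elementary_const c)
  show ?case
    by (rule exI[of _ "\<lambda>x h. 0"]) (auto intro: elementary.elementary_const)
next
  case (elementary_inner b)
  show ?case
    by (rule exI[of _ "\<lambda>x h. h \<bullet> b"])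
      (auto intro!: elementary.elementary_const derivative_eq_intros)
next
  case (elementary_add f g)
  then obtain f' g' where d: "\<And>x. (f has_derivative f' x) (at x)" "\<And>x. (g has_derivative g' x) (at x)"
    and e: "\<And>b. elementary (\<lambda>x. f' x b)" "\<And>b. elementary (\<lambda>x. g' x b)" by blast
  show ?case
    by (rule exI[of _ "\<lambda>x h. f' x h + g' x h"])
      (auto intro: elementary.elementary_add e has_derivative_add d)
next
  case (elementary_mult f g)
  then obtain f' g' where d: "\<And>x. (f has_derivative f' x) (at x)" "\<And>x. (g has_derivative g' x) (at x)"
    and e: "\<And>b. elementary (\<lambda>x. f' x b)" "\<And>b. elementary (\<lambda>x. g' x b)" by blast
  show ?case
    by (rule exI[of _ "\<lambda>x h. f x * g' x h + f' x h * g x"])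
      (auto intro!: elementary.elementary_add elementary.elementary_mult elementary_mult.hyps
        e has_derivative_mult d)
next
  case (elementary_inverse f)
  then obtain f' where d: "\<And>x. (f has_derivative f' x) (at x)"
    and e: "\<And>b. elementary (\<lambda>x. f' x b)" by blast
  have i: "elementary (\<lambda>x. inverse (f x))"
    by (intro elementary.elementary_inverse elementary_inverse.hyps)
  have "elementary (\<lambda>x. (-1) * (inverse (f x) * f' x b * inverse (f x)))" for b
    by (intro elementary.elementary_mult elementary.elementary_const i e)
  then show ?case
    by (intro exI[of _ "\<lambda>x h. - (inverse (f x) * f' x h * inverse (f x))"])
      (auto intro!: Deriv.has_derivative_inverse d elementary_inverse.hyps)
next
  case (elementary_sqrt f)
  then obtain f' where d: "\<And>x. (f has_derivative f' x) (at x)"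
    and e: "\<And>b. elementary (\<lambda>x. f' x b)" by blast
  have s: "elementary (\<lambda>x. sqrt (f x))"
    by (intro elementary.elementary_sqrt elementary_sqrt.hyps)
  have i: "elementary (\<lambda>x. inverse (2 * sqrt (f x)))"
    by (intro elementary.elementary_inverse elementary.elementary_mult elementary.elementary_const s)
      (use elementary_sqrt.hyps in \<open>auto simp: less_imp_neq[symmetric]\<close>)
  have "elementary (\<lambda>x. f' x b * inverse (2 * sqrt (f x)))" for b
    by (intro elementary.elementary_mult i e)
  moreover have "((\<lambda>x. sqrt (f x)) has_derivative (\<lambda>h. f' x h * inverse (2 * sqrt (f x)))) (at x)" for x
    using elementary_sqrt.hyps(2)[of x] d[of x]
    by (auto intro!: derivative_eq_intros simp: field_simps)
  ultimately show ?case
    by (intro exI[of _ "\<lambda>x h. f' x h * inverse (2 * sqrt (f x))"]) auto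
qed

lemma elementary_Ck: "elementary f \<Longrightarrow> Ck k f"
proof (induction k arbitrary: f)
  case 0
  obtain f' where "\<And>x. (f has_derivative f' x) (at x)"
    using elementary_derivative[OF 0] by blast
  then show ?case
    by (auto intro!: continuous_at_imp_continuous_on has_derivative_continuous)
next
  case (Suc k)
  obtain f' where d: "\<And>x. (f has_derivative f' x) (at x)"
    and e: "\<And>b. elementary (\<lambda>x. f' x b)"
    using elementary_derivative[OF Suc.prems] by blast
  have "frechet_derivative f (at x) = f' x" for x
    using frechet_derivative_at[OF d] by simp
  moreover have "f differentiable_on UNIV"
    using d by (auto simp: differentiable_on_def differentiable_def)
  ultimately show ?case using Suc.IH[OF e] by simp
qed

lemma elementary_smooth: "elementary f \<Longrightarrow> smooth f"
  by (simp add: smooth_def elementary_Ck)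

section \<open>Smooth bounded approximations of the hinge\<close>

definition soft_plus :: "real \<Rightarrow> real \<Rightarrow> real" where
  "soft_plus \<epsilon> \<sigma> = (\<sigma> + sqrt (\<sigma> * \<sigma> + \<epsilon> * \<epsilon>)) / 2"

text \<open>The hinge of the squared radius is neither smooth nor bounded. The division saturates
  the values at \<open>1 / \<epsilon>\<close> and makes the slope decay, so that the composition
  with the squared radius has a bounded gradient.\<close>

definition soft_cap :: "real \<Rightarrow> real \<Rightarrow> real" where
  "soft_cap \<epsilon> \<sigma> = soft_plus \<epsilon> \<sigma> / (1 + \<epsilon> * soft_plus \<epsilon> \<sigma>)"

definition soft_cap' :: "real \<Rightarrow> real \<Rightarrow> real" where
  "soft_cap' \<epsilon> \<sigma> = (1 + \<sigma> / sqrt (\<sigma> * \<sigma> + \<epsilon> * \<epsilon>)) / 2 / (1 + \<epsilon> * soft_plus \<epsilon> \<sigma>)\<^sup>2"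

context
  fixes \<epsilon> :: real
  assumes eps: "0 < \<epsilon>"
begin

lemma soft_root: "\<bar>\<sigma>\<bar> < sqrt (\<sigma> * \<sigma> + \<epsilon> * \<epsilon>)" "sqrt (\<sigma> * \<sigma> + \<epsilon> * \<epsilon>) \<le> \<bar>\<sigma>\<bar> + \<epsilon>"
proof -
  show "\<bar>\<sigma>\<bar> < sqrt (\<sigma> * \<sigma> + \<epsilon> * \<epsilon>)"
    by (rule real_less_rsqrt) (use eps in \<open>simp add: power2_eq_square\<close>)
  show "sqrt (\<sigma> * \<sigma> + \<epsilon> * \<epsilon>) \<le> \<bar>\<sigma>\<bar> + \<epsilon>"
    by (rule real_le_lsqrt) (use eps in \<open>auto simp: power2_eq_square algebra_simps\<close>)
qed

lemma soft_plus_pos: "0 < soft_plus \<epsilon> \<sigma>"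
  and soft_plus_ge: "max 0 \<sigma> \<le> soft_plus \<epsilon> \<sigma>"
  and soft_plus_le: "soft_plus \<epsilon> \<sigma> \<le> max 0 \<sigma> + \<epsilon>"
  using soft_root[of \<sigma>] eps by (auto simp: soft_plus_def)

lemma soft_denominator_pos: "0 < 1 + \<epsilon> * soft_plus \<epsilon> \<sigma>"
  using soft_plus_pos[of \<sigma>] eps by (simp add: add_pos_pos)

lemma soft_cap_bounds: "0 \<le> soft_cap \<epsilon> \<sigma>" "soft_cap \<epsilon> \<sigma> \<le> 1 / \<epsilon>" "soft_cap \<epsilon> \<sigma> \<le> max 0 \<sigma> + \<epsilon>"
proof -
  let ?v = "soft_plus \<epsilon> \<sigma>"
  note p = soft_plus_pos[of \<sigma>] soft_denominator_pos[of \<sigma>] eps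
  show "0 \<le> soft_cap \<epsilon> \<sigma>" using p by (simp add: soft_cap_def)
  show "soft_cap \<epsilon> \<sigma> \<le> 1 / \<epsilon>" using p by (simp add: soft_cap_def field_simps)
  have "soft_cap \<epsilon> \<sigma> \<le> ?v / 1" unfolding soft_cap_def using p by (intro divide_left_mono) auto
  then show "soft_cap \<epsilon> \<sigma> \<le> max 0 \<sigma> + \<epsilon>" using soft_plus_le[of \<sigma>] by simp
qed

lemma soft_slope: "0 \<le> (1 + \<sigma> / sqrt (\<sigma> * \<sigma> + \<epsilon> * \<epsilon>)) / 2" "(1 + \<sigma> / sqrt (\<sigma> * \<sigma> + \<epsilon> * \<epsilon>)) / 2 \<le> 1"
proof -
  define q where "q = \<sigma> / sqrt (\<sigma> * \<sigma> + \<epsilon> * \<epsilon>)"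
  have "0 < sqrt (\<sigma> * \<sigma> + \<epsilon> * \<epsilon>)" using soft_root(1)[of \<sigma>] by linarith
  then have "- 1 \<le> q" "q \<le> 1"
    unfolding q_def using soft_root(1)[of \<sigma>]
    by (simp_all only: pos_le_divide_eq pos_divide_le_eq)
  then show "0 \<le> (1 + \<sigma> / sqrt (\<sigma> * \<sigma> + \<epsilon> * \<epsilon>)) / 2"
    and "(1 + \<sigma> / sqrt (\<sigma> * \<sigma> + \<epsilon> * \<epsilon>)) / 2 \<le> 1"
    unfolding q_def[symmetric] by simp_all
qed

lemma soft_cap'_nonneg: "0 \<le> soft_cap' \<epsilon> \<sigma>"
  using soft_slope[of \<sigma>] by (simp add: soft_cap'_def)

lemma soft_cap'_le: "soft_cap' \<epsilon> \<sigma> \<le> 1 / (1 + \<epsilon> * soft_plus \<epsilon> \<sigma>)\<^sup>2"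
  unfolding soft_cap'_def using soft_slope[of \<sigma>] by (intro divide_right_mono) auto

lemma soft_denominator_sq_ge: "1 + \<epsilon> * soft_plus \<epsilon> \<sigma> \<le> (1 + \<epsilon> * soft_plus \<epsilon> \<sigma>)\<^sup>2"
  using soft_plus_pos[of \<sigma>] eps by (simp add: power2_eq_square algebra_simps)

lemma soft_cap'_le_1: "soft_cap' \<epsilon> \<sigma> \<le> 1"
proof -
  have "1 \<le> (1 + \<epsilon> * soft_plus \<epsilon> \<sigma>)\<^sup>2"
    using soft_denominator_sq_ge[of \<sigma>] soft_plus_pos[of \<sigma>] eps by (smt (verit) mult_pos_pos)
  then have "1 / (1 + \<epsilon> * soft_plus \<epsilon> \<sigma>)\<^sup>2 \<le> 1 / 1" by (intro divide_left_mono) auto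
  then show ?thesis using soft_cap'_le[of \<sigma>] by simp
qed

lemma has_real_derivative_soft_cap: "(soft_cap \<epsilon> has_real_derivative soft_cap' \<epsilon> \<sigma>) (at \<sigma>)"
proof -
  let ?r = "sqrt (\<sigma> * \<sigma> + \<epsilon> * \<epsilon>)" and ?v = "soft_plus \<epsilon> \<sigma>"
  have r: "0 < ?r" using soft_root(1)[of \<sigma>] by linarith
  have "(soft_plus \<epsilon> has_real_derivative (1 + \<sigma> / ?r) / 2) (at \<sigma>)"
    unfolding soft_plus_def[abs_def] using r
    by (auto intro!: derivative_eq_intros simp: field_simps)
  then have "((\<lambda>\<sigma>. soft_plus \<epsilon> \<sigma> / (1 + \<epsilon> * soft_plus \<epsilon> \<sigma>)) has_real_derivative
      ((1 + \<sigma> / ?r) / 2 * (1 + \<epsilon> * ?v) - ?v * (\<epsilon> * ((1 + \<sigma> / ?r) / 2))) / ((1 + \<epsilon> * ?v) * (1 + \<epsilon> * ?v))) (at \<sigma>)"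
    using soft_denominator_pos[of \<sigma>] by (auto intro!: derivative_eq_intros)
  moreover have "((1 + \<sigma> / ?r) / 2 * (1 + \<epsilon> * ?v) - ?v * (\<epsilon> * ((1 + \<sigma> / ?r) / 2))) / ((1 + \<epsilon> * ?v) * (1 + \<epsilon> * ?v))
      = soft_cap' \<epsilon> \<sigma>"
  proof -
    have "h * (1 + \<epsilon> * ?v) - ?v * (\<epsilon> * h) = h" for h by (simp add: algebra_simps)
    then show ?thesis unfolding soft_cap'_def power2_eq_square by (simp only:)
  qed
  ultimately show ?thesis by (simp add: soft_cap_def[abs_def])
qed

text \<open>The three terms account for the layer around the jump, for the tails of the smoothed step
  and for the saturation at infinity.\<close>

lemma soft_cap'_approximates_step:
  assumes "0 < \<eta>"
  shows "\<bar>soft_cap' \<epsilon> \<sigma> - indicator {0<..} \<sigma>\<bar>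
    \<le> indicator {-\<eta>..\<eta>} \<sigma> + (\<epsilon> / \<eta>)\<^sup>2 + sqrt (2 * \<epsilon> * (max 0 \<sigma> + \<epsilon>))"
proof (cases "\<bar>\<sigma>\<bar> \<le> \<eta>")
  case True
  have "\<bar>soft_cap' \<epsilon> \<sigma> - indicator {0<..} \<sigma>\<bar> \<le> 1"
    using soft_cap'_nonneg[of \<sigma>] soft_cap'_le_1[of \<sigma>] by (auto simp: indicator_def)
  moreover have "indicator {-\<eta>..\<eta>} \<sigma> = (1 :: real)" using True by (auto simp: abs_le_iff)
  moreover have "0 \<le> sqrt (2 * \<epsilon> * (max 0 \<sigma> + \<epsilon>))" using eps by simp
  ultimately show ?thesis by (smt (verit) zero_le_power2)
next
  case False
  define r where "r = sqrt (\<sigma> * \<sigma> + \<epsilon> * \<epsilon>)"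
  define p where "p = (1 + \<sigma> / r) / 2"
  define d where "d = (1 + \<epsilon> * soft_plus \<epsilon> \<sigma>)\<^sup>2"
  have r: "\<bar>\<sigma>\<bar> < r" "r\<^sup>2 = \<sigma>\<^sup>2 + \<epsilon>\<^sup>2"
    using soft_root(1)[of \<sigma>] by (auto simp: r_def power2_eq_square)
  have p: "0 \<le> p" "p \<le> 1" using soft_slope[of \<sigma>] by (auto simp: p_def r_def)
  have d: "1 \<le> d"
    using soft_denominator_sq_ge[of \<sigma>] soft_plus_pos[of \<sigma>] eps unfolding d_def
    by (smt (verit) mult_pos_pos)
  \<comment> \<open>Rationalizing the difference of \<open>r\<close> and the modulus of
    \<open>\<sigma>\<close> yields a quadratic gain in \<open>\<epsilon>\<close>; both denominators
    are at least \<open>\<eta>\<close>.\<close>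
  have "1 - \<bar>\<sigma>\<bar> / r \<le> (\<epsilon> / \<eta>)\<^sup>2"
  proof -
    have "r - \<bar>\<sigma>\<bar> = \<epsilon>\<^sup>2 / (r + \<bar>\<sigma>\<bar>)"
      using r by (simp add: field_simps power2_eq_square abs_mult_self_eq)
    also have "\<dots> \<le> \<epsilon>\<^sup>2 / \<eta>"
      using r False assms by (intro divide_left_mono) auto
    finally have "(r - \<bar>\<sigma>\<bar>) / r \<le> (\<epsilon>\<^sup>2 / \<eta>) / r"
      using r by (intro divide_right_mono) auto
    also have "\<dots> \<le> (\<epsilon>\<^sup>2 / \<eta>) / \<eta>"
      using r False assms by (intro divide_left_mono) auto
    finally show ?thesis using r by (simp add: field_simps power2_eq_square)
  qed
  moreover have "\<bar>p - indicator {0<..} \<sigma>\<bar> = (1 - \<bar>\<sigma>\<bar> / r) / 2"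
  proof (cases "0 < \<sigma>")
    case True
    then have "p - indicator {0<..} \<sigma> = - ((1 - \<bar>\<sigma>\<bar> / r) / 2)" by (simp add: p_def field_simps)
    moreover have "\<bar>\<sigma>\<bar> / r \<le> 1" using r by simp
    ultimately show ?thesis by simp
  next
    case False
    then have "p - indicator {0<..} \<sigma> = (1 - \<bar>\<sigma>\<bar> / r) / 2" by (simp add: p_def field_simps)
    moreover have "\<bar>\<sigma>\<bar> / r \<le> 1" using r by simp
    ultimately show ?thesis by simp
  qed
  moreover have "X / 2 \<le> Y" if "X \<le> Y" "0 \<le> Y" for X Y :: real using that by simp
  ultimately have step: "\<bar>p - indicator {0<..} \<sigma>\<bar> \<le> (\<epsilon> / \<eta>)\<^sup>2"
    by (metis zero_le_power2)
  \<comment> \<open>The saturation error is at most both \<open>a\<close> and 1, hence at most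
    \<open>sqrt a\<close>. The square root matters: it grows linearly in the radius instead of
    quadratically, and times the linearly growing torque it is still controlled by the second
    moment.\<close>
  have "p - p / d \<le> sqrt (2 * \<epsilon> * (max 0 \<sigma> + \<epsilon>))"
  proof -
    define a where "a = 2 * \<epsilon> * (max 0 \<sigma> + \<epsilon>)"
    have a: "0 \<le> a" using eps by (simp add: a_def)
    have "1 - 1 / d \<le> 2 * (\<epsilon> * soft_plus \<epsilon> \<sigma>)"
    proof -
      define x where "x = \<epsilon> * soft_plus \<epsilon> \<sigma>"
      have x: "0 < x" using eps soft_plus_pos[of \<sigma>] by (simp add: x_def)
      have "(1 + x)\<^sup>2 - 1 \<le> 2 * x * (1 + x)\<^sup>2"
        using x by (simp add: power2_eq_square algebra_simps)
      then show ?thesis using x d unfolding d_def x_def[symmetric] by (simp add: field_simps)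
    qed
    also have "\<dots> \<le> a"
      using soft_plus_le[of \<sigma>] eps by (simp add: a_def)
    finally have "1 - 1 / d \<le> a" .
    moreover have "1 - 1 / d \<le> 1" using d by simp
    moreover have "a \<le> sqrt a" if "a \<le> 1"
      using a that by (intro real_le_rsqrt) (simp add: power2_eq_square mult_left_le)
    moreover have "1 \<le> sqrt a" if "\<not> a \<le> 1" using that by simp
    ultimately have "1 - 1 / d \<le> sqrt a" by (cases "a \<le> 1") linarith+
    moreover have "p - p / d \<le> 1 - 1 / d"
      using p d mult_right_mono[of p 1 "1 - 1 / d"] by (simp add: algebra_simps)
    ultimately show ?thesis by (simp add: a_def)
  qed
  moreover have "0 \<le> p - p / d" using p d mult_right_mono[of 1 d p] by (simp add: field_simps)
  moreover have "soft_cap' \<epsilon> \<sigma> = p / d" by (simp add: soft_cap'_def p_def d_def r_def)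
  ultimately show ?thesis using step by (auto simp: indicator_def)
qed

end

section \<open>The charge distribution of a solution\<close>

lemma has_derivative_soft_cap_radial:
  fixes x c :: "real^2"
  assumes "0 < \<epsilon>"
  shows "((\<lambda>y. soft_cap \<epsilon> ((norm (y - c))\<^sup>2 - s)) has_derivative
    (\<lambda>h. soft_cap' \<epsilon> ((norm (x - c))\<^sup>2 - s) * (2 * ((x - c) \<bullet> h)))) (at x)"
proof -
  have "((\<lambda>y. (y - c) \<bullet> (y - c) - s) has_derivative (\<lambda>h. 2 * ((x - c) \<bullet> h))) (at x)"
    by (auto intro!: derivative_eq_intros simp: inner_commute)
  from has_derivative_compose[OF this
      has_field_derivative_imp_has_derivative[OF has_real_derivative_soft_cap[OF assms]]]
  show ?thesis by (simp add: power2_norm_eq_inner)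
qed

lemma grad_soft_cap_radial:
  assumes "0 < \<epsilon>"
  shows "grad (\<lambda>y. soft_cap \<epsilon> ((norm (y - c))\<^sup>2 - s)) x
    = (2 * soft_cap' \<epsilon> ((norm (x - c))\<^sup>2 - s)) *\<^sub>R (x - c)"
  using frechet_derivative_at[OF has_derivative_soft_cap_radial[OF assms, of c s x], symmetric]
  by (simp add: grad_def vec_eq_iff inner_axis)

text \<open>The gradient is the slope times \<open>2 (x - c)\<close>. The slope decays at least like
  \<open>1 / (1 + \<epsilon> v)\<close>, and the radius is at most
  \<open>1 + \<bar>s\<bar> + v\<close> with the same \<open>v\<close>, so their product stays
  bounded.\<close>

lemma norm_grad_soft_cap_radial_le:
  assumes "0 < \<epsilon>"
  shows "norm (grad (\<lambda>y. soft_cap \<epsilon> ((norm (y - c))\<^sup>2 - s)) x) \<le> 2 * (1 + \<bar>s\<bar>) + 2 / \<epsilon>"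
proof -
  define \<sigma> where "\<sigma> = (norm (x - c))\<^sup>2 - s"
  define v where "v = soft_plus \<epsilon> \<sigma>"
  have v: "0 < v" "max 0 \<sigma> \<le> v" using soft_plus_pos[OF assms] soft_plus_ge[OF assms] by (auto simp: v_def)
  have d: "0 < 1 + \<epsilon> * v" using v assms by (simp add: add_pos_pos)
  have "norm (x - c) \<le> 1 + (norm (x - c))\<^sup>2" by (rule norm_le_one_plus_sq)
  also have "\<dots> \<le> (1 + \<bar>s\<bar>) + v" using v by (simp add: \<sigma>_def)
  finally have x: "norm (x - c) \<le> (1 + \<bar>s\<bar>) + v" .
  have "soft_cap' \<epsilon> \<sigma> \<le> 1 / (1 + \<epsilon> * v)\<^sup>2"
    using soft_cap'_le[OF assms] by (simp add: v_def)
  also have "\<dots> \<le> 1 / (1 + \<epsilon> * v)"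
    using soft_denominator_sq_ge[OF assms, of \<sigma>] d by (intro divide_left_mono) (auto simp: v_def)
  finally have s': "soft_cap' \<epsilon> \<sigma> \<le> 1 / (1 + \<epsilon> * v)" .
  have "soft_cap' \<epsilon> \<sigma> * norm (x - c) \<le> 1 / (1 + \<epsilon> * v) * ((1 + \<bar>s\<bar>) + v)"
    using s' x d soft_cap'_nonneg[OF assms] by (intro mult_mono) auto
  also have "\<dots> = (1 + \<bar>s\<bar>) / (1 + \<epsilon> * v) + v / (1 + \<epsilon> * v)"
    by (simp add: add_divide_distrib)
  also have "\<dots> \<le> (1 + \<bar>s\<bar>) / 1 + 1 / \<epsilon>"
    using v assms d by (intro add_mono divide_left_mono) (auto simp: field_simps)
  finally show ?thesis
    using soft_cap'_nonneg[OF assms, of \<sigma>]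
    by (simp add: grad_soft_cap_radial[OF assms] \<sigma>_def abs_mult)
qed

lemma test_function_soft_cap:
  assumes eps: "0 < \<epsilon>"
  shows "test_function (\<lambda>x t. soft_cap \<epsilon> ((norm (x - c))\<^sup>2 - s))"
  unfolding test_function_def
proof (intro conjI)
  define b1 :: "(real^2) \<times> real" where "b1 = (axis 1 1, 0)"
  define b2 :: "(real^2) \<times> real" where "b2 = (axis 2 1, 0)"
  \<comment> \<open>The squared distance is spelled out with sums and products of inner products on
    space-time, the form that the rules for \<open>elementary\<close> recognize.\<close>
  define \<sigma> where "\<sigma> p = (p \<bullet> b1 + - c $ 1) * (p \<bullet> b1 + - c $ 1)
      + (p \<bullet> b2 + - c $ 2) * (p \<bullet> b2 + - c $ 2) + - s" for p
  have \<sigma>_eq: "\<sigma> (x, t) = (norm (x - c))\<^sup>2 - s" for x t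
  proof -
    have "(x, t) \<bullet> b1 = x $ 1" "(x, t) \<bullet> b2 = x $ 2" by (simp_all add: b1_def b2_def inner_axis)
    then show ?thesis
      by (simp add: \<sigma>_def power2_norm_eq_inner inner_vec_def UNIV_2)
  qed
  have \<sigma>: "elementary \<sigma>"
    unfolding \<sigma>_def by (intro elementary.intros)
  have v: "elementary (\<lambda>p. soft_plus \<epsilon> (\<sigma> p))"
  proof -
    have "elementary (\<lambda>p. (\<sigma> p + sqrt (\<sigma> p * \<sigma> p + \<epsilon> * \<epsilon>)) * (1 / 2))"
      using eps by (intro elementary.intros \<sigma>) (simp add: add_nonneg_pos)
    then show ?thesis by (simp add: soft_plus_def)
  qed
  have "elementary (\<lambda>p. soft_plus \<epsilon> (\<sigma> p) * inverse (1 + \<epsilon> * soft_plus \<epsilon> (\<sigma> p)))"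
    using soft_denominator_pos[OF eps] by (intro elementary.intros v) (simp add: less_imp_neq[symmetric])
  moreover have "(\<lambda>(x, t::real). soft_cap \<epsilon> ((norm (x - c))\<^sup>2 - s))
      = (\<lambda>p. soft_plus \<epsilon> (\<sigma> p) * inverse (1 + \<epsilon> * soft_plus \<epsilon> (\<sigma> p)))"
    by (auto simp: fun_eq_iff soft_cap_def divide_inverse \<sigma>_eq)
  ultimately have "elementary (\<lambda>(x, t::real). soft_cap \<epsilon> ((norm (x - c))\<^sup>2 - s))"
    by simp
  then show "smooth (\<lambda>(x, t::real). soft_cap \<epsilon> ((norm (x - c))\<^sup>2 - s))"
    by (rule elementary_smooth)
  show "bounded (range (\<lambda>(x, t::real). soft_cap \<epsilon> ((norm (x - c))\<^sup>2 - s)))"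
    unfolding bounded_iff using soft_cap_bounds(1,2)[OF eps]
    by (intro exI[of _ "1 / \<epsilon>"]) auto
  show "bounded (range (\<lambda>(x, t::real). grad (\<lambda>y. soft_cap \<epsilon> ((norm (y - c))\<^sup>2 - s)) x))"
    unfolding bounded_iff using norm_grad_soft_cap_radial_le[OF eps, of c s]
    by (intro exI[of _ "2 * (1 + \<bar>s\<bar>) + 2 / \<epsilon>"]) auto
  show "bounded (range (\<lambda>(x, t). dt (\<lambda>x t. soft_cap \<epsilon> ((norm (x - c))\<^sup>2 - s)) x t))"
    by (simp add: dt_def)
qed

text \<open>The unit disc is covered by dyadic shells: on the shell of index \<open>j\<close> the
  integrand is at most \<open>2 powr (p * (j + 1))\<close>, and the shell lies in a disc of area
  \<open>pi / 4^j\<close>. The series has ratio \<open>2 powr p / 4 < 1\<close> because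
  \<open>p < 2\<close>.\<close>

lemma local_riesz_potential_finite:
  fixes p :: real
  assumes p: "0 < p" "p < 2"
  shows "(\<integral>\<^sup>+w. indicator (cball 0 1) w * ennreal (norm w powr (- p)) \<partial>(lborel :: (real^2) measure)) < \<infinity>"
proof -
  define a :: "nat \<Rightarrow> ennreal" where "a j = ennreal (((1 / 2) ^ Suc j) powr (- p))" for j
  define B :: "nat \<Rightarrow> (real^2) set" where "B j = cball 0 ((1 / 2) ^ j)" for j
  have [measurable]: "B j \<in> sets borel" for j by (simp add: B_def)
  have ptw: "indicator (cball 0 1) w * ennreal (norm w powr (- p)) \<le> (\<Sum>j. a j * indicator (B j) w)"
    for w :: "real^2"
  proof (cases "w \<in> cball 0 1 \<and> w \<noteq> 0")
    case True
    then have "0 < norm w" "norm w \<le> 1" by auto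
    then obtain j where j: "norm w \<le> 1 * (1 / 2) ^ j" "1 * (1 / 2) ^ Suc j < norm w"
      by (rule dyadic_scale)
    have "norm w powr (- p) \<le> ((1 / 2) ^ Suc j) powr (- p)"
      using j p by (intro powr_mono2') auto
    then have "ennreal (norm w powr (- p)) \<le> a j" unfolding a_def by (rule ennreal_leI)
    moreover have "w \<in> B j" using j by (simp add: B_def)
    ultimately have "indicator (cball 0 1) w * ennreal (norm w powr (- p)) \<le> a j * indicator (B j) w"
      using True by (simp add: indicator_def)
    also have "\<dots> \<le> (\<Sum>j. a j * indicator (B j) w)"
      by (rule suminf_term_le)
    finally show ?thesis .
  next
    case False
    then have "indicator (cball 0 1) w * ennreal (norm w powr (- p)) = 0"
      by (auto simp: indicator_def)
    then show ?thesis by (simp only: zero_le)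
  qed
  define r where "r = (2::real) powr p * (1 / 4)"
  have "(2::real) powr p < 2 powr 2" using p by (intro powr_less_mono) auto
  then have r: "0 < r" "r < 1" by (auto simp: r_def)
  have term_eq: "a j * emeasure lborel (B j) = ennreal (2 powr p * pi * r ^ j)" for j
  proof -
    have half: "((1 / 2 :: real) ^ n) powr (- p) = (2 powr p) ^ n" for n
    proof -
      have "((1 / 2 :: real) ^ n) powr (- p) = ((1 / 2) powr (- p)) ^ n"
        by (simp add: powr_realpow[symmetric] powr_powr mult.commute)
      also have "(1 / 2 :: real) powr (- p) = 2 powr p" by (simp add: powr_minus powr_divide)
      finally show ?thesis .
    qed
    have 1: "a j = ennreal (2 powr p * (2 powr p) ^ j)" unfolding a_def half by simp
    have "((1 / 2 :: real) ^ j)\<^sup>2 = (1 / 4) ^ j"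
      by (simp add: power2_eq_square power_mult_distrib[symmetric])
    then have 2: "emeasure lborel (B j) = ennreal (pi * (1 / 4) ^ j)"
      unfolding B_def by (subst emeasure_cball) (simp_all add: unit_ball_vol_2)
    have 3: "(2 powr p) ^ j * (1 / 4 :: real) ^ j = r ^ j"
      by (simp only: r_def power_mult_distrib)
    have "a j * emeasure lborel (B j) = ennreal ((2 powr p * (2 powr p) ^ j) * (pi * (1 / 4) ^ j))"
      unfolding 1 2 by (rule ennreal_mult[symmetric]) auto
    also have "(2 powr p * (2 powr p) ^ j) * (pi * (1 / 4) ^ j) = 2 powr p * pi * ((2 powr p) ^ j * (1 / 4 :: real) ^ j)"
      by (simp only: mult_ac)
    finally show ?thesis unfolding 3 .
  qed
  have "(\<integral>\<^sup>+w. indicator (cball 0 1) w * ennreal (norm w powr (- p)) \<partial>(lborel :: (real^2) measure))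
      \<le> (\<integral>\<^sup>+w. (\<Sum>j. a j * indicator (B j) w) \<partial>lborel)"
    by (intro nn_integral_mono ptw)
  also have "\<dots> = (\<Sum>j. \<integral>\<^sup>+w. a j * indicator (B j) w \<partial>lborel)"
    by (rule nn_integral_suminf) measurable
  also have "\<dots> = (\<Sum>j. ennreal (2 powr p * pi * r ^ j))"
    by (simp add: nn_integral_cmult_indicator term_eq)
  also have "\<dots> = ennreal (2 powr p * pi * (1 / (1 - r)))"
    using r by (intro suminf_ennreal_eq sums_mult geometric_sums) auto
  finally show ?thesis by (rule le_less_trans) simp
qed

lemma shift_measurable_lebesgue [measurable]:
  "(\<lambda>x. x - c) \<in> lebesgue \<rightarrow>\<^sub>M borel" for c :: "real^2"
  by (intro measurable_completion) simp

text \<open>The shift by \<open>c\<close> will place the center of mass at the origin.\<close>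

definition charge :: "(real^2 \<Rightarrow> real) \<Rightarrow> real^2 \<Rightarrow> (real^2) measure" where
  "charge g c = distr (density lebesgue (\<lambda>x. ennreal (g x))) borel (\<lambda>x. x - c)"

context
  fixes g :: "real^2 \<Rightarrow> real" and c :: "real^2"
  assumes g: "integrable lebesgue g" "AE x in lebesgue. 0 \<le> g x"
begin

lemma g_measurable: "g \<in> borel_measurable lebesgue"
  using g by simp

lemma sets_charge: "sets (charge g c) = sets borel"
  by (simp add: charge_def)

lemma nn_integral_charge:
  assumes [measurable]: "h \<in> borel_measurable borel"
  shows "(\<integral>\<^sup>+x. h x \<partial>charge g c) = (\<integral>\<^sup>+x. ennreal (g x) * h (x - c) \<partial>lebesgue)"
proof -
  note [measurable] = g_measurable
  show ?thesis
    unfolding charge_def by (subst nn_integral_distr) (auto simp: nn_integral_density)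
qed

lemma integrable_charge:
  fixes h :: "real^2 \<Rightarrow> 'b::{banach, second_countable_topology}"
  assumes [measurable]: "h \<in> borel_measurable borel"
  shows "integrable (charge g c) h \<longleftrightarrow> integrable lebesgue (\<lambda>x. g x *\<^sub>R h (x - c))"
proof -
  note [measurable] = g_measurable
  show ?thesis
    unfolding charge_def using g by (simp add: integrable_distr_eq integrable_density)
qed

lemma integral_charge:
  fixes h :: "real^2 \<Rightarrow> 'b::{banach, second_countable_topology}"
  assumes [measurable]: "h \<in> borel_measurable borel"
  shows "(\<integral>x. h x \<partial>charge g c) = (\<integral>x. g x *\<^sub>R h (x - c) \<partial>lebesgue)"
proof -
  note [measurable] = g_measurable
  show ?thesis
    unfolding charge_def using g by (subst integral_distr) (auto intro!: integral_density)
qed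

lemma finite_measure_charge: "finite_measure (charge g c)"
proof (rule finite_measureI)
  have "emeasure (charge g c) (space (charge g c)) = (\<integral>\<^sup>+x. 1 \<partial>charge g c)" by simp
  also have "\<dots> = (\<integral>\<^sup>+x. ennreal (g x) \<partial>lebesgue)" by (subst nn_integral_charge) auto
  also have "\<dots> \<le> (\<integral>\<^sup>+x. ennreal (norm (g x)) \<partial>lebesgue)"
    by (intro nn_integral_mono ennreal_leI) auto
  also have "\<dots> < \<infinity>" using g(1) by (simp add: integrable_iff_bounded)
  finally show "emeasure (charge g c) (space (charge g c)) \<noteq> \<infinity>" by simp
qed

lemma measure_charge_UNIV: "measure (charge g c) UNIV = (\<integral>x. g x \<partial>lebesgue)"
proof -
  interpret finite_measure "charge g c" by (rule finite_measure_charge)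
  have "(\<integral>x. (1 :: real) \<partial>charge g c) = (\<integral>x. g x *\<^sub>R (1 :: real) \<partial>lebesgue)"
    using integral_charge[of "\<lambda>x. 1 :: real"] by simp
  then show ?thesis using sets_eq_imp_space_eq[OF sets_charge] by simp
qed

lemma charge_le_lebesgue:
  assumes M: "AE x in lebesgue. g x \<le> M" and [measurable]: "A \<in> sets borel"
  shows "emeasure (charge g c) A \<le> ennreal M * emeasure lborel A"
proof -
  have "emeasure (charge g c) A = (\<integral>\<^sup>+x. indicator A x \<partial>charge g c)"
    by (simp add: sets_charge)
  also have "\<dots> = (\<integral>\<^sup>+x. ennreal (g x) * indicator A (x - c) \<partial>lebesgue)"
    by (rule nn_integral_charge) simp
  also have "\<dots> \<le> (\<integral>\<^sup>+x. ennreal M * indicator A (x - c) \<partial>lebesgue)"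
    using M by (intro nn_integral_mono_AE) (auto intro!: mult_right_mono ennreal_leI elim!: eventually_mono)
  also have "\<dots> = (\<integral>\<^sup>+x. ennreal M * indicator A (x - c) \<partial>lborel)"
    by (rule nn_integral_completion)
  also have "\<dots> = (\<integral>\<^sup>+x. ennreal M * indicator A (x - c) \<partial>(distr lborel borel ((+) c)))"
    by (simp add: lborel_distr_plus)
  also have "\<dots> = (\<integral>\<^sup>+x. ennreal M * indicator A x \<partial>lborel)"
    by (subst nn_integral_distr) auto
  finally show ?thesis by (simp add: nn_integral_cmult)
qed

text \<open>The kernel is split at distance one: nearby the density is at most \<open>M\<close>, and
  farther away the kernel is at most 1 and contributes at most the total mass.\<close>

lemma nn_integral_charge_potential:
  assumes M: "AE x in lebesgue. g x \<le> M" and "0 \<le> p"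
  shows "(\<integral>\<^sup>+z. ennreal (norm (y - z) powr (- p)) \<partial>charge g c)
    \<le> ennreal M * (\<integral>\<^sup>+w. indicator (cball 0 1) w * ennreal (norm w powr (- p)) \<partial>(lborel :: (real^2) measure))
      + ennreal (\<integral>x. g x \<partial>lebesgue)"
proof -
  interpret finite_measure "charge g c" by (rule finite_measure_charge)
  define k :: "real^2 \<Rightarrow> ennreal" where "k w = indicator (cball 0 1) w * ennreal (norm w powr (- p))" for w
  have [measurable]: "cball (0::real^2) 1 \<in> sets borel" by simp
  have [measurable]: "k \<in> borel_measurable borel" unfolding k_def by measurable
  have [measurable_cong]: "sets (charge g c) = sets borel" by (rule sets_charge)
  have "ennreal (norm (y - z) powr (- p)) \<le> k (y - z) + 1" for z
  proof (cases "norm (y - z) \<le> 1")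
    case True
    then have "ennreal (norm (y - z) powr (- p)) = k (y - z)" by (simp add: k_def indicator_def)
    then show ?thesis by (simp add: add_increasing2)
  next
    case False
    then have "norm (y - z) powr (- p) \<le> 1 powr (- p)" using assms(2) by (intro powr_mono2') auto
    then have "ennreal (norm (y - z) powr (- p)) \<le> 1" by simp
    then show ?thesis by (rule add_increasing[OF zero_le])
  qed
  then have "(\<integral>\<^sup>+z. ennreal (norm (y - z) powr (- p)) \<partial>charge g c) \<le> (\<integral>\<^sup>+z. k (y - z) + 1 \<partial>charge g c)"
    by (intro nn_integral_mono) auto
  also have "\<dots> = (\<integral>\<^sup>+z. k (y - z) \<partial>charge g c) + (\<integral>\<^sup>+z. 1 \<partial>charge g c)"
    by (rule nn_integral_add) measurable
  also have "(\<integral>\<^sup>+z. 1 \<partial>charge g c) = ennreal (\<integral>x. g x \<partial>lebesgue)"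
    using measure_charge_UNIV sets_eq_imp_space_eq[OF sets_charge] by (simp add: emeasure_eq_measure)
  also have "(\<integral>\<^sup>+z. k (y - z) \<partial>charge g c) = (\<integral>\<^sup>+x. ennreal (g x) * k (y - (x - c)) \<partial>lebesgue)"
    by (rule nn_integral_charge) measurable
  also have "\<dots> \<le> (\<integral>\<^sup>+x. ennreal M * k (y - (x - c)) \<partial>lebesgue)"
    using M by (intro nn_integral_mono_AE) (auto intro!: mult_right_mono ennreal_leI elim!: eventually_mono)
  also have "\<dots> = (\<integral>\<^sup>+x. ennreal M * k (y - (x - c)) \<partial>lborel)"
    by (rule nn_integral_completion)
  also have "\<dots> = (\<integral>\<^sup>+x. ennreal M * k (y - (x - c)) \<partial>(distr lborel borel ((+) (y + c))))"
    by (simp add: lborel_distr_plus)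
  also have "\<dots> = (\<integral>\<^sup>+x. ennreal M * k (y - (y + c + x - c)) \<partial>lborel)"
    by (rule nn_integral_distr) measurable
  also have "\<dots> = (\<integral>\<^sup>+x. ennreal M * k x \<partial>lborel)"
    by (simp add: k_def indicator_def)
  also have "\<dots> = ennreal M * (\<integral>\<^sup>+x. k x \<partial>lborel)" by (rule nn_integral_cmult) measurable
  finally show ?thesis by (simp add: k_def)
qed

end

text \<open>After normalizing the sum to 1, the claim is \<open>x \<le> x powr p\<close> on the unit
  interval. It serves to separate the initial radius from the growth in time.\<close>

lemma powr_add_subadditive:
  fixes a b p :: real
  assumes "0 \<le> a" "0 \<le> b" "0 < p" "p \<le> 1"
  shows "(a + b) powr p \<le> a powr p + b powr p"
proof (cases "a + b = 0")
  case False
  then have ab: "0 < a + b" using assms by simp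
  have ge: "x \<le> x powr p" if "0 \<le> x" "x \<le> 1" for x :: real
    using powr_mono'[of p 1 x] that assms by simp
  have "1 = a / (a + b) + b / (a + b)" using ab by (simp add: add_divide_distrib[symmetric])
  also have "\<dots> \<le> (a / (a + b)) powr p + (b / (a + b)) powr p"
    using ab assms by (intro add_mono ge) auto
  also have "\<dots> = (a powr p + b powr p) / (a + b) powr p"
    using ab assms by (simp add: powr_divide add_divide_distrib)
  finally show ?thesis using ab by (simp add: field_simps)
qed (use assms in simp)

text \<open>In the variable of the squared radius, area is linear:
  \<open>pi * (s + h) - pi * (s - h)\<close>, independent of \<open>s\<close>.\<close>

lemma emeasure_annulus_le:
  assumes "0 < h" "h \<le> s"
  shows "emeasure lborel {x :: real^2. \<bar>(norm x)\<^sup>2 - s\<bar> \<le> h} \<le> ennreal (2 * pi * h)"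
proof -
  define q where "q = sqrt (s + h)"
  define r where "r = sqrt (s - h)"
  have qr: "0 \<le> q" "q\<^sup>2 = s + h" "0 \<le> r" "r\<^sup>2 = s - h" using assms by (auto simp: q_def r_def)
  have "r \<le> q" using assms by (simp add: q_def r_def)
  have "{x :: real^2. \<bar>(norm x)\<^sup>2 - s\<bar> \<le> h} \<subseteq> cball 0 q - ball 0 r"
  proof
    fix x :: "real^2"
    assume "x \<in> {x. \<bar>(norm x)\<^sup>2 - s\<bar> \<le> h}"
    then have "(norm x)\<^sup>2 \<le> q\<^sup>2" "r\<^sup>2 \<le> (norm x)\<^sup>2" by (auto simp: qr abs_le_iff)
    then have "norm x \<le> q" "r \<le> norm x"
      using power2_le_imp_le[of "norm x" q] power2_le_imp_le[of r "norm x"] qr by auto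
    then show "x \<in> cball 0 q - ball 0 r" by simp
  qed
  then have "emeasure lborel {x :: real^2. \<bar>(norm x)\<^sup>2 - s\<bar> \<le> h} \<le> emeasure lborel (cball (0 :: real^2) q - ball 0 r)"
    by (rule emeasure_mono) simp
  also have "\<dots> = emeasure lborel (cball (0 :: real^2) q) - emeasure lborel (ball (0 :: real^2) r)"
    using \<open>r \<le> q\<close> qr by (intro emeasure_Diff) (auto simp: emeasure_ball)
  also have "\<dots> = ennreal (pi * (s + h)) - ennreal (pi * (s - h))"
    using qr by (simp add: emeasure_ball emeasure_cball unit_ball_vol_2)
  also have "\<dots> = ennreal (2 * pi * h)"
    using assms by (subst ennreal_minus) (auto simp: algebra_simps)
  finally show ?thesis .
qed

text \<open>The complement of the support is a possibly uncountable union of open sets on which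
  \<open>g\<close> vanishes almost everywhere. Lindelof reduces it to a countable union, for which
  the exceptional null sets can be collected.\<close>

lemma AE_outside_ess_support: "AE x in lebesgue. x \<notin> ess_support g \<longrightarrow> g x = 0"
proof -
  let ?F = "{U. open U \<and> (AE x in lebesgue. x \<in> U \<longrightarrow> g x = 0)}"
  obtain F' where F': "F' \<subseteq> ?F" "countable F'" "\<Union> F' = \<Union> ?F"
    using Lindelof[of ?F] by auto
  have "AE x in lebesgue. \<forall>U\<in>F'. x \<in> U \<longrightarrow> g x = 0"
    using F' by (subst AE_ball_countable) auto
  then show ?thesis
    by eventually_elim (use F'(3) in \<open>auto simp: ess_support_def\<close>)
qed

lemma ess_support_subset_cball:
  assumes "AE x in lebesgue. g x \<noteq> 0 \<longrightarrow> dist c x \<le> r"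
  shows "ess_support g \<subseteq> cball c r"
proof -
  have "AE x in lebesgue. x \<in> - cball c r \<longrightarrow> g x = 0"
    using assms by eventually_elim auto
  then have "- cball c r \<in> {U. open U \<and> (AE x in lebesgue. x \<in> U \<longrightarrow> g x = 0)}"
    by (simp add: open_Compl)
  then show ?thesis unfolding ess_support_def by blast
qed

lemma AE_le_Linfty_norm:
  assumes "in_Linfty g"
  shows "AE x in lebesgue. g x \<le> Linfty_norm g"
proof -
  let ?e = "esssup lebesgue (\<lambda>x. ereal \<bar>g x\<bar>)"
  have AE: "AE x in lebesgue. ereal \<bar>g x\<bar> \<le> ?e" by (rule esssup_AE)
  have "?e \<noteq> \<infinity>" using assms by (simp add: in_Linfty_def)
  then show ?thesis
    using AE by (cases ?e) (auto simp: Linfty_norm_def elim!: eventually_mono)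
qed

lemma borel_measurable_kernel [measurable]: "kernel \<alpha> \<in> borel_measurable borel"
proof -
  have "vector [- (z $ 2), z $ 1] = (- (z $ 2)) *\<^sub>R axis 1 1 + (z $ 1) *\<^sub>R (axis 2 1 :: real^2)" for z :: "real^2"
    by (simp add: vec_eq_iff forall_2 axis_def)
  \<comment> \<open>The explicit formula holds off the origin, so the unspecified value there is
    split off as a single point.\<close>
  then have "kernel \<alpha> = (\<lambda>z. if z = 0 then kernel \<alpha> 0 else
      (\<alpha> * green_const \<alpha> * norm z powr (- (2 + \<alpha>))) *\<^sub>R ((- (z $ 2)) *\<^sub>R axis 1 1 + (z $ 1) *\<^sub>R axis 2 1))"
    by (auto simp: kernel_eq)
  also have "\<dots> \<in> borel_measurable borel"
  proof (rule measurable_If)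
    show "{z \<in> space borel. z = (0 :: real^2)} \<in> sets borel" by simp
  qed measurable
  finally show ?thesis .
qed

section \<open>Convergence of the smoothed flux\<close>

context centered_measure
begin

lemma abs_torque_le:
  assumes "0 \<le> U"
  shows "\<bar>torque \<alpha> \<nu> y\<bar> \<le> norm y * U"
proof -
  have "ennreal \<bar>torque \<alpha> \<nu> y\<bar> \<le> (\<integral>\<^sup>+z. ennreal (norm (angular_kernel \<alpha> y z)) \<partial>\<nu>)"
    unfolding torque_def using integral_norm_bound_ennreal[OF integrable_angular_kernel, of y] by simp
  also have "\<dots> \<le> (\<integral>\<^sup>+z. ennreal (norm y) * ennreal (norm (y - z) powr (- (1 + \<alpha>))) \<partial>\<nu>)"
    using abs_angular_kernel_le'[of \<alpha>]
    by (intro nn_integral_mono) (simp add: ennreal_mult[symmetric] ennreal_leI)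
  also have "\<dots> \<le> ennreal (norm y) * ennreal U"
    using potential_le[of y] by (simp add: nn_integral_cmult mult_left_mono)
  also have "\<dots> = ennreal (norm y * U)" using assms by (simp add: ennreal_mult)
  finally show ?thesis using assms by (subst (asm) ennreal_le_iff) auto
qed

lemma integral_norm_le: "(\<integral>x. norm x \<partial>\<nu>) \<le> measure \<nu> UNIV + I"
proof -
  have "(\<integral>x. norm x \<partial>\<nu>) \<le> (\<integral>x. 1 + (norm x)\<^sup>2 \<partial>\<nu>)"
    by (intro norm_le_one_plus_sq integral_mono integrable_norm') (use integrable_sq in auto)
  also have "\<dots> = measure \<nu> UNIV + (\<integral>x. (norm x)\<^sup>2 \<partial>\<nu>)" using integrable_sq by simp
  finally show ?thesis using inertia_le by simp
qed

lemma borel_measurable_soft_cap' [measurable]: "(\<lambda>x::real^2. soft_cap' \<epsilon> ((norm x)\<^sup>2 - s)) \<in> borel_measurable borel"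
  unfolding soft_cap'_def soft_plus_def by measurable

lemma integrable_mult_torque:
  fixes w :: "real^2 \<Rightarrow> real"
  assumes "0 \<le> U" and [measurable]: "w \<in> borel_measurable borel" and w: "\<And>x. \<bar>w x\<bar> \<le> 1"
  shows "integrable \<nu> (\<lambda>x. w x * torque \<alpha> \<nu> x)"
proof (rule Bochner_Integration.integrable_bound)
  show "integrable \<nu> (\<lambda>x. norm x * U)" using integrable_norm' by simp
  have "\<bar>w x\<bar> * \<bar>torque \<alpha> \<nu> x\<bar> \<le> 1 * (norm x * U)" for x
    using w abs_torque_le[OF assms(1)] by (intro mult_mono) auto
  then show "AE x in \<nu>. norm (w x * torque \<alpha> \<nu> x) \<le> norm (norm x * U)"
    using assms(1) by (intro AE_I2) (simp add: abs_mult)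
qed measurable

text \<open>With smoothing parameter \<open>h^2\<close> and a layer of width \<open>h\<close>, all
  three errors are of order \<open>h\<close>: the layer has mass at most \<open>L * h\<close>, the
  tail of the step is \<open>(h^2 / h)^2 \<le> h\<close>, and the saturation is at most
  \<open>2 h (norm x + 1)\<close>. The bound is uniform in time if \<open>L\<close>, the mass and
  \<open>I\<close> are.\<close>

lemma soft_flux_error:
  assumes U: "0 \<le> U" and s: "0 < s" and h: "0 < h" "h \<le> 1"
    and annulus: "measure \<nu> {x. \<bar>(norm x)\<^sup>2 - s\<bar> \<le> h} \<le> L * h"
  shows "\<bar>(\<integral>x. soft_cap' (h\<^sup>2) ((norm x)\<^sup>2 - s) * torque \<alpha> \<nu> x \<partial>\<nu>) - flux \<alpha> \<nu> s\<bar>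
    \<le> U * (sqrt (s + 1) * L + 3 * (measure \<nu> UNIV + I) + 2 * I) * h"
proof -
  let ?w = "\<lambda>x::real^2. soft_cap' (h\<^sup>2) ((norm x)\<^sup>2 - s)"
  let ?A = "{y::real^2. s < (norm y)\<^sup>2}" and ?R = "{x::real^2. \<bar>(norm x)\<^sup>2 - s\<bar> \<le> h}"
  have h2: "0 < h\<^sup>2" using h by simp
  have [measurable]: "?A \<in> sets borel" "?R \<in> sets borel" by measurable
  have int1: "integrable \<nu> (\<lambda>x. ?w x * torque \<alpha> \<nu> x)"
    using soft_cap'_nonneg[OF h2] soft_cap'_le_1[OF h2] U by (intro integrable_mult_torque) auto
  have int2: "integrable \<nu> (\<lambda>x. indicator ?A x * torque \<alpha> \<nu> x)"
    using U by (intro integrable_mult_torque) (auto simp: indicator_def)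
  have int3: "integrable \<nu> (\<lambda>x. indicator ?R x :: real)"
    by (rule integrable_real_indicator) (auto simp: emeasure_eq_measure)
  have ptw: "\<bar>?w x * torque \<alpha> \<nu> x - indicator ?A x * torque \<alpha> \<nu> x\<bar>
      \<le> U * (sqrt (s + 1) * indicator ?R x + (3 * h) * norm x + (2 * h) * (norm x)\<^sup>2)" for x
  proof -
    define \<sigma> where "\<sigma> = (norm x)\<^sup>2 - s"
    have ind: "indicator ?A x = (indicator {0<..} \<sigma> :: real)" "indicator {-h..h} \<sigma> = (indicator ?R x :: real)"
      by (auto simp: \<sigma>_def indicator_def abs_le_iff)
    have sq: "sqrt (2 * h\<^sup>2 * (max 0 \<sigma> + h\<^sup>2)) \<le> 2 * h * (norm x + 1)"
    proof (rule real_le_lsqrt)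
      have "max 0 \<sigma> \<le> (norm x)\<^sup>2" using s by (simp add: \<sigma>_def)
      moreover have "h\<^sup>2 \<le> 1" using h by (intro power_le_one) auto
      ultimately have "max 0 \<sigma> + h\<^sup>2 \<le> (norm x)\<^sup>2 + 1" by linarith
      also have "\<dots> \<le> 2 * (norm x + 1)\<^sup>2" by (simp add: power2_sum)
      finally have "2 * h\<^sup>2 * (max 0 \<sigma> + h\<^sup>2) \<le> 2 * h\<^sup>2 * (2 * (norm x + 1)\<^sup>2)"
        by (intro mult_left_mono) auto
      then show "2 * h\<^sup>2 * (max 0 \<sigma> + h\<^sup>2) \<le> (2 * h * (norm x + 1))\<^sup>2"
        by (simp add: power_mult_distrib)
    qed (use h in auto)
    have "(h\<^sup>2 / h)\<^sup>2 \<le> h" using h by (simp add: power2_eq_square mult_left_le)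
    then have "\<bar>?w x - indicator ?A x\<bar> \<le> indicator ?R x + h + 2 * h * (norm x + 1)"
      using soft_cap'_approximates_step[OF h2 h(1), of \<sigma>] sq unfolding ind \<sigma>_def[symmetric] by linarith
    then have "\<bar>?w x - indicator ?A x\<bar> * \<bar>torque \<alpha> \<nu> x\<bar>
        \<le> (indicator ?R x + h + 2 * h * (norm x + 1)) * (norm x * U)"
      using abs_torque_le[OF U] h by (intro mult_mono) auto
    also have "\<dots> = U * (norm x * indicator ?R x + (3 * h) * norm x + (2 * h) * (norm x)\<^sup>2)"
      by (simp add: algebra_simps power2_eq_square)
    also have "\<dots> \<le> U * (sqrt (s + 1) * indicator ?R x + (3 * h) * norm x + (2 * h) * (norm x)\<^sup>2)"
    proof -
      have "norm x \<le> sqrt (s + 1)" if "x \<in> ?R"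
        using that h by (intro real_le_rsqrt) (auto simp: abs_le_iff)
      then show ?thesis using U h by (intro mult_left_mono add_mono) (auto simp: indicator_def)
    qed
    finally show ?thesis by (simp add: abs_mult left_diff_distrib[symmetric])
  qed
  have "\<bar>(\<integral>x. ?w x * torque \<alpha> \<nu> x \<partial>\<nu>) - flux \<alpha> \<nu> s\<bar>
      = \<bar>\<integral>x. ?w x * torque \<alpha> \<nu> x - indicator ?A x * torque \<alpha> \<nu> x \<partial>\<nu>\<bar>"
    unfolding flux_def by (simp only: Bochner_Integration.integral_diff[OF int1 int2])
  also have "\<dots> \<le> (\<integral>x. U * (sqrt (s + 1) * indicator ?R x + (3 * h) * norm x + (2 * h) * (norm x)\<^sup>2) \<partial>\<nu>)"
    by (intro integral_abs_bound_integral Bochner_Integration.integrable_diff int1 int2 ptw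
        integrable_mult_right Bochner_Integration.integrable_add int3 integrable_norm' integrable_sq)
  also have "\<dots> = U * (sqrt (s + 1) * measure \<nu> ?R + (3 * h) * (\<integral>x. norm x \<partial>\<nu>) + (2 * h) * (\<integral>x. (norm x)\<^sup>2 \<partial>\<nu>))"
    using int3 integrable_norm' integrable_sq by (simp del: indicator_simps)
  also have "\<dots> \<le> U * (sqrt (s + 1) * (L * h) + (3 * h) * (measure \<nu> UNIV + I) + (2 * h) * I)"
    using U s h annulus integral_norm_le inertia_le
    by (intro mult_left_mono add_mono) auto
  also have "\<dots> = U * (sqrt (s + 1) * L + 3 * (measure \<nu> UNIV + I) + 2 * I) * h"
    by (simp add: algebra_simps)
  finally show ?thesis .
qed

lemma tendsto_integral_soft_cap:
  assumes eps: "\<And>n. 0 < \<epsilon> n" "\<And>n. \<epsilon> n \<le> 1" "\<epsilon> \<longlonglongrightarrow> 0" and s: "0 < s"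
  shows "(\<lambda>n. \<integral>x. soft_cap (\<epsilon> n) ((norm x)\<^sup>2 - s) \<partial>\<nu>) \<longlonglongrightarrow> excess \<nu> s"
  unfolding excess_def
proof (rule integral_dominated_convergence)
  show "integrable \<nu> (\<lambda>x. (norm x)\<^sup>2 + 1)" using integrable_sq by simp
  show "(\<lambda>x. soft_cap (\<epsilon> n) ((norm x)\<^sup>2 - s)) \<in> borel_measurable \<nu>" for n
    unfolding soft_cap_def soft_plus_def by measurable
  have "\<bar>soft_cap (\<epsilon> n) ((norm x)\<^sup>2 - s)\<bar> \<le> (norm x)\<^sup>2 + 1" for n and x :: "real^2"
  proof -
    have "max 0 ((norm x)\<^sup>2 - s) \<le> (norm x)\<^sup>2" using s by simp
    then show ?thesis
      using soft_cap_bounds(1,3)[OF eps(1), of n "(norm x)\<^sup>2 - s"] eps(2)[of n] by linarith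
  qed
  then show "AE x in \<nu>. norm (soft_cap (\<epsilon> n) ((norm x)\<^sup>2 - s)) \<le> (norm x)\<^sup>2 + 1" for n
    by simp
  show "AE x in \<nu>. (\<lambda>n. soft_cap (\<epsilon> n) ((norm x)\<^sup>2 - s)) \<longlonglongrightarrow> max 0 ((norm x)\<^sup>2 - s)"
  proof (intro AE_I2)
    fix x :: "real^2"
    define \<sigma> where "\<sigma> = (norm x)\<^sup>2 - s"
    have v: "(\<lambda>n. soft_plus (\<epsilon> n) \<sigma>) \<longlonglongrightarrow> (\<sigma> + sqrt (\<sigma> * \<sigma> + 0 * 0)) / 2"
      unfolding soft_plus_def by (intro tendsto_intros eps) simp
    have "(\<lambda>n. soft_cap (\<epsilon> n) \<sigma>) \<longlonglongrightarrow> ((\<sigma> + sqrt (\<sigma> * \<sigma> + 0 * 0)) / 2) / (1 + 0 * ((\<sigma> + sqrt (\<sigma> * \<sigma> + 0 * 0)) / 2))"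
      unfolding soft_cap_def by (intro tendsto_intros eps v) simp
    moreover have "((\<sigma> + sqrt (\<sigma> * \<sigma> + 0 * 0)) / 2) / (1 + 0 * ((\<sigma> + sqrt (\<sigma> * \<sigma> + 0 * 0)) / 2)) = max 0 \<sigma>"
      by (simp add: max_def)
    ultimately show "(\<lambda>n. soft_cap (\<epsilon> n) ((norm x)\<^sup>2 - s)) \<longlonglongrightarrow> max 0 ((norm x)\<^sup>2 - s)"
      by (simp add: \<sigma>_def)
  qed
qed (use integrable_excess in simp)

end

section \<open>Solutions of the active scalar flow\<close>

locale scalar_flow =
  fixes \<alpha> R\<^sub>0 :: real and \<theta>\<^sub>0 :: "real^2 \<Rightarrow> real" and \<theta> :: "real \<Rightarrow> real^2 \<Rightarrow> real"
  assumes \<alpha>: "0 < \<alpha>" "\<alpha> < 1"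
    and nonneg\<^sub>0: "AE x in lebesgue. 0 \<le> \<theta>\<^sub>0 x"
    and nonzero\<^sub>0: "\<not> (AE x in lebesgue. \<theta>\<^sub>0 x = 0)"
    and support\<^sub>0: "ess_support \<theta>\<^sub>0 \<subseteq> cball 0 R\<^sub>0"
    and solution: "active_scalar_solution \<alpha> \<theta>\<^sub>0 \<theta>"
begin

definition "m = total_mass (\<theta> 0)"
definition "M = Linfty_norm (\<theta> 0)"
definition "c = mass_center (\<theta> 0)"
definition "I = inertia (\<theta> 0)"
text \<open>The conversion \<open>enn2real\<close> is faithful, because the local Riesz potential is
  finite for the exponent \<open>1 + \<alpha> < 2\<close>.\<close>

definition "U = enn2real (ennreal M * (\<integral>\<^sup>+w. indicator (cball 0 1) w * ennreal (norm w powr (- (1 + \<alpha>)))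
    \<partial>(lborel :: (real^2) measure)) + ennreal m)"
definition "\<nu> t = charge (\<theta> t) c"
definition "\<kappa> = \<alpha> * green_const \<alpha>"

lemma initial: "AE x in lebesgue. \<theta> 0 x = \<theta>\<^sub>0 x"
  using solution by (simp add: active_scalar_solution_def weak_solution_def)

lemma initial_nonneg: "AE x in lebesgue. 0 \<le> \<theta> 0 x"
  using initial nonneg\<^sub>0 by eventually_elim simp

lemma
  assumes "0 \<le> t"
  shows integrable_\<theta>: "integrable lebesgue (\<theta> t)"
    and nonneg_\<theta>: "AE x in lebesgue. 0 \<le> \<theta> t x"
    and le_M: "AE x in lebesgue. \<theta> t x \<le> M"
    and integrable_inertia: "integrable lebesgue (\<lambda>x. (norm x)\<^sup>2 * \<theta> t x)"
    and mass_eq: "(\<integral>x. \<theta> t x \<partial>lebesgue) = m"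
    and center_eq: "mass_center (\<theta> t) = c"
    and inertia_eq: "(\<integral>x. (norm x)\<^sup>2 * \<theta> t x \<partial>lebesgue) = I"
proof -
  show "integrable lebesgue (\<theta> t)"
    using solution assms by (simp add: active_scalar_solution_def weak_solution_def)
  have cons: "integrable lebesgue (\<lambda>x. (norm x)\<^sup>2 * \<theta> t x)"
    "total_mass (\<theta> t) = m" "Linfty_norm (\<theta> t) = M" "mass_center (\<theta> t) = c" "inertia (\<theta> t) = I"
    using solution assms
    unfolding active_scalar_solution_def conserves_invariants_def m_def M_def c_def I_def by blast+
  show "AE x in lebesgue. 0 \<le> \<theta> t x"
    using solution initial_nonneg assms
    unfolding active_scalar_solution_def preserves_nonneg_def by blast
  have "in_Linfty (\<theta> t)"
    using solution assms by (simp add: active_scalar_solution_def weak_solution_def)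
  from AE_le_Linfty_norm[OF this] show "AE x in lebesgue. \<theta> t x \<le> M"
    unfolding cons .
  show "integrable lebesgue (\<lambda>x. (norm x)\<^sup>2 * \<theta> t x)" "mass_center (\<theta> t) = c"
    by (rule cons)+
  show "(\<integral>x. \<theta> t x \<partial>lebesgue) = m" "(\<integral>x. (norm x)\<^sup>2 * \<theta> t x \<partial>lebesgue) = I"
    using cons(2,5) by (simp_all add: total_mass_def inertia_def)
qed

lemma measurable_\<theta>: "0 \<le> t \<Longrightarrow> \<theta> t \<in> borel_measurable lebesgue"
  using integrable_\<theta> by (rule borel_measurable_integrable)

lemma \<theta>_nonzero: "\<not> (AE x in lebesgue. \<theta> 0 x = 0)"
proof
  assume "AE x in lebesgue. \<theta> 0 x = 0"
  then have "AE x in lebesgue. \<theta>\<^sub>0 x = 0" using initial by eventually_elim simp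
  then show False using nonzero\<^sub>0 by simp
qed

lemma m_pos: "0 < m"
proof -
  have "0 \<le> m" using mass_eq[of 0] integral_nonneg_AE[OF initial_nonneg] by simp
  moreover have "m \<noteq> 0"
    using integral_nonneg_eq_0_iff_AE[OF integrable_\<theta>[of 0] initial_nonneg] mass_eq[of 0] \<theta>_nonzero by simp
  ultimately show ?thesis by simp
qed

lemma AE_lebesgue_neq: "AE x in lebesgue. x \<noteq> (a :: real^2)"
  by (rule AE_I'[of "{a}"]) auto

lemma I_pos: "0 < I"
proof -
  have nn: "AE x in lebesgue. 0 \<le> (norm x)\<^sup>2 * \<theta> 0 x"
    using initial_nonneg by eventually_elim simp
  have "0 \<le> I" using inertia_eq[of 0] integral_nonneg_AE[OF nn] by simp
  moreover have "I \<noteq> 0"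
  proof
    assume "I = 0"
    then have "AE x in lebesgue. (norm x)\<^sup>2 * \<theta> 0 x = 0"
      using integral_nonneg_eq_0_iff_AE[OF integrable_inertia[of 0] nn] inertia_eq[of 0] by simp
    then have "AE x in lebesgue. \<theta> 0 x = 0"
      using AE_lebesgue_neq[of 0] by eventually_elim simp
    then show False using \<theta>_nonzero by simp
  qed
  ultimately show ?thesis by simp
qed

lemma AE_initial_ball: "AE x in lebesgue. \<theta> 0 x \<noteq> 0 \<longrightarrow> norm x \<le> R\<^sub>0"
  using AE_outside_ess_support[of \<theta>\<^sub>0] initial
  by eventually_elim (use support\<^sub>0 in auto)

lemma R\<^sub>0_pos: "0 < R\<^sub>0"
proof (rule ccontr)
  assume R: "\<not> 0 < R\<^sub>0"
  have "AE x in lebesgue. \<theta> 0 x = 0"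
    using AE_initial_ball AE_lebesgue_neq[of 0]
  proof eventually_elim
    case (elim x)
    then have "R\<^sub>0 < norm x" using R by (simp add: not_less le_less_trans)
    then show ?case using elim by auto
  qed
  then show False using \<theta>_nonzero by simp
qed

lemma first_moment:
  assumes "0 \<le> t"
  shows "integrable lebesgue (\<lambda>x. \<theta> t x *\<^sub>R x)" "(\<integral>x. \<theta> t x *\<^sub>R x \<partial>lebesgue) = m *\<^sub>R c"
proof -
  have [measurable]: "\<theta> t \<in> borel_measurable lebesgue" using assms by (rule measurable_\<theta>)
  have [measurable]: "(\<lambda>x::real^2. x) \<in> lebesgue \<rightarrow>\<^sub>M borel" by (intro measurable_completion) simp
  show "integrable lebesgue (\<lambda>x. \<theta> t x *\<^sub>R x)"
  proof (rule Bochner_Integration.integrable_bound)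
    show "integrable lebesgue (\<lambda>x. \<theta> t x + (norm x)\<^sup>2 * \<theta> t x)"
      using integrable_\<theta>[OF assms] integrable_inertia[OF assms] by simp
    show "AE x in lebesgue. norm (\<theta> t x *\<^sub>R x) \<le> norm (\<theta> t x + (norm x)\<^sup>2 * \<theta> t x)"
      using nonneg_\<theta>[OF assms]
    proof eventually_elim
      case (elim x)
      have "\<theta> t x * norm x \<le> \<theta> t x * (1 + (norm x)\<^sup>2)"
        using norm_le_one_plus_sq elim by (rule mult_left_mono)
      then show ?case using elim by (simp add: algebra_simps)
    qed
  qed measurable
  show "(\<integral>x. \<theta> t x *\<^sub>R x \<partial>lebesgue) = m *\<^sub>R c"
    unfolding center_eq[OF assms, symmetric] mass_center_def total_mass_def mass_eq[OF assms]
    using m_pos by simp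
qed

text \<open>The center of mass is an average, with nonnegative weights, of points of the ball of
  radius \<open>R\<^sub>0\<close>.\<close>

lemma norm_c_le: "norm c \<le> R\<^sub>0"
proof -
  have "norm (m *\<^sub>R c) \<le> (\<integral>x. norm (\<theta> 0 x *\<^sub>R x) \<partial>lebesgue)"
    unfolding first_moment(2)[of 0, symmetric, simplified] by (rule integral_norm_bound)
  also have "\<dots> \<le> (\<integral>x. R\<^sub>0 * \<theta> 0 x \<partial>lebesgue)"
  proof (rule integral_mono_AE)
    show "integrable lebesgue (\<lambda>x. norm (\<theta> 0 x *\<^sub>R x))"
      using first_moment(1)[of 0] by (intro integrable_norm) simp
    show "integrable lebesgue (\<lambda>x. R\<^sub>0 * \<theta> 0 x)" using integrable_\<theta>[of 0] by simp
    show "AE x in lebesgue. norm (\<theta> 0 x *\<^sub>R x) \<le> R\<^sub>0 * \<theta> 0 x"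
      using initial_nonneg AE_initial_ball
    proof eventually_elim
      case (elim x)
      then show ?case
        by (cases "\<theta> 0 x = 0") (auto simp: mult.commute[of R\<^sub>0] intro!: mult_left_mono)
    qed
  qed
  also have "\<dots> = R\<^sub>0 * m" using mass_eq[of 0] by simp
  finally show ?thesis using m_pos by simp
qed

lemma U_nonneg: "0 \<le> U"
  unfolding U_def by (rule enn2real_nonneg)

lemma M_nonneg: "0 \<le> M"
proof (rule ccontr)
  assume M: "\<not> 0 \<le> M"
  have "AE x in lebesgue. \<theta> 0 x = 0"
    using le_M[OF order_refl] initial_nonneg by eventually_elim (use M in simp)
  then show False using \<theta>_nonzero by simp
qed

lemma potential_le_U:
  assumes "0 \<le> t"
  shows "(\<integral>\<^sup>+z. ennreal (norm (y - z) powr (- (1 + \<alpha>))) \<partial>\<nu> t) \<le> ennreal U"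
proof -
  have fin: "(\<integral>\<^sup>+w. indicator (cball 0 1) w * ennreal (norm w powr (- (1 + \<alpha>)))
      \<partial>(lborel :: (real^2) measure)) < \<infinity>"
    using \<alpha> by (intro local_riesz_potential_finite) auto
  have "(\<integral>\<^sup>+z. ennreal (norm (y - z) powr (- (1 + \<alpha>))) \<partial>\<nu> t)
      \<le> ennreal M * (\<integral>\<^sup>+w. indicator (cball 0 1) w * ennreal (norm w powr (- (1 + \<alpha>)))
        \<partial>(lborel :: (real^2) measure)) + ennreal m"
    using nn_integral_charge_potential[OF integrable_\<theta> nonneg_\<theta> le_M, OF assms assms assms, of "1 + \<alpha>" c y] \<alpha>
    unfolding \<nu>_def mass_eq[OF assms] by simp
  also have "\<dots> = ennreal U"
    unfolding U_def using fin by (intro ennreal_enn2real[symmetric]) (simp add: ennreal_mult_less_top)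
  finally show ?thesis .
qed

lemma centered_measure_\<nu>:
  assumes "0 \<le> t"
  shows "centered_measure (\<nu> t) \<alpha> I U"
proof -
  note g = integrable_\<theta>[OF assms] nonneg_\<theta>[OF assms]
  have [measurable]: "\<theta> t \<in> borel_measurable lebesgue" using assms by (rule measurable_\<theta>)
  interpret finite_measure "\<nu> t" unfolding \<nu>_def by (rule finite_measure_charge[OF g])
  have expand: "\<theta> t x *\<^sub>R (norm (x - c))\<^sup>2
      = (norm x)\<^sup>2 * \<theta> t x - 2 * (c \<bullet> (\<theta> t x *\<^sub>R x)) + (norm c)\<^sup>2 * \<theta> t x" for x
    by (simp add: power2_norm_eq_inner inner_diff_left inner_diff_right inner_commute algebra_simps)
  have int_inner: "integrable lebesgue (\<lambda>x. c \<bullet> (\<theta> t x *\<^sub>R x))"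
    using first_moment(1)[OF assms] by (rule integrable_inner_right)
  have int: "integrable lebesgue (\<lambda>x. \<theta> t x *\<^sub>R (norm (x - c))\<^sup>2)"
    unfolding expand using integrable_inertia[OF assms] int_inner g by simp
  have "(\<integral>x. c \<bullet> (\<theta> t x *\<^sub>R x) \<partial>lebesgue) = c \<bullet> (m *\<^sub>R c)"
    using first_moment[OF assms] by (subst integral_inner_right) auto
  then have "(\<integral>x. \<theta> t x *\<^sub>R (norm (x - c))\<^sup>2 \<partial>lebesgue) = I - 2 * (c \<bullet> (m *\<^sub>R c)) + (norm c)\<^sup>2 * m"
    using integrable_inertia[OF assms] int_inner g inertia_eq[OF assms] mass_eq[OF assms]
    unfolding expand by simp
  \<comment> \<open>The parallel axis theorem: moving the reference point to the center of mass
    lowers the inertia by the mass times the squared norm of \<open>c\<close>. The same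
    \<open>c\<close> serves at all times by conservation.\<close>
  also have "\<dots> \<le> I" using m_pos by (simp add: power2_norm_eq_inner)
  finally have le: "(\<integral>x. \<theta> t x *\<^sub>R (norm (x - c))\<^sup>2 \<partial>lebesgue) \<le> I" .
  show ?thesis
  proof
    show "sets (\<nu> t) = sets borel" by (simp add: \<nu>_def sets_charge[OF g])
    show "integrable (\<nu> t) (\<lambda>x. (norm x)\<^sup>2)"
      unfolding \<nu>_def using int by (subst integrable_charge[OF g]) auto
    show "(\<integral>x. (norm x)\<^sup>2 \<partial>\<nu> t) \<le> I"
      unfolding \<nu>_def using le by (subst integral_charge[OF g]) auto
    have "(\<integral>x. \<theta> t x *\<^sub>R (x - c) \<partial>lebesgue) = m *\<^sub>R c - m *\<^sub>R c"
      using first_moment[OF assms] g mass_eq[OF assms] by (simp add: scaleR_diff_right)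
    then show "(\<integral>x. x \<partial>\<nu> t) = 0"
      unfolding \<nu>_def by (subst integral_charge[OF g]) auto
    show "(\<integral>\<^sup>+z. ennreal (norm (y - z) powr (- (1 + \<alpha>))) \<partial>\<nu> t) \<le> ennreal U" for y
      by (rule potential_le_U[OF assms])
  qed (use \<alpha> in auto)
qed

section \<open>Time derivative of the excess along a solution\<close>

lemma inner_velocity:
  assumes "0 \<le> t"
  shows "velocity \<alpha> (\<theta> t) x \<bullet> (x - c) = \<kappa> * torque \<alpha> (\<nu> t) (x - c)"
proof -
  note g = integrable_\<theta>[OF assms] nonneg_\<theta>[OF assms]
  have [measurable]: "\<theta> t \<in> borel_measurable lebesgue" using assms by (rule measurable_\<theta>)
  have [measurable]: "f \<in> lebesgue \<rightarrow>\<^sub>M borel" if "f \<in> borel \<rightarrow>\<^sub>M borel" for f :: "real^2 \<Rightarrow> 'a :: topological_space"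
    using that by (intro measurable_completion) simp
  have "(\<integral>\<^sup>+y. ennreal (\<theta> t y) * ennreal (norm (x - c - (y - c)) powr (- (1 + \<alpha>))) \<partial>lebesgue) \<le> ennreal U"
    using potential_le_U[OF assms, of "x - c"] unfolding \<nu>_def
    by (subst (asm) nn_integral_charge[OF g]) auto
  then have bound: "(\<integral>\<^sup>+y. ennreal (\<theta> t y) * ennreal (norm (x - y) powr (- (1 + \<alpha>))) \<partial>lebesgue) \<le> ennreal U"
    by simp
  have int: "integrable lebesgue (\<lambda>y. \<theta> t y *\<^sub>R kernel \<alpha> (x - y))"
  proof (rule integrableI_bounded)
    have "(\<integral>\<^sup>+y. ennreal (norm (\<theta> t y *\<^sub>R kernel \<alpha> (x - y))) \<partial>lebesgue)
        \<le> (\<integral>\<^sup>+y. ennreal \<bar>\<kappa>\<bar> * (ennreal (\<theta> t y) * ennreal (norm (x - y) powr (- (1 + \<alpha>)))) \<partial>lebesgue)"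
    proof (rule nn_integral_mono_AE)
      show "AE y in lebesgue. ennreal (norm (\<theta> t y *\<^sub>R kernel \<alpha> (x - y)))
          \<le> ennreal \<bar>\<kappa>\<bar> * (ennreal (\<theta> t y) * ennreal (norm (x - y) powr (- (1 + \<alpha>))))"
        \<comment> \<open>The point \<open>y = x\<close>, where the kernel has an unspecified value,
          is a null set.\<close>
        using nonneg_\<theta>[OF assms] AE_lebesgue_neq[of x]
      proof eventually_elim
        case (elim y)
        then have "norm (kernel \<alpha> (x - y)) = \<bar>\<kappa>\<bar> * norm (x - y) powr (- (1 + \<alpha>))"
          unfolding \<kappa>_def by (intro norm_kernel) auto
        then show ?case using elim by (simp add: ennreal_mult[symmetric] mult.left_commute)
      qed
    qed
    also have "\<dots> = ennreal \<bar>\<kappa>\<bar> * (\<integral>\<^sup>+y. ennreal (\<theta> t y) * ennreal (norm (x - y) powr (- (1 + \<alpha>))) \<partial>lebesgue)"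
      by (rule nn_integral_cmult) measurable
    also have "\<dots> \<le> ennreal \<bar>\<kappa>\<bar> * ennreal U" using bound by (rule mult_left_mono) simp
    also have "\<dots> < \<infinity>" by (simp add: ennreal_mult_less_top)
    finally show "(\<integral>\<^sup>+y. ennreal (norm (\<theta> t y *\<^sub>R kernel \<alpha> (x - y))) \<partial>lebesgue) < \<infinity>" .
  qed measurable
  have "velocity \<alpha> (\<theta> t) x \<bullet> (x - c) = (\<integral>y. (x - c) \<bullet> (\<theta> t y *\<^sub>R kernel \<alpha> (x - y)) \<partial>lebesgue)"
    unfolding velocity_def using int by (subst integral_inner_right) (auto simp: inner_commute)
  also have "\<dots> = (\<integral>y. \<kappa> * (\<theta> t y *\<^sub>R angular_kernel \<alpha> (x - c) (y - c)) \<partial>lebesgue)"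
  proof (rule integral_cong_AE)
    show "AE y in lebesgue. (x - c) \<bullet> (\<theta> t y *\<^sub>R kernel \<alpha> (x - y))
        = \<kappa> * (\<theta> t y *\<^sub>R angular_kernel \<alpha> (x - c) (y - c))"
      using AE_lebesgue_neq[of x]
    proof eventually_elim
      case (elim y)
      then show ?case using inner_kernel[of x y c \<alpha>] by (simp add: \<kappa>_def mult_ac)
    qed
  qed measurable
  also have "\<dots> = \<kappa> * (\<integral>y. \<theta> t y *\<^sub>R angular_kernel \<alpha> (x - c) (y - c) \<partial>lebesgue)" by simp
  also have "(\<integral>y. \<theta> t y *\<^sub>R angular_kernel \<alpha> (x - c) (y - c) \<partial>lebesgue) = torque \<alpha> (\<nu> t) (x - c)"
    unfolding torque_def \<nu>_def by (subst integral_charge[OF g]) auto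
  finally show ?thesis .
qed

text \<open>The weak formulation with a test function constant in time: its gradient is a multiple
  of \<open>x - c\<close>, so the velocity enters only through the torque, and the factor 2 comes
  from differentiating the squared radius.\<close>

lemma soft_cap_derivative:
  assumes eps: "0 < \<epsilon>" and t: "0 \<le> t"
  shows "((\<lambda>t. \<integral>x. soft_cap \<epsilon> ((norm x)\<^sup>2 - s) \<partial>\<nu> t) has_real_derivative
    2 * \<kappa> * (\<integral>x. soft_cap' \<epsilon> ((norm x)\<^sup>2 - s) * torque \<alpha> (\<nu> t) x \<partial>\<nu> t)) (at t within {0..})"
proof -
  let ?f = "\<lambda>x (t::real). soft_cap \<epsilon> ((norm (x - c))\<^sup>2 - s)"
  note g = integrable_\<theta> nonneg_\<theta>
  interpret centered_measure "\<nu> t" \<alpha> I U using t by (rule centered_measure_\<nu>)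
  have [measurable]: "(\<lambda>x::real^2. soft_cap \<epsilon> ((norm x)\<^sup>2 - s)) \<in> borel_measurable borel"
    unfolding soft_cap_def soft_plus_def by measurable
  have "((\<lambda>t. \<integral>x. \<theta> t x * ?f x t \<partial>lebesgue) has_real_derivative
      (\<integral>x. \<theta> t x * (velocity \<alpha> (\<theta> t) x \<bullet> grad (\<lambda>y. ?f y t) x) \<partial>lebesgue)
      + (\<integral>x. \<theta> t x * dt ?f x t \<partial>lebesgue)) (at t within {0..})"
    using solution test_function_soft_cap[OF eps, of c s] t
    unfolding active_scalar_solution_def weak_solution_def by blast
  also have "(\<integral>x. \<theta> t x * dt ?f x t \<partial>lebesgue) = 0" by (simp add: dt_def)
  also have "(\<lambda>x. \<theta> t x * (velocity \<alpha> (\<theta> t) x \<bullet> grad (\<lambda>y. ?f y t) x))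
      = (\<lambda>x. \<theta> t x *\<^sub>R (2 * \<kappa> * (soft_cap' \<epsilon> ((norm (x - c))\<^sup>2 - s) * torque \<alpha> (\<nu> t) (x - c))))"
    by (simp add: grad_soft_cap_radial[OF eps] inner_velocity[OF t] fun_eq_iff)
  also have "(\<integral>x. \<theta> t x *\<^sub>R (2 * \<kappa> * (soft_cap' \<epsilon> ((norm (x - c))\<^sup>2 - s) * torque \<alpha> (\<nu> t) (x - c))) \<partial>lebesgue)
      = (\<integral>x. 2 * \<kappa> * (soft_cap' \<epsilon> ((norm x)\<^sup>2 - s) * torque \<alpha> (\<nu> t) x) \<partial>\<nu> t)"
    unfolding \<nu>_def[of t] using borel_measurable_torque[unfolded \<nu>_def]
    by (subst integral_charge[OF g, OF t t]) auto
  finally have deriv: "((\<lambda>t. \<integral>x. \<theta> t x * ?f x t \<partial>lebesgue) has_real_derivative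
      2 * \<kappa> * (\<integral>x. soft_cap' \<epsilon> ((norm x)\<^sup>2 - s) * torque \<alpha> (\<nu> t) x \<partial>\<nu> t)) (at t within {0..})"
    by simp
  have eq: "(\<integral>x. \<theta> t x * ?f x t \<partial>lebesgue) = (\<integral>x. soft_cap \<epsilon> ((norm x)\<^sup>2 - s) \<partial>\<nu> t)" if "0 \<le> t" for t
    unfolding \<nu>_def by (subst integral_charge[OF g, OF that that]) auto
  show ?thesis
    by (rule has_field_derivative_transform_within[OF deriv, of 1]) (use t eq in auto)
qed

lemma measure_annulus_\<nu>_le:
  assumes t: "0 \<le> t" and h: "0 < h" "h \<le> s"
  shows "measure (\<nu> t) {x. \<bar>(norm x)\<^sup>2 - s\<bar> \<le> h} \<le> 2 * pi * M * h"
proof -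
  interpret centered_measure "\<nu> t" \<alpha> I U using t by (rule centered_measure_\<nu>)
  have [measurable]: "{x::real^2. \<bar>(norm x)\<^sup>2 - s\<bar> \<le> h} \<in> sets borel" by measurable
  have "emeasure (\<nu> t) {x. \<bar>(norm x)\<^sup>2 - s\<bar> \<le> h} \<le> ennreal M * emeasure lborel {x::real^2. \<bar>(norm x)\<^sup>2 - s\<bar> \<le> h}"
    unfolding \<nu>_def by (rule charge_le_lebesgue[OF integrable_\<theta> nonneg_\<theta> le_M]) (use t in auto)
  also have "\<dots> \<le> ennreal M * ennreal (2 * pi * h)"
    by (intro mult_left_mono emeasure_annulus_le h) simp
  also have "\<dots> = ennreal (2 * pi * M * h)"
    using M_nonneg h by (simp add: ennreal_mult[symmetric] mult_ac)
  finally show ?thesis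
    using M_nonneg h by (simp add: emeasure_eq_measure)
qed

text \<open>The hinge itself is not an admissible test function. Its smoothed versions converge
  pointwise, and their time derivatives converge at a rate uniform in time because mass, inertia and
  maximum norm are conserved; hence limit and differentiation may be exchanged.\<close>

lemma excess_derivative:
  assumes s: "0 < s" and t: "0 \<le> t"
  shows "((\<lambda>t. excess (\<nu> t) s) has_real_derivative 2 * \<kappa> * flux \<alpha> (\<nu> t) s) (at t within {0..})"
proof -
  \<comment> \<open>Both caps are needed: \<open>h n \<le> 1\<close> for the error bound of the
    smoothed flux, and \<open>h n \<le> s\<close> for the area of the annulus.\<close>
  define h where "h n = min 1 s / real (Suc n)" for n
  have h: "0 < h n" "h n \<le> 1" "h n \<le> s" for n
  proof -
    show "0 < h n" using s by (simp add: h_def)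
    have "h n \<le> min 1 s / 1" unfolding h_def using s by (intro divide_left_mono) auto
    then show "h n \<le> 1" "h n \<le> s" by auto
  qed
  have h_lim: "h \<longlonglongrightarrow> 0"
    unfolding h_def by (rule LIMSEQ_Suc[OF lim_const_over_n])
  define C where "C = U * (sqrt (s + 1) * (2 * pi * M) + 3 * (m + I) + 2 * I)"
  let ?f = "\<lambda>n t. \<integral>x. soft_cap ((h n)\<^sup>2) ((norm x)\<^sup>2 - s) \<partial>\<nu> t"
  let ?D = "\<lambda>n t. \<integral>x. soft_cap' ((h n)\<^sup>2) ((norm x)\<^sup>2 - s) * torque \<alpha> (\<nu> t) x \<partial>\<nu> t"
  have err: "\<bar>?D n t - flux \<alpha> (\<nu> t) s\<bar> \<le> C * h n" if "0 \<le> t" for n t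
  proof -
    interpret centered_measure "\<nu> t" \<alpha> I U using that by (rule centered_measure_\<nu>)
    have "measure (\<nu> t) UNIV = m"
      unfolding \<nu>_def using measure_charge_UNIV[OF integrable_\<theta> nonneg_\<theta>] mass_eq that by simp
    then show ?thesis
      using soft_flux_error[OF U_nonneg s h(1,2) measure_annulus_\<nu>_le[OF that h(1,3)]]
      by (simp add: C_def)
  qed
  have lim: "(\<lambda>n. ?f n t) \<longlonglongrightarrow> excess (\<nu> t) s" if "0 \<le> t" for t
  proof -
    interpret centered_measure "\<nu> t" \<alpha> I U using that by (rule centered_measure_\<nu>)
    have "(\<lambda>n. (h n)\<^sup>2) \<longlonglongrightarrow> 0\<^sup>2" by (intro tendsto_intros h_lim)
    then have "(\<lambda>n. (h n)\<^sup>2) \<longlonglongrightarrow> 0" by simp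
    moreover have "0 < (h n)\<^sup>2" "(h n)\<^sup>2 \<le> 1" for n
      using h(1,2)[of n] power_le_one[of "h n" 2] by auto
    ultimately show ?thesis by (intro tendsto_integral_soft_cap s)
  qed
  have "\<exists>g. \<forall>t\<in>{0..}. (\<lambda>n. ?f n t) \<longlonglongrightarrow> g t \<and>
      (g has_derivative (\<lambda>u. 2 * \<kappa> * flux \<alpha> (\<nu> t) s * u)) (at t within {0..})"
  proof (rule has_derivative_sequence[where ?x0.0 = 0 and l = "excess (\<nu> 0) s"])
    show "((\<lambda>t. ?f n t) has_derivative (\<lambda>u. 2 * \<kappa> * ?D n t * u)) (at t within {0..})" if "t \<in> {0..}" for n t
      using soft_cap_derivative[of "(h n)\<^sup>2" t s] that h(1)[of n]
      by (simp add: has_field_derivative_def)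
    show "\<forall>\<^sub>F n in sequentially. \<forall>t\<in>{0..}. \<forall>u. norm (2 * \<kappa> * ?D n t * u - 2 * \<kappa> * flux \<alpha> (\<nu> t) s * u) \<le> e * norm u"
      if "0 < e" for e
    proof -
      have "(\<lambda>n. 2 * \<bar>\<kappa>\<bar> * (C * h n)) \<longlonglongrightarrow> 2 * \<bar>\<kappa>\<bar> * (C * 0)" by (intro tendsto_intros h_lim)
      then have "\<forall>\<^sub>F n in sequentially. 2 * \<bar>\<kappa>\<bar> * (C * h n) < e"
        using that by (intro order_tendstoD(2)) auto
      then show ?thesis
      proof eventually_elim
        case (elim n)
        show ?case
        proof (intro ballI allI)
          fix t u :: real assume "t \<in> {0..}"
          then have "2 * \<bar>\<kappa>\<bar> * \<bar>?D n t - flux \<alpha> (\<nu> t) s\<bar> \<le> 2 * \<bar>\<kappa>\<bar> * (C * h n)"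
            using err[of t n] by (intro mult_left_mono) auto
          then have "2 * \<bar>\<kappa>\<bar> * \<bar>?D n t - flux \<alpha> (\<nu> t) s\<bar> * \<bar>u\<bar> \<le> e * \<bar>u\<bar>"
            using elim by (intro mult_right_mono) auto
          moreover have "2 * \<kappa> * ?D n t * u - 2 * \<kappa> * flux \<alpha> (\<nu> t) s * u
              = 2 * \<kappa> * (?D n t - flux \<alpha> (\<nu> t) s) * u" by (simp add: algebra_simps)
          ultimately show "norm (2 * \<kappa> * ?D n t * u - 2 * \<kappa> * flux \<alpha> (\<nu> t) s * u) \<le> e * norm u"
            by (simp add: abs_mult)
        qed
      qed
    qed
    show "(\<lambda>n. ?f n 0) \<longlonglongrightarrow> excess (\<nu> 0) s" by (rule lim) simp
  qed auto
  then obtain g where g: "\<And>t. 0 \<le> t \<Longrightarrow> (\<lambda>n. ?f n t) \<longlonglongrightarrow> g t"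
    "\<And>t. 0 \<le> t \<Longrightarrow> (g has_derivative (\<lambda>u. 2 * \<kappa> * flux \<alpha> (\<nu> t) s * u)) (at t within {0..})"
    by auto
  have eq: "excess (\<nu> t) s = g t" if "0 \<le> t" for t
    using LIMSEQ_unique[OF lim g(1)] that by blast
  have "((\<lambda>t. excess (\<nu> t) s) has_derivative (\<lambda>u. 2 * \<kappa> * flux \<alpha> (\<nu> t) s * u)) (at t within {0..})"
    by (rule has_derivative_transform[OF _ _ g(2)]) (use t eq in auto)
  then show ?thesis by (simp add: has_field_derivative_def)
qed

section \<open>From vanishing excess to confinement\<close>

lemma initial_excess:
  assumes "4 * R\<^sub>0\<^sup>2 \<le> s"
  shows "excess (\<nu> 0) s = 0"
proof -
  have "excess (\<nu> 0) s = (\<integral>x. \<theta> 0 x *\<^sub>R max 0 ((norm (x - c))\<^sup>2 - s) \<partial>lebesgue)"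
    unfolding excess_def \<nu>_def by (subst integral_charge[OF integrable_\<theta> nonneg_\<theta>]) auto
  also have "\<dots> = 0"
  proof (rule integral_eq_zero_AE)
    show "AE x in lebesgue. \<theta> 0 x *\<^sub>R max 0 ((norm (x - c))\<^sup>2 - s) = 0"
      using AE_initial_ball
    proof eventually_elim
      case (elim x)
      show ?case
      proof (cases "\<theta> 0 x = 0")
        case False
        \<comment> \<open>Relative to the center of mass the initial radius is at most doubled,
          which is the origin of the threshold \<open>4 * R\<^sub>0\<^sup>2\<close>.\<close>
        then have "norm (x - c) \<le> 2 * R\<^sub>0" using elim norm_c_le norm_triangle_ineq4[of x c] by simp
        then have "(norm (x - c))\<^sup>2 \<le> (2 * R\<^sub>0)\<^sup>2" by (intro power_mono) auto
        then show ?thesis using assms by (simp add: power_mult_distrib)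
      qed simp
    qed
  qed
  finally show ?thesis .
qed

lemma ess_support_subset:
  assumes t: "0 \<le> t" and S: "0 < S" "excess (\<nu> t) S = 0"
  shows "ess_support (\<theta> t) \<subseteq> cball c (sqrt S)"
proof (rule ess_support_subset_cball)
  note g = integrable_\<theta>[OF t] nonneg_\<theta>[OF t]
  interpret centered_measure "\<nu> t" \<alpha> I U using t by (rule centered_measure_\<nu>)
  have "integrable lebesgue (\<lambda>x. \<theta> t x *\<^sub>R max 0 ((norm (x - c))\<^sup>2 - S))"
    using integrable_excess[of S] unfolding \<nu>_def by (subst (asm) integrable_charge[OF g]) auto
  moreover have "AE x in lebesgue. 0 \<le> \<theta> t x *\<^sub>R max 0 ((norm (x - c))\<^sup>2 - S)"
    using nonneg_\<theta>[OF t] by eventually_elim simp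
  moreover have "(\<integral>x. \<theta> t x *\<^sub>R max 0 ((norm (x - c))\<^sup>2 - S) \<partial>lebesgue) = 0"
    using S(2) unfolding excess_def \<nu>_def by (subst (asm) integral_charge[OF g]) auto
  ultimately have "AE x in lebesgue. \<theta> t x *\<^sub>R max 0 ((norm (x - c))\<^sup>2 - S) = 0"
    by (simp only: integral_nonneg_eq_0_iff_AE)
  then show "AE x in lebesgue. \<theta> t x \<noteq> 0 \<longrightarrow> dist c x \<le> sqrt S"
  proof eventually_elim
    case (elim x)
    show ?case
    proof
      assume "\<theta> t x \<noteq> 0"
      then have "(norm (x - c))\<^sup>2 \<le> S" using elim by (auto simp: max_def split: if_splits)
      then have "norm (x - c) \<le> sqrt S" by (rule real_le_rsqrt)
      then show "dist c x \<le> sqrt S" by (simp add: dist_norm norm_minus_commute)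
    qed
  qed
qed

text \<open>The front starts at twice the threshold, that is at
  \<open>8 * R\<^sub>0\<^sup>2\<close>, whose square root is strictly below
  \<open>3 * R\<^sub>0\<close>. Returning from the center of mass to the origin adds at most one
  more \<open>R\<^sub>0\<close>, which accounts for the factor 4 and for strictness.\<close>

lemma confinement:
  fixes t :: real
  defines "B \<equiv> 4 / 3 * (2 + \<alpha> / 2) * (\<bar>2 * \<kappa>\<bar> * spread_rate \<alpha> I + 1)"
  assumes t: "0 \<le> t" and x: "x \<in> ess_support (\<theta> t)"
  shows "norm x < 4 * R\<^sub>0 + (B * t) powr (1 / (4 + \<alpha>))"
proof -
  define q where "q = 2 + \<alpha> / 2"
  define S where "S = front \<alpha> (2 * (4 * R\<^sub>0\<^sup>2)) B t"
  have R: "0 < R\<^sub>0" by (rule R\<^sub>0_pos)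
  have "0 \<le> spread_rate \<alpha> I" using I_pos \<alpha> by (intro spread_rate_nonneg) auto
  then have B: "0 \<le> B" using \<alpha> by (simp add: B_def)
  have S_pos: "0 < S" unfolding S_def using R B t by (intro front_pos) auto
  have "excess (\<nu> t) S = 0"
    unfolding S_def B_def
  proof (rule excess_vanishes_beyond_front[where \<nu> = \<nu> and U = U and m = m])
    show "measure (\<nu> t) UNIV = m" if "0 \<le> t" for t
      unfolding \<nu>_def using measure_charge_UNIV[OF integrable_\<theta> nonneg_\<theta>] mass_eq that by simp
    show "excess (\<nu> 0) s = 0" if "4 * R\<^sub>0\<^sup>2 \<le> s" for s using that by (rule initial_excess)
  qed (use centered_measure_\<nu> excess_derivative R I_pos \<alpha> t in auto)
  then have "dist c x \<le> sqrt S" using ess_support_subset[OF t S_pos] x by auto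
  then have "norm x \<le> R\<^sub>0 + sqrt S"
    using norm_c_le norm_triangle_ineq[of c "x - c"] by (simp add: dist_norm norm_minus_commute)
  also have "sqrt S = ((8 * R\<^sub>0\<^sup>2) powr q + B * t) powr (1 / (4 + \<alpha>))"
  proof -
    have "1 / q * (1 / 2) = 1 / (4 + \<alpha>)" using \<alpha> by (simp add: q_def field_simps)
    then show ?thesis
      using S_pos by (simp add: S_def front_def q_def[symmetric] powr_half_sqrt[symmetric] powr_powr)
  qed
  also have "\<dots> \<le> ((8 * R\<^sub>0\<^sup>2) powr q) powr (1 / (4 + \<alpha>)) + (B * t) powr (1 / (4 + \<alpha>))"
    using \<alpha> B t by (intro powr_add_subadditive) auto
  also have "((8 * R\<^sub>0\<^sup>2) powr q) powr (1 / (4 + \<alpha>)) = sqrt (8 * R\<^sub>0\<^sup>2)"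
  proof -
    have "q * (1 / (4 + \<alpha>)) = 1 / 2" using \<alpha> by (simp add: q_def field_simps)
    then show ?thesis unfolding powr_powr by (simp add: powr_half_sqrt)
  qed
  also have "sqrt (8 * R\<^sub>0\<^sup>2) < 3 * R\<^sub>0"
    using R by (intro real_less_lsqrt) (auto simp: power_mult_distrib)
  finally show ?thesis by simp
qed

end

theorem theorem3p1:
  fixes \<alpha> :: real
  assumes "0 < \<alpha>" and "\<alpha> < 1"
  shows "\<exists>C\<^sub>0 :: real \<Rightarrow> real \<Rightarrow> real \<Rightarrow> real \<Rightarrow> real.
    \<forall>(R\<^sub>0::real) (\<theta>\<^sub>0 :: real^2 \<Rightarrow> real) (\<theta> :: real \<Rightarrow> real^2 \<Rightarrow> real).
      in_Linfty \<theta>\<^sub>0 \<and>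
      (AE x in lebesgue. 0 \<le> \<theta>\<^sub>0 x) \<and> \<not> (AE x in lebesgue. \<theta>\<^sub>0 x = 0) \<and>
      compact (ess_support \<theta>\<^sub>0) \<and> ess_support \<theta>\<^sub>0 \<subseteq> cball 0 R\<^sub>0 \<and>
      active_scalar_solution \<alpha> \<theta>\<^sub>0 \<theta>
      \<longrightarrow> (\<forall>t\<ge>0. ess_support (\<theta> t) \<subseteq>
             {x. norm x < 4 * R\<^sub>0
                  + C\<^sub>0 (inertia \<theta>\<^sub>0) R\<^sub>0 (total_mass \<theta>\<^sub>0) (Linfty_norm \<theta>\<^sub>0)
                    * (t * ln (2 + t)) powr (1 / (4 + \<alpha>))})"
proof -
  define B where "B i = 4 / 3 * (2 + \<alpha> / 2) * (\<bar>2 * (\<alpha> * green_const \<alpha>)\<bar> * spread_rate \<alpha> i + 1)" for i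
  \<comment> \<open>As \<open>ln (2 + t) \<ge> ln 2\<close>, the time \<open>t\<close> is at most
    \<open>t * ln (2 + t) / ln 2\<close>; dividing by \<open>ln 2\<close> turns the bound in
    \<open>t\<close> alone into one with the logarithm.\<close>
  define C\<^sub>0 :: "real \<Rightarrow> real \<Rightarrow> real \<Rightarrow> real \<Rightarrow> real"
    where "C\<^sub>0 i r m M = (B i / ln 2) powr (1 / (4 + \<alpha>))" for i r m M
  show ?thesis
  proof (intro exI[of _ C\<^sub>0] allI impI subsetI)
    fix R\<^sub>0 t :: real and \<theta>\<^sub>0 :: "real^2 \<Rightarrow> real" and \<theta> :: "real \<Rightarrow> real^2 \<Rightarrow> real" and x :: "real^2"
    assume A: "in_Linfty \<theta>\<^sub>0 \<and>
      (AE x in lebesgue. 0 \<le> \<theta>\<^sub>0 x) \<and> \<not> (AE x in lebesgue. \<theta>\<^sub>0 x = 0) \<and>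
      compact (ess_support \<theta>\<^sub>0) \<and> ess_support \<theta>\<^sub>0 \<subseteq> cball 0 R\<^sub>0 \<and>
      active_scalar_solution \<alpha> \<theta>\<^sub>0 \<theta>"
      and t: "0 \<le> t" and x: "x \<in> ess_support (\<theta> t)"
    interpret scalar_flow \<alpha> R\<^sub>0 \<theta>\<^sub>0 \<theta> using A assms by unfold_locales auto
    \<comment> \<open>The constant refers to the given datum, while \<open>I\<close> is computed
      from the solution at time zero; the two functions agree only almost everywhere.\<close>
    have "inertia \<theta>\<^sub>0 = I"
    proof -
      have "\<theta>\<^sub>0 \<in> borel_measurable lebesgue" using A by (simp add: in_Linfty_def)
      moreover have "(\<lambda>x::real^2. (norm x)\<^sup>2) \<in> borel_measurable lebesgue"
        by (intro measurable_completion) simp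
      ultimately show ?thesis
        unfolding inertia_def I_def using initial measurable_\<theta>[of 0]
        by (intro integral_cong_AE) (auto intro!: borel_measurable_times elim!: eventually_mono)
    qed
    moreover have "norm x < 4 * R\<^sub>0 + (B I * t) powr (1 / (4 + \<alpha>))"
      using confinement[OF t x] by (simp add: B_def \<kappa>_def)
    moreover have "(B I * t) powr (1 / (4 + \<alpha>)) \<le> C\<^sub>0 I R\<^sub>0 (total_mass \<theta>\<^sub>0) (Linfty_norm \<theta>\<^sub>0) * (t * ln (2 + t)) powr (1 / (4 + \<alpha>))"
    proof -
      have "0 \<le> spread_rate \<alpha> I" using I_pos assms by (intro spread_rate_nonneg) auto
      then have B: "0 \<le> B I" using assms by (simp add: B_def)
      have "t * ln 2 \<le> t * ln (2 + t)" using t by (intro mult_left_mono) auto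
      then have "B I / ln 2 * (t * ln 2) \<le> B I / ln 2 * (t * ln (2 + t))"
        by (rule mult_left_mono) (use B in simp)
      then have "(B I * t) powr (1 / (4 + \<alpha>)) \<le> (B I / ln 2 * (t * ln (2 + t))) powr (1 / (4 + \<alpha>))"
        using B t assms by (intro powr_mono2) auto
      also have "\<dots> = (B I / ln 2) powr (1 / (4 + \<alpha>)) * (t * ln (2 + t)) powr (1 / (4 + \<alpha>))"
        by (rule powr_mult)
      finally show ?thesis by (simp add: C\<^sub>0_def)
    qed
    ultimately show "x \<in> {x. norm x < 4 * R\<^sub>0
        + C\<^sub>0 (inertia \<theta>\<^sub>0) R\<^sub>0 (total_mass \<theta>\<^sub>0) (Linfty_norm \<theta>\<^sub>0) * (t * ln (2 + t)) powr (1 / (4 + \<alpha>))}"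
      by simp
  qed
qed

end
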